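(* Let $\Gamma\curvearrowright^{\sigma}A$ and $\Lambda\curvearrowright^{\alpha}B$ be properly outer (over the center) trace preserving actions of countable discrete groups on finite von Neumann algebras. Assume that $\Theta:A\rtimes\Gamma\to B\rtimes\Lambda$ is a $\ast$-isomorphism satisfying the following conditions: (i) $\Theta(A)=B$, and (ii) there exist $0<\varepsilon<1$ and a finite subset $K\subseteq B\rtimes\Lambda$ such that for every $\gamma\in\Gamma$ we have $$\Big\|\Theta(u_\gamma)-\sum_{a,b,c,d\in K}a\,E_{L(\Lambda)}\big(b\,\Theta(u_\gamma)\,c\big)\,d\Big\|_2\le\varepsilon .$$ Then one can find $D>0$ and a finite subset $F\subseteq B$ such that for every $\gamma\in\Gamma$ there exists $\lambda\in\Lambda$ satisfying $$\max_{b,c\in F}\big|\tau\big(b^*\,\Theta(u_\gamma)\,c\,v_\lambda\big)\big|\ge D>0 .$$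
   Context: A trace preserving action $\Gamma\curvearrowright^{\sigma}A$ on a finite von Neumann algebra is called properly outer over the center of $A$ if for every $\gamma\ne1$ and every $0\neq z\in\mathcal Z(A)$ (central projection) with $\sigma_\gamma(z)=z$, the automorphism $\sigma_\gamma:Az\to Az$ is not inner. (When $A$ is abelian this is the usual freeness of the action.) $\{u_\gamma\}_{\gamma\in\Gamma}$ and $\{v_\lambda\}_{\lambda\in\Lambda}$ are the canonical group unitaries in $A\rtimes\Gamma$ and $B\rtimes\Lambda$, $\tau$ is the canonical trace on $B\rtimes\Lambda$, $\|x\|_2=\tau(x^*x)^{1/2}$, and $E_{L(\Lambda)}:B\rtimes\Lambda\to L(\Lambda)$ is the trace-preserving conditional expectation onto the von Neumann subalgebra generated by $\{v_\lambda\}$. *)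

theory Defs
  imports "HOL-Analysis.Analysis"
begin

section \<open>Complex Hilbert spaces\<close>

class scaleC =
  fixes scaleC :: "complex \<Rightarrow> 'a \<Rightarrow> 'a"  (infixr \<open>*\<^sub>C\<close> 75)

text \<open>
  The norm and the metric are those of the underlying real Hilbert space, whose inner product is
  the real part of the complex one. The complex inner product is linear in the second argument.
\<close>

class complex_hilbert = real_inner + complete_space + scaleC +
  fixes cinner :: "'a \<Rightarrow> 'a \<Rightarrow> complex"
  assumes scaleC_add_right: "c *\<^sub>C (x + y) = c *\<^sub>C x + c *\<^sub>C y"
    and scaleC_add_left: "(c + d) *\<^sub>C x = c *\<^sub>C x + d *\<^sub>C x"
    and scaleC_scaleC: "c *\<^sub>C d *\<^sub>C x = (c * d) *\<^sub>C x"
    and scaleC_of_real: "of_real r *\<^sub>C x = r *\<^sub>R x"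
    and cinner_commute: "cinner x y = cnj (cinner y x)"
    and cinner_add_right: "cinner x (y + z) = cinner x y + cinner x z"
    and cinner_scaleC_right: "cinner x (c *\<^sub>C y) = c * cinner x y"
    and Re_cinner: "Re (cinner x y) = inner x y"

lemma scaleC_zero_right [simp]: "c *\<^sub>C (0::'a::complex_hilbert) = 0"
  using scaleC_add_right[of c "0::'a" 0] by simp

lemma scaleC_minus_right: "c *\<^sub>C (- x) = - (c *\<^sub>C (x::'a::complex_hilbert))"
proof (rule minus_unique[symmetric])
  show "c *\<^sub>C x + c *\<^sub>C (- x) = 0"
    by (simp flip: scaleC_add_right)
qed

lemma scaleC_diff_right: "c *\<^sub>C (x - y) = c *\<^sub>C x - c *\<^sub>C (y::'a::complex_hilbert)"
  using scaleC_add_right[of c x "- y"] by (simp add: scaleC_minus_right)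

lemma Im_cinner: "Im (cinner x y) = - inner x (\<i> *\<^sub>C (y::'a::complex_hilbert))"
  by (simp flip: Re_cinner add: cinner_scaleC_right)

lemma cinner_scaleC_left: "cinner (c *\<^sub>C x) y = cnj c * cinner x (y::'a::complex_hilbert)"
proof -
  have "cinner (c *\<^sub>C x) y = cnj (cinner y (c *\<^sub>C x))" by (rule cinner_commute)
  also have "\<dots> = cnj c * cnj (cinner y x)" by (simp add: cinner_scaleC_right)
  also have "cnj (cinner y x) = cinner x y" by (rule cinner_commute[symmetric])
  finally show ?thesis .
qed

lemma norm_scaleC: "norm (c *\<^sub>C (x::'a::complex_hilbert)) = cmod c * norm x"
proof -
  have *: "cinner z z = of_real ((norm z)\<^sup>2)" for z :: 'a
  proof (rule complex_eqI)
    show "Re (cinner z z) = Re (complex_of_real ((norm z)\<^sup>2))"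
      by (simp add: Re_cinner power2_norm_eq_inner)
    have "Im (cinner z z) = Im (cnj (cinner z z))"
      by (rule arg_cong[OF cinner_commute])
    thus "Im (cinner z z) = Im (complex_of_real ((norm z)\<^sup>2))"
      by simp
  qed
  have "complex_of_real ((norm (c *\<^sub>C x))\<^sup>2) = (c * cnj c) * of_real ((norm x)\<^sup>2)"
    unfolding *[symmetric] by (simp only: cinner_scaleC_left cinner_scaleC_right ac_simps)
  also have "\<dots> = complex_of_real ((cmod c * norm x)\<^sup>2)"
    by (simp only: complex_norm_square[symmetric] of_real_mult power_mult_distrib of_real_power)
  finally have "(norm (c *\<^sub>C x))\<^sup>2 = (cmod c * norm x)\<^sup>2"
    by (simp only: of_real_eq_iff)
  thus ?thesis by (simp add: power2_eq_iff_nonneg)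
qed


section \<open>The Hilbert space of square summable functions with values in a Hilbert space\<close>

definition square_summable :: "('g \<Rightarrow> 'h::real_inner) \<Rightarrow> bool" where
  "square_summable f \<longleftrightarrow> (\<lambda>g. (norm (f g))\<^sup>2) summable_on UNIV"

lemma square_summable_0: "square_summable (\<lambda>_. 0)"
  by (simp add: square_summable_def)

lemma square_summable_add:
  assumes "square_summable f" "square_summable h"
  shows "square_summable (\<lambda>g. f g + h g)"
proof -
  have "(\<lambda>g. 2 * (norm (f g))\<^sup>2 + 2 * (norm (h g))\<^sup>2) summable_on UNIV"
    using assms unfolding square_summable_def
    by (intro summable_on_add summable_on_cmult_right)
  moreover have "(norm (f g + h g))\<^sup>2 \<le> 2 * (norm (f g))\<^sup>2 + 2 * (norm (h g))\<^sup>2" for g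
  proof -
    have "(norm (f g + h g))\<^sup>2 \<le> (norm (f g) + norm (h g))\<^sup>2"
      by (simp add: norm_triangle_ineq power_mono)
    also have "\<dots> \<le> 2 * (norm (f g))\<^sup>2 + 2 * (norm (h g))\<^sup>2"
      using sum_squares_bound[of "norm (f g)" "norm (h g)"] by (simp add: power2_sum)
    finally show ?thesis .
  qed
  ultimately show ?thesis
    unfolding square_summable_def by (rule summable_on_comparison_test) auto
qed

lemma square_summable_scaleR:
  assumes "square_summable f"
  shows "square_summable (\<lambda>g. r *\<^sub>R f g)"
  using assms unfolding square_summable_def
  by (simp add: power_mult_distrib summable_on_cmult_right)

lemma square_summable_scaleC:
  assumes "square_summable f"
  shows "square_summable (\<lambda>g. c *\<^sub>C (f g :: 'h::complex_hilbert))"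
  using assms unfolding square_summable_def
  by (simp add: norm_scaleC power_mult_distrib summable_on_cmult_right)

lemma square_summable_uminus:
  assumes "square_summable f"
  shows "square_summable (\<lambda>g. - f g)"
  using assms unfolding square_summable_def by simp

lemma square_summable_diff:
  assumes "square_summable f" "square_summable h"
  shows "square_summable (\<lambda>g. f g - h g)"
  using square_summable_add[OF assms(1) square_summable_uminus[OF assms(2)]] by simp

lemma square_summable_inner:
  assumes "square_summable f" "square_summable h"
  shows "(\<lambda>g. inner (f g) (h g)) summable_on UNIV"
proof -
  have "(\<lambda>g. (norm (f g))\<^sup>2 + (norm (h g))\<^sup>2) summable_on UNIV"
    using assms unfolding square_summable_def by (rule summable_on_add)
  moreover have "norm (inner (f g) (h g)) \<le> (norm (f g))\<^sup>2 + (norm (h g))\<^sup>2" for g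
  proof -
    have "norm (inner (f g) (h g)) \<le> norm (f g) * norm (h g)"
      by (simp add: Cauchy_Schwarz_ineq2)
    also have "\<dots> \<le> (norm (f g))\<^sup>2 + (norm (h g))\<^sup>2"
      using sum_squares_bound[of "norm (f g)" "norm (h g)"]
        mult_nonneg_nonneg[OF norm_ge_zero[of "f g"] norm_ge_zero[of "h g"]] by linarith
    finally show ?thesis .
  qed
  ultimately have "(\<lambda>g. norm (inner (f g) (h g))) summable_on UNIV"
    by (rule summable_on_comparison_test) auto
  thus ?thesis by (rule abs_summable_summable)
qed

lemma square_summable_cinner:
  assumes "square_summable f" "square_summable h"
  shows "(\<lambda>g. cinner (f g) (h g :: 'h::complex_hilbert)) summable_on UNIV"
proof -
  have "(\<lambda>g. complex_of_real (inner (f g) (h g))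
          + \<i> * complex_of_real (- inner (f g) (\<i> *\<^sub>C h g))) summable_on UNIV"
    using square_summable_inner[OF assms]
      square_summable_inner[OF assms(1) square_summable_scaleC[OF assms(2), of \<i>]]
    by (intro summable_on_add summable_on_cmult_right summable_on_of_real)
      (simp_all add: summable_on_uminus)
  moreover have "complex_of_real (inner (f g) (h g))
          + \<i> * complex_of_real (- inner (f g) (\<i> *\<^sub>C h g)) = cinner (f g) (h g)" for g
    by (rule complex_eqI) (simp_all add: Re_cinner Im_cinner)
  ultimately show ?thesis by simp
qed

typedef (overloaded) ('g, 'h) ell2 = "{f :: 'g \<Rightarrow> 'h::complex_hilbert. square_summable f}"
  morphisms ell2_fun Ell2
  using square_summable_0 by blast

setup_lifting type_definition_ell2

lemma square_summable_ell2_fun: "square_summable (ell2_fun x)"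
  using ell2_fun by blast

instantiation ell2 :: (type, complex_hilbert) real_inner
begin

lift_definition zero_ell2 :: "('a, 'b) ell2" is "\<lambda>_. 0"
  by (rule square_summable_0)

lift_definition plus_ell2 :: "('a, 'b) ell2 \<Rightarrow> ('a, 'b) ell2 \<Rightarrow> ('a, 'b) ell2"
  is "\<lambda>x y g. x g + y g" by (rule square_summable_add)

lift_definition minus_ell2 :: "('a, 'b) ell2 \<Rightarrow> ('a, 'b) ell2 \<Rightarrow> ('a, 'b) ell2"
  is "\<lambda>x y g. x g - y g" by (rule square_summable_diff)

lift_definition uminus_ell2 :: "('a, 'b) ell2 \<Rightarrow> ('a, 'b) ell2"
  is "\<lambda>x g. - x g" by (rule square_summable_uminus)

lift_definition scaleR_ell2 :: "real \<Rightarrow> ('a, 'b) ell2 \<Rightarrow> ('a, 'b) ell2"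
  is "\<lambda>r x g. r *\<^sub>R x g" by (rule square_summable_scaleR)

definition inner_ell2 :: "('a, 'b) ell2 \<Rightarrow> ('a, 'b) ell2 \<Rightarrow> real" where
  "inner_ell2 x y = (\<Sum>\<^sub>\<infinity>g. inner (ell2_fun x g) (ell2_fun y g))"

definition norm_ell2 :: "('a, 'b) ell2 \<Rightarrow> real" where
  "norm_ell2 x = sqrt (inner x x)"

definition sgn_ell2 :: "('a, 'b) ell2 \<Rightarrow> ('a, 'b) ell2" where
  "sgn_ell2 x = inverse (norm x) *\<^sub>R x"

definition dist_ell2 :: "('a, 'b) ell2 \<Rightarrow> ('a, 'b) ell2 \<Rightarrow> real" where
  "dist_ell2 x y = norm (x - y)"

definition uniformity_ell2 :: "(('a, 'b) ell2 \<times> ('a, 'b) ell2) filter" where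
  "uniformity_ell2 = (INF e\<in>{0<..}. principal {(x, y). dist x y < e})"

definition open_ell2 :: "('a, 'b) ell2 set \<Rightarrow> bool" where
  "open_ell2 U \<longleftrightarrow> (\<forall>x\<in>U. eventually (\<lambda>(x', y). x' = x \<longrightarrow> y \<in> U) uniformity)"

instance
proof
  fix x y z :: "('a, 'b) ell2" and a b :: real
  note ss = square_summable_ell2_fun
  note ssi = square_summable_inner[OF ss ss]
  show "x + y + z = x + (y + z)" by transfer (simp add: add.assoc)
  show "x + y = y + x" by transfer (simp add: add.commute)
  show "0 + x = x" by transfer simp
  show "- x + x = 0" by transfer simp
  show "x - y = x + - y" by transfer simp
  show "a *\<^sub>R (x + y) = a *\<^sub>R x + a *\<^sub>R y" by transfer (simp add: scaleR_add_right)
  show "(a + b) *\<^sub>R x = a *\<^sub>R x + b *\<^sub>R x" by transfer (simp add: scaleR_add_left)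
  show "a *\<^sub>R b *\<^sub>R x = (a * b) *\<^sub>R x" by transfer simp
  show "1 *\<^sub>R x = x" by transfer simp
  show "sgn x = inverse (norm x) *\<^sub>R x" by (rule sgn_ell2_def)
  show "dist x y = norm (x - y)" by (rule dist_ell2_def)
  show "(uniformity :: (('a, 'b) ell2 \<times> ('a, 'b) ell2) filter) =
      (INF e\<in>{0<..}. principal {(x, y). dist x y < e})" by (rule uniformity_ell2_def)
  show "open U \<longleftrightarrow> (\<forall>x\<in>U. eventually (\<lambda>(x', y). x' = x \<longrightarrow> y \<in> U) uniformity)"
    for U :: "('a, 'b) ell2 set" by (rule open_ell2_def)
  show "inner x y = inner y x" by (simp add: inner_ell2_def inner_commute)
  show "inner (x + y) z = inner x z + inner y z"
    by (simp add: inner_ell2_def plus_ell2.rep_eq inner_add_left infsum_add ssi)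
  show "inner (a *\<^sub>R x) y = a * inner x y"
    by (simp add: inner_ell2_def scaleR_ell2.rep_eq infsum_cmult_right')
  show "0 \<le> inner x x" by (simp add: inner_ell2_def infsum_nonneg)
  show "inner x x = 0 \<longleftrightarrow> x = 0"
  proof
    assume "inner x x = 0"
    hence "inner (ell2_fun x g) (ell2_fun x g) = 0" for g
      using nonneg_infsum_le_0D[OF _ ssi[of x x], of g] by (simp add: inner_ell2_def)
    thus "x = 0" by (simp add: ell2_fun_inject[symmetric] zero_ell2.rep_eq fun_eq_iff)
  qed (simp add: inner_ell2_def zero_ell2.rep_eq)
  show "norm x = sqrt (inner x x)" by (rule norm_ell2_def)
qed

end

instantiation ell2 :: (type, complex_hilbert) complex_hilbert
begin

lift_definition scaleC_ell2 :: "complex \<Rightarrow> ('a, 'b) ell2 \<Rightarrow> ('a, 'b) ell2"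
  is "\<lambda>c x g. c *\<^sub>C x g" by (rule square_summable_scaleC)

definition cinner_ell2 :: "('a, 'b) ell2 \<Rightarrow> ('a, 'b) ell2 \<Rightarrow> complex" where
  "cinner_ell2 x y = (\<Sum>\<^sub>\<infinity>g. cinner (ell2_fun x g) (ell2_fun y g))"

instance
proof
  fix x y z :: "('a, 'b) ell2" and r :: real and c d :: complex
  note ssc = square_summable_cinner[OF square_summable_ell2_fun square_summable_ell2_fun]
  note ssi = square_summable_inner[OF square_summable_ell2_fun square_summable_ell2_fun]
  show "c *\<^sub>C (x + y) = c *\<^sub>C x + c *\<^sub>C y" by transfer (simp add: scaleC_add_right)
  show "(c + d) *\<^sub>C x = c *\<^sub>C x + d *\<^sub>C x" by transfer (simp add: scaleC_add_left)
  show "c *\<^sub>C d *\<^sub>C x = (c * d) *\<^sub>C x" by transfer (simp add: scaleC_scaleC)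
  show "of_real r *\<^sub>C x = r *\<^sub>R x" by transfer (simp add: scaleC_of_real)
  show "cinner x y = cnj (cinner y x)"
    unfolding cinner_ell2_def infsum_cnj[symmetric] by (rule infsum_cong) (rule cinner_commute)
  show "cinner x (y + z) = cinner x y + cinner x z"
    by (simp add: cinner_ell2_def plus_ell2.rep_eq cinner_add_right infsum_add ssc)
  show "cinner x (c *\<^sub>C y) = c * cinner x y"
    by (simp add: cinner_ell2_def scaleC_ell2.rep_eq cinner_scaleC_right infsum_cmult_right')
  show "Re (cinner x y) = inner x y"
    by (simp add: cinner_ell2_def inner_ell2_def infsum_Re[symmetric] ssc Re_cinner)
next
  fix X :: "nat \<Rightarrow> ('a, 'b) ell2"
  assume "Cauchy X"
  have norm_sq: "(norm x)\<^sup>2 = (\<Sum>\<^sub>\<infinity>g. (norm (ell2_fun x g))\<^sup>2)" for x :: "('a, 'b) ell2"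
    by (simp add: norm_ell2_def inner_ell2_def power2_norm_eq_inner infsum_nonneg)
  have fin_le: "(\<Sum>g\<in>F. (norm (ell2_fun x g))\<^sup>2) \<le> (norm x)\<^sup>2" if "finite F"
    for F and x :: "('a, 'b) ell2"
    unfolding norm_sq using that square_summable_ell2_fun[of x]
    by (intro finite_sum_le_infsum) (auto simp: square_summable_def)
  have coord: "norm (ell2_fun x g) \<le> norm x" for g and x :: "('a, 'b) ell2"
  proof -
    have "0 \<le> norm x" by (simp add: norm_ell2_def inner_ell2_def infsum_nonneg)
    thus ?thesis using fin_le[of "{g}" x] by (simp add: power2_le_iff_abs_le)
  qed
  have C: "\<exists>N. \<forall>m\<ge>N. \<forall>n\<ge>N. norm (X m - X n) < e" if e: "e > 0" for e
  proof -
    obtain N where "\<forall>m\<ge>N. \<forall>n\<ge>N. dist (X m) (X n) < e"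
      using \<open>Cauchy X\<close> e unfolding Cauchy_def by blast
    thus ?thesis unfolding dist_ell2_def by blast
  qed
  have "convergent (\<lambda>n. ell2_fun (X n) g)" for g
  proof (rule Cauchy_convergent, rule CauchyI)
    fix e :: real assume "0 < e"
    then obtain N where N: "\<forall>m\<ge>N. \<forall>n\<ge>N. norm (X m - X n) < e" using C by blast
    have "norm (ell2_fun (X m) g - ell2_fun (X n) g) < e" if "m \<ge> N" "n \<ge> N" for m n
      using coord[of "X m - X n" g] N that by (fastforce simp: minus_ell2.rep_eq)
    thus "\<exists>M. \<forall>m\<ge>M. \<forall>n\<ge>M. norm (ell2_fun (X m) g - ell2_fun (X n) g) < e" by blast
  qed
  then obtain L where L: "\<And>g. (\<lambda>n. ell2_fun (X n) g) \<longlonglongrightarrow> L g"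
    unfolding convergent_def by metis
  have bound: "(\<Sum>g\<in>F. (norm (ell2_fun (X n) g - L g))\<^sup>2) \<le> e\<^sup>2"
    if N: "\<forall>m\<ge>N. \<forall>n\<ge>N. norm (X m - X n) < e" and "n \<ge> N" "finite F" for e N n F
  proof (rule LIMSEQ_le_const2)
    show "(\<lambda>m. \<Sum>g\<in>F. (norm (ell2_fun (X n) g - ell2_fun (X m) g))\<^sup>2) \<longlonglongrightarrow>
        (\<Sum>g\<in>F. (norm (ell2_fun (X n) g - L g))\<^sup>2)"
      by (intro tendsto_intros L)
    show "\<exists>M. \<forall>m\<ge>M. (\<Sum>g\<in>F. (norm (ell2_fun (X n) g - ell2_fun (X m) g))\<^sup>2) \<le> e\<^sup>2"
    proof (intro exI allI impI)
      fix m assume "m \<ge> N"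
      have "(\<Sum>g\<in>F. (norm (ell2_fun (X n) g - ell2_fun (X m) g))\<^sup>2) \<le> (norm (X n - X m))\<^sup>2"
        using fin_le[OF \<open>finite F\<close>, of "X n - X m"] by (simp add: minus_ell2.rep_eq)
      also have "\<dots> \<le> e\<^sup>2"
        using N \<open>n \<ge> N\<close> \<open>m \<ge> N\<close>
        by (intro power_mono) (auto simp: less_imp_le norm_ell2_def inner_ell2_def infsum_nonneg)
      finally show "(\<Sum>g\<in>F. (norm (ell2_fun (X n) g - ell2_fun (X m) g))\<^sup>2) \<le> e\<^sup>2" .
    qed
  qed
  have summ: "square_summable (\<lambda>g. ell2_fun (X n) g - L g)"
    if N: "\<forall>m\<ge>N. \<forall>n\<ge>N. norm (X m - X n) < e" and "n \<ge> N" for e N n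
    unfolding square_summable_def
    by (rule nonneg_bdd_above_summable_on) (auto intro!: bdd_aboveI2 bound[OF N \<open>n \<ge> N\<close>])
  obtain N where N: "\<forall>m\<ge>N. \<forall>n\<ge>N. norm (X m - X n) < 1" using C[of 1] by auto
  have "square_summable L"
    using square_summable_diff[OF square_summable_ell2_fun[of "X N"] summ[OF N order_refl]] by simp
  hence rep: "ell2_fun (Ell2 L) = L" by (simp add: Ell2_inverse)
  have "X \<longlonglongrightarrow> Ell2 L"
    unfolding tendsto_iff eventually_sequentially
  proof (intro allI impI)
    fix e :: real assume "e > 0"
    then obtain N where N: "\<forall>m\<ge>N. \<forall>n\<ge>N. norm (X m - X n) < e / 2" using C[of "e / 2"] by auto
    have "dist (X n) (Ell2 L) < e" if "n \<ge> N" for n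
    proof -
      have "(norm (X n - Ell2 L))\<^sup>2 \<le> (e / 2)\<^sup>2"
        unfolding norm_sq minus_ell2.rep_eq rep
        using summ[OF N that] bound[OF N that]
        by (intro infsum_le_finite_sums) (auto simp: square_summable_def)
      hence "norm (X n - Ell2 L) \<le> e / 2"
        using \<open>e > 0\<close> by (auto intro: power2_le_imp_le)
      thus ?thesis using \<open>e > 0\<close> by (simp add: dist_ell2_def)
    qed
    thus "\<exists>N. \<forall>n\<ge>N. dist (X n) (Ell2 L) < e" by blast
  qed
  thus "convergent X" unfolding convergent_def by blast
qed

end

lemma norm_ell2_square: "(norm x)\<^sup>2 = (\<Sum>\<^sub>\<infinity>g. (norm (ell2_fun x g))\<^sup>2)"
  by (simp add: norm_ell2_def inner_ell2_def power2_norm_eq_inner infsum_nonneg)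

lemma norm_ell2_fun_le: "norm (ell2_fun x g) \<le> norm x"
proof -
  have "(\<Sum>h\<in>{g}. (norm (ell2_fun x h))\<^sup>2) \<le> (norm x)\<^sup>2"
    unfolding norm_ell2_square using square_summable_ell2_fun[of x]
    by (intro finite_sum_le_infsum) (auto simp: square_summable_def)
  thus ?thesis by (simp add: power2_le_iff_abs_le)
qed

lift_definition ell2_single :: "'g \<Rightarrow> 'h \<Rightarrow> ('g, 'h::complex_hilbert) ell2"
  is "\<lambda>g \<xi> h. if h = g then \<xi> else 0"
  unfolding square_summable_def
  by (rule finite_nonzero_values_imp_summable_on) (auto intro: finite_subset[of _ "{_}"])

lemma norm_ell2_single: "norm (ell2_single g \<xi>) = norm \<xi>"
proof -
  have "(norm (ell2_single g \<xi>))\<^sup>2 = (\<Sum>\<^sub>\<infinity>h. (if h = g then (norm \<xi>)\<^sup>2 else 0))"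
    unfolding norm_ell2_square ell2_single.rep_eq by (rule infsum_cong) simp
  also have "\<dots> = (\<Sum>\<^sub>\<infinity>h\<in>{g}. (norm \<xi>)\<^sup>2)"
    by (rule infsum_cong_neutral) auto
  finally show ?thesis by simp
qed


section \<open>Bounded operators on a Hilbert space\<close>

typedef (overloaded) 'h bop =
  "{f :: 'h::complex_hilbert \<Rightarrow> 'h. bounded_linear f \<and> (\<forall>c x. f (c *\<^sub>C x) = c *\<^sub>C f x)}"
  morphisms bop_apply Bop
  by (rule exI[of _ "\<lambda>x. x"]) (simp add: bounded_linear_ident)

setup_lifting type_definition_bop

lemma bop_eqI: "(\<And>x. bop_apply a x = bop_apply b x) \<Longrightarrow> a = b"
  by (simp add: bop_apply_inject[symmetric] fun_eq_iff)

lemma bounded_linear_bop_apply: "bounded_linear (bop_apply a)"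
  using bop_apply[of a] by simp

lemma bop_apply_scaleC: "bop_apply a (c *\<^sub>C x) = c *\<^sub>C bop_apply a x"
  using bop_apply[of a] by simp

text \<open>
  Multiplication is composition. The type is not an instance of class \<^class>\<open>ring_1\<close> only because
  the Hilbert space may be zero.
\<close>

instantiation bop :: (complex_hilbert) "{ring, monoid_mult, scaleC}"
begin

lift_definition zero_bop :: "'a bop" is "\<lambda>_. 0"
  by simp

lift_definition one_bop :: "'a bop" is "\<lambda>x. x"
  by (simp add: bounded_linear_ident)

lift_definition plus_bop :: "'a bop \<Rightarrow> 'a bop \<Rightarrow> 'a bop" is "\<lambda>a b x. a x + b x"
  by (auto intro: bounded_linear_add simp: scaleC_add_right)

lift_definition uminus_bop :: "'a bop \<Rightarrow> 'a bop" is "\<lambda>a x. - a x"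
  by (auto intro: bounded_linear_minus simp: scaleC_minus_right)

lift_definition minus_bop :: "'a bop \<Rightarrow> 'a bop \<Rightarrow> 'a bop" is "\<lambda>a b x. a x - b x"
  by (auto intro: bounded_linear_sub simp: scaleC_diff_right)

lift_definition times_bop :: "'a bop \<Rightarrow> 'a bop \<Rightarrow> 'a bop" is "\<lambda>a b x. a (b x)"
  by (auto intro: bounded_linear_compose)

lift_definition scaleC_bop :: "complex \<Rightarrow> 'a bop \<Rightarrow> 'a bop" is "\<lambda>c a x. c *\<^sub>C a x"
proof (intro conjI allI)
  fix c d :: complex and a :: "'a \<Rightarrow> 'a" and x
  assume a: "bounded_linear a \<and> (\<forall>c x. a (c *\<^sub>C x) = c *\<^sub>C a x)"
  have "bounded_linear (\<lambda>x::'a. c *\<^sub>C x)"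
  proof (rule bounded_linear_intro)
    fix r and x :: 'a
    show "c *\<^sub>C r *\<^sub>R x = r *\<^sub>R c *\<^sub>C x"
      by (simp add: scaleC_of_real[symmetric] scaleC_scaleC mult.commute)
    show "norm (c *\<^sub>C x) \<le> norm x * cmod c" by (simp add: norm_scaleC mult.commute)
  qed (rule scaleC_add_right)
  thus "bounded_linear (\<lambda>x. c *\<^sub>C a x)"
    using a by (auto intro: bounded_linear_compose)
  show "c *\<^sub>C a (d *\<^sub>C x) = d *\<^sub>C c *\<^sub>C a x"
    using a by (simp add: scaleC_scaleC mult.commute)
qed

instance
proof
  fix a b c :: "'a bop"
  show "a * b * c = a * (b * c)" by transfer simp
  show "1 * a = a" by transfer simp
  show "a * 1 = a" by transfer simp
  show "a + b + c = a + (b + c)" by transfer (simp add: add.assoc)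
  show "a + b = b + a" by transfer (simp add: add.commute)
  show "0 + a = a" by transfer simp
  show "- a + a = 0" by transfer simp
  show "a - b = a + - b" by transfer simp
  show "(a + b) * c = a * c + b * c" by transfer simp
  show "a * (b + c) = a * b + a * c"
    by transfer (simp add: linear_add[OF bounded_linear.linear])
qed

end

text \<open>The adjoint exists and is unique by the Riesz representation theorem.\<close>

definition adj :: "'h::complex_hilbert bop \<Rightarrow> 'h bop" where
  "adj a = (THE b. \<forall>x y. cinner (bop_apply b x) y = cinner x (bop_apply a y))"

definition positive_bop :: "'h::complex_hilbert bop \<Rightarrow> bool" where
  "positive_bop a \<longleftrightarrow> (\<forall>x. cinner x (bop_apply a x) \<in> \<real>\<^sub>\<ge>\<^sub>0)"


section \<open>Tracial von Neumann algebras\<close>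

definition commutant :: "'h::complex_hilbert bop set \<Rightarrow> 'h bop set" where
  "commutant S = {x. \<forall>s\<in>S. x * s = s * x}"

definition von_neumann_algebra :: "'h::complex_hilbert bop set \<Rightarrow> bool" where
  "von_neumann_algebra A \<longleftrightarrow> (\<forall>a\<in>A. adj a \<in> A) \<and> commutant (commutant A) = A"

definition vN_generated :: "'h::complex_hilbert bop set \<Rightarrow> 'h bop set" where
  "vN_generated S = commutant (commutant (S \<union> adj ` S))"

definition center :: "'h::complex_hilbert bop set \<Rightarrow> 'h bop set" where
  "center A = A \<inter> commutant A"

definition projection :: "'h::complex_hilbert bop \<Rightarrow> bool" where
  "projection p \<longleftrightarrow> p * p = p \<and> adj p = p"

text \<open>
  Order least upper bounds in the self-adjoint part of \<open>A\<close>. For an upward directed family they are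
  the strong limits.
\<close>

definition is_lub_in :: "'h::complex_hilbert bop set \<Rightarrow> 'h bop set \<Rightarrow> 'h bop \<Rightarrow> bool" where
  "is_lub_in A X s \<longleftrightarrow> s \<in> A \<and> adj s = s \<and> (\<forall>x\<in>X. positive_bop (s - x)) \<and>
     (\<forall>t\<in>A. adj t = t \<longrightarrow> (\<forall>x\<in>X. positive_bop (t - x)) \<longrightarrow> positive_bop (t - s))"

definition upward_directed :: "'h::complex_hilbert bop set \<Rightarrow> bool" where
  "upward_directed X \<longleftrightarrow> X \<noteq> {} \<and>
     (\<forall>x\<in>X. \<forall>y\<in>X. \<exists>z\<in>X. positive_bop (z - x) \<and> positive_bop (z - y))"

definition faithful_normal_tracial_state ::
    "'h::complex_hilbert bop set \<Rightarrow> ('h bop \<Rightarrow> complex) \<Rightarrow> bool" where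
  "faithful_normal_tracial_state A \<tau> \<longleftrightarrow>
     (\<forall>a\<in>A. \<forall>b\<in>A. \<tau> (a + b) = \<tau> a + \<tau> b) \<and>
     (\<forall>c. \<forall>a\<in>A. \<tau> (c *\<^sub>C a) = c * \<tau> a) \<and>
     (\<forall>a\<in>A. positive_bop a \<longrightarrow> \<tau> a \<in> \<real>\<^sub>\<ge>\<^sub>0) \<and>
     \<tau> 1 = 1 \<and>
     (\<forall>a\<in>A. \<forall>b\<in>A. \<tau> (a * b) = \<tau> (b * a)) \<and>
     (\<forall>a\<in>A. \<tau> (adj a * a) = 0 \<longrightarrow> a = 0) \<and>
     (\<forall>X s. X \<subseteq> A \<and> (\<forall>x\<in>X. positive_bop x) \<and> upward_directed X \<and> is_lub_in A X s \<longrightarrow>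
        Re (\<tau> s) = (SUP x\<in>X. Re (\<tau> x)))"

definition tracial_von_neumann_algebra ::
    "'h::complex_hilbert bop set \<Rightarrow> ('h bop \<Rightarrow> complex) \<Rightarrow> bool" where
  "tracial_von_neumann_algebra A \<tau> \<longleftrightarrow>
     von_neumann_algebra A \<and> faithful_normal_tracial_state A \<tau>"

definition two_norm :: "('h::complex_hilbert bop \<Rightarrow> complex) \<Rightarrow> 'h bop \<Rightarrow> real" where
  "two_norm \<tau> x = sqrt (Re (\<tau> (adj x * x)))"

definition star_isomorphism ::
    "'h::complex_hilbert bop set \<Rightarrow> 'k::complex_hilbert bop set \<Rightarrow> ('h bop \<Rightarrow> 'k bop) \<Rightarrow> bool" where
  "star_isomorphism M N \<Theta> \<longleftrightarrow> bij_betw \<Theta> M N \<and>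
     (\<forall>x\<in>M. \<forall>y\<in>M. \<Theta> (x + y) = \<Theta> x + \<Theta> y \<and> \<Theta> (x * y) = \<Theta> x * \<Theta> y) \<and>
     (\<forall>c. \<forall>x\<in>M. \<Theta> (c *\<^sub>C x) = c *\<^sub>C \<Theta> x) \<and>
     (\<forall>x\<in>M. \<Theta> (adj x) = adj (\<Theta> x))"

text \<open>
  \<open>E\<close> is the \<open>\<tau>\<close>-preserving conditional expectation of \<open>M\<close> onto \<open>N\<close>. For a faithful normal
  tracial state \<open>\<tau>\<close> on \<open>M\<close> and a von Neumann subalgebra \<open>N\<close> it exists and is unique on \<open>M\<close>.
\<close>

definition trace_preserving_cond_exp :: "('h::complex_hilbert bop \<Rightarrow> complex) \<Rightarrow>
    'h bop set \<Rightarrow> 'h bop set \<Rightarrow> ('h bop \<Rightarrow> 'h bop) \<Rightarrow> bool" where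
  "trace_preserving_cond_exp \<tau> M N E \<longleftrightarrow>
     (\<forall>x\<in>M. E x \<in> N) \<and>
     (\<forall>y\<in>N. E y = y) \<and>
     (\<forall>x\<in>M. \<forall>y\<in>M. E (x + y) = E x + E y) \<and>
     (\<forall>c. \<forall>x\<in>M. E (c *\<^sub>C x) = c *\<^sub>C E x) \<and>
     (\<forall>x\<in>M. positive_bop x \<longrightarrow> positive_bop (E x)) \<and>
     (\<forall>y\<in>N. \<forall>x\<in>M. \<forall>z\<in>N. E (y * x * z) = y * E x * z) \<and>
     (\<forall>x\<in>M. \<tau> (E x) = \<tau> x)"


section \<open>Actions and crossed products\<close>

text \<open>
  Groups are written additively (\<^class>\<open>group_add\<close> is not commutative): the neutral element is
  \<open>0\<close>, the product of \<open>g\<close> and \<open>h\<close> is \<open>g + h\<close>, and the inverse of \<open>g\<close> is \<open>- g\<close>.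
\<close>

definition trace_preserving_action :: "('g::group_add \<Rightarrow> 'h::complex_hilbert bop \<Rightarrow> 'h bop) \<Rightarrow>
    'h bop set \<Rightarrow> ('h bop \<Rightarrow> complex) \<Rightarrow> bool" where
  "trace_preserving_action \<sigma> A \<tau> \<longleftrightarrow>
     (\<forall>g. star_isomorphism A A (\<sigma> g)) \<and>
     (\<forall>a\<in>A. \<sigma> 0 a = a) \<and>
     (\<forall>g h. \<forall>a\<in>A. \<sigma> (g + h) a = \<sigma> g (\<sigma> h a)) \<and>
     (\<forall>g. \<forall>a\<in>A. \<tau> (\<sigma> g a) = \<tau> a)"

text \<open>
  \<open>\<theta>\<close> restricts to an inner automorphism of the corner \<open>Az\<close>; \<open>w\<close> ranges over the unitaries of
  \<open>Az\<close>, whose unit is \<open>z\<close>.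
\<close>

definition inner_on_corner ::
    "'h::complex_hilbert bop set \<Rightarrow> 'h bop \<Rightarrow> ('h bop \<Rightarrow> 'h bop) \<Rightarrow> bool" where
  "inner_on_corner A z \<theta> \<longleftrightarrow>
     (\<exists>w\<in>(\<lambda>a. a * z) ` A. adj w * w = z \<and> w * adj w = z \<and>
        (\<forall>a\<in>(\<lambda>a. a * z) ` A. \<theta> a = w * a * adj w))"

definition properly_outer_over_center ::
    "('g::group_add \<Rightarrow> 'h::complex_hilbert bop \<Rightarrow> 'h bop) \<Rightarrow> 'h bop set \<Rightarrow> bool" where
  "properly_outer_over_center \<sigma> A \<longleftrightarrow>
     (\<forall>g z. g \<noteq> 0 \<and> z \<in> center A \<and> projection z \<and> z \<noteq> 0 \<and> \<sigma> g z = z \<longrightarrow>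
        \<not> inner_on_corner A z (\<sigma> g))"

text \<open>
  The copy of \<open>a \<in> A\<close> in the crossed product, acting on \<open>\<ell>\<^sup>2(\<Gamma>, H)\<close> by
  \<open>(\<pi>(a) \<xi>)(g) = \<sigma>\<^bsub>-g\<^esub>(a) \<xi>(g)\<close>. Since automorphisms of \<open>A\<close> are isometric, this is a bounded
  operator.
\<close>

definition crossed_emb :: "('g::group_add \<Rightarrow> 'h::complex_hilbert bop \<Rightarrow> 'h bop) \<Rightarrow>
    'h bop \<Rightarrow> ('g, 'h) ell2 bop" where
  "crossed_emb \<sigma> a =
     (THE T. \<forall>\<xi> g. ell2_fun (bop_apply T \<xi>) g = bop_apply (\<sigma> (- g) a) (ell2_fun \<xi> g))"

lemma inj_left_translation: "inj_on ((+) (- g)) (UNIV :: 'g::group_add set)"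
  by (simp add: inj_on_def)

lemma surj_left_translation: "(+) (- g) ` UNIV = (UNIV :: 'g::group_add set)"
proof (rule surjI)
  show "- g + (g + h) = h" for h by (simp add: add.assoc[symmetric])
qed

lift_definition ell2_translate ::
    "'g::group_add \<Rightarrow> ('g, 'h::complex_hilbert) ell2 \<Rightarrow> ('g, 'h) ell2" is "\<lambda>g \<xi> h. \<xi> (- g + h)"
proof -
  fix g :: 'g and \<xi> :: "'g \<Rightarrow> 'h"
  assume "square_summable \<xi>"
  thus "square_summable (\<lambda>h. \<xi> (- g + h))"
    using summable_on_reindex[OF inj_left_translation[of g], of "\<lambda>h. (norm (\<xi> h))\<^sup>2"]
    by (simp add: square_summable_def surj_left_translation comp_def)
qed

lemma norm_ell2_translate: "norm (ell2_translate g \<xi>) = norm \<xi>"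
proof -
  have "(norm (ell2_translate g \<xi>))\<^sup>2 = (norm \<xi>)\<^sup>2"
    using infsum_reindex[OF inj_left_translation[of g], of "\<lambda>h. (norm (ell2_fun \<xi> h))\<^sup>2"]
    by (simp add: norm_ell2_square ell2_translate.rep_eq surj_left_translation comp_def)
  thus ?thesis by simp
qed

lift_definition crossed_unitary :: "'g::group_add \<Rightarrow> ('g, 'h::complex_hilbert) ell2 bop"
  is ell2_translate
proof (intro conjI allI)
  fix g :: 'g
  show "bounded_linear (ell2_translate g :: ('g, 'h) ell2 \<Rightarrow> _)"
  proof (rule bounded_linear_intro)
    show "norm (ell2_translate g x) \<le> norm x * 1" for x :: "('g, 'h) ell2"
      by (simp add: norm_ell2_translate)
  qed (transfer; simp)+
  show "ell2_translate g (c *\<^sub>C x) = c *\<^sub>C ell2_translate g x" for c and x :: "('g, 'h) ell2"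
    by transfer simp
qed

definition crossed_product :: "('g::group_add \<Rightarrow> 'h::complex_hilbert bop \<Rightarrow> 'h bop) \<Rightarrow>
    'h bop set \<Rightarrow> ('g, 'h) ell2 bop set" where
  "crossed_product \<sigma> A = vN_generated (crossed_emb \<sigma> ` A \<union> range crossed_unitary)"

definition group_vN :: "('g::group_add, 'h::complex_hilbert) ell2 bop set" where
  "group_vN = vN_generated (range crossed_unitary)"

text \<open>
  The diagonal matrix coefficient at the neutral element. On the crossed product it takes values
  in \<open>A\<close> and is the canonical conditional expectation onto \<open>A\<close>, sending \<open>\<Sum>\<^sub>g a\<^sub>g u\<^sub>g\<close>
  to \<open>a\<^sub>0\<close>.
\<close>

lift_definition coeff_0 :: "('g::group_add, 'h::complex_hilbert) ell2 bop \<Rightarrow> 'h bop"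
  is "\<lambda>x \<xi>. ell2_fun (x (ell2_single 0 \<xi>)) 0"
proof (intro conjI allI)
  fix x :: "('g, 'h) ell2 \<Rightarrow> ('g, 'h) ell2"
  assume x: "bounded_linear x \<and> (\<forall>c \<xi>. x (c *\<^sub>C \<xi>) = c *\<^sub>C x \<xi>)"
  have *: "bounded_linear (ell2_single 0 :: 'h \<Rightarrow> ('g, 'h) ell2)"
  proof (rule bounded_linear_intro)
    show "norm (ell2_single 0 \<xi> :: ('g, 'h) ell2) \<le> norm \<xi> * 1" for \<xi> :: 'h
      by (simp add: norm_ell2_single)
  qed (transfer; simp add: fun_eq_iff)+
  have **: "bounded_linear (\<lambda>\<eta> :: ('g, 'h) ell2. ell2_fun \<eta> 0)"
  proof (rule bounded_linear_intro)
    show "norm (ell2_fun \<eta> 0) \<le> norm \<eta> * 1" for \<eta> :: "('g, 'h) ell2"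
      by (simp add: norm_ell2_fun_le)
  qed (transfer; simp)+
  show "bounded_linear (\<lambda>\<xi>. ell2_fun (x (ell2_single 0 \<xi>)) 0)"
    using bounded_linear_compose[OF ** bounded_linear_compose[OF conjunct1[OF x] *]] .
  fix c and \<xi> :: 'h
  have "(ell2_single 0 (c *\<^sub>C \<xi>) :: ('g, 'h) ell2) = c *\<^sub>C ell2_single 0 \<xi>"
    by transfer (simp add: fun_eq_iff)
  thus "ell2_fun (x (ell2_single 0 (c *\<^sub>C \<xi>))) 0 = c *\<^sub>C ell2_fun (x (ell2_single 0 \<xi>)) 0"
    using x by (simp add: scaleC_ell2.rep_eq)
qed

definition crossed_trace :: "('h::complex_hilbert bop \<Rightarrow> complex) \<Rightarrow>
    ('g::group_add, 'h) ell2 bop \<Rightarrow> complex" where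
  "crossed_trace \<tau> x = \<tau> (coeff_0 x)"

end

theory Submission
  imports Defs
begin

text \<open>
  Put \<open>x = \<Theta>(u\<^sub>\<gamma>)\<close>, a unitary of \<open>M = B \<rtimes> \<Lambda>\<close> normalizing \<open>B\<close>, with Fourier coefficients
  \<open>a\<^sub>l = E\<^sub>B(x v\<^sub>l\<^sup>*)\<close>. Since \<open>a\<^sub>l\<^sup>* a\<^sub>m\<close> intertwines the identity of \<open>B\<close> with \<open>\<alpha>\<^sub>h\<close> for
  \<open>h = l m\<^sup>-\<^sup>1\<close>, proper outerness makes the ranges of the \<open>a\<^sub>l\<close> pairwise orthogonal, whence
  \<open>\<Sum>\<^sub>l |\<tau>(b x c v\<^sub>l\<^sup>*)| \<le> \<parallel>b\<parallel> \<parallel>c\<parallel>\<close> for \<open>b, c \<in> B\<close>. As \<open>\<parallel>E(y)\<parallel>\<^sub>2\<^sup>2 = \<Sum>\<^sub>l |\<tau>(y v\<^sub>l\<^sup>*)|\<^sup>2\<close> for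
  \<open>E = E\<^bsub>L(\<Lambda>)\<^esub>\<close>, this gives \<open>\<parallel>E(b x c)\<parallel>\<^sub>2\<^sup>2 \<le> \<parallel>b\<parallel> \<parallel>c\<parallel> sup\<^sub>l |\<tau>(b x c v\<^sub>l\<^sup>*)|\<close>. Condition (ii) and
  \<open>\<parallel>x\<parallel>\<^sub>2 = 1\<close> bound \<open>\<parallel>E(b x c)\<parallel>\<^sub>2\<close> below for some \<open>b, c \<in> K\<close>, and \<open>K\<close> can be replaced by finite
  Fourier sums, which are dense in the 2-norm.

  That right multiplications are 2-norm bounded on \<open>M\<close> is not obvious, because \<open>B\<close> acts on an
  arbitrary Hilbert space, where \<open>\<alpha>\<close> need not be implemented. It follows from
  \<open>T\<^bsub>g,0\<^esub> = \<alpha>\<^bsub>-g\<^esub>(T\<^bsub>0,-g\<^esub>)\<close> for the matrix entries of \<open>T \<in> M\<close>, which is tested against those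
  \<open>r \<in> B\<close> for which \<open>\<parallel>a r\<parallel>\<^sub>2 \<le> C \<parallel>a \<eta>\<parallel>\<close> for some vector \<open>\<eta>\<close> and all \<open>a \<in> B\<close>.
\<close>

section \<open>Complex inner products and the Riesz representation theorem\<close>

text \<open>A nonzero intertwiner of the identity with \<open>\<alpha> h\<close> has a polar part
  that is unitary in a central corner and implements \<open>\<alpha> h\<close> there; this is what
  proper outerness excludes. Orthogonality of ranges is exploited through the range projections p_l
  of the coefficients: their traces add up to at most 1, and Cauchy-Schwarz bounds each |\<tau>(b
  a_l c')| by a constant times \<tau>(p_l), not merely its square root. The algebra B need not carry
  its trace as a vector state, while summability in ell2 is a statement about single vectors. The
  order normality of \<tau> bridges this gap and yields Parseval for M. The canonical trace of M is
  treated as a state; invariance of its 2-norm under adjoints, a consequence of Parseval and of the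
  relation between row and column entries, does the work of cyclicity.\<close>

lemma cinner_add_left: "cinner (x + y) z = cinner x z + cinner y (z::'a::complex_hilbert)"
  by (metis cinner_add_right cinner_commute complex_cnj_add)

lemma cinner_zero_right [simp]: "cinner x (0::'a::complex_hilbert) = 0"
  using cinner_add_right[of x 0 0] by simp

lemma cinner_zero_left [simp]: "cinner (0::'a::complex_hilbert) x = 0"
  using cinner_add_left[of 0 0 x] by simp

lemma cinner_minus_right: "cinner x (- y) = - cinner x (y::'a::complex_hilbert)"
  using cinner_add_right[of x y "- y"] by (simp add: add_eq_0_iff)

lemma cinner_minus_left: "cinner (- x) y = - cinner x (y::'a::complex_hilbert)"
  using cinner_add_left[of x "- x" y] by (simp add: add_eq_0_iff)

lemma cinner_diff_right: "cinner x (y - z) = cinner x y - cinner x (z::'a::complex_hilbert)"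
  using cinner_add_right[of x y "- z"] by (simp add: cinner_minus_right)

lemma cinner_diff_left: "cinner (x - y) z = cinner x z - cinner y (z::'a::complex_hilbert)"
  using cinner_add_left[of x "- y" z] by (simp add: cinner_minus_left)

lemma cinner_sum_right: "cinner x (sum f S) = (\<Sum>i\<in>S. cinner x (f i :: 'a::complex_hilbert))"
  by (induction S rule: infinite_finite_induct) (simp_all add: cinner_add_right)

lemma cinner_self: "cinner x x = of_real ((norm (x::'a::complex_hilbert))\<^sup>2)"
proof (rule complex_eqI)
  show "Re (cinner x x) = Re (complex_of_real ((norm x)\<^sup>2))"
    by (simp add: Re_cinner power2_norm_eq_inner)
  have "Im (cinner x x) = Im (cnj (cinner x x))"
    by (rule arg_cong[OF cinner_commute])
  thus "Im (cinner x x) = Im (complex_of_real ((norm x)\<^sup>2))"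
    by simp
qed

lemma cinner_eqI: "(\<And>y. cinner y x = cinner y x') \<Longrightarrow> x = (x'::'a::complex_hilbert)"
proof -
  assume *: "\<And>y. cinner y x = cinner y x'"
  have "cinner (x - x') (x - x') = 0"
    by (simp add: cinner_diff_right *)
  thus "x = x'" by (simp add: cinner_self)
qed

text \<open>Transfers the real facts about \<open>inner\<close>, namely continuity and the Riesz
  theorem, to the complex product.\<close>

lemma complex_inner_eq:
  "cinner x y = complex_of_real (inner x y) + \<i> * complex_of_real (- inner x (\<i> *\<^sub>C (y::'a::complex_hilbert)))"
  by (rule complex_eqI) (simp_all add: Re_cinner Im_cinner)

lemma cmod_cinner_le: "cmod (cinner x y) \<le> norm x * norm (y::'a::complex_hilbert)"
proof (cases "cinner x y = 0")
  case False
  \<comment> \<open>A phase that rotates the product onto the positive axis, so that the real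
    Cauchy-Schwarz inequality applies.\<close>
  define c where "c = cnj (sgn (cinner x y))"
  have c: "cmod c = 1" using False by (simp add: c_def norm_sgn)
  have "c * cinner x y = of_real (cmod (cinner x y))"
  proof -
    have "c * cinner x y = cnj (cinner x y) * cinner x y / of_real (cmod (cinner x y))"
      by (simp add: c_def sgn_eq)
    also have "cnj (cinner x y) * cinner x y = of_real (cmod (cinner x y) * cmod (cinner x y))"
      by (simp only: mult.commute[of "cnj _"] complex_norm_square[symmetric] power2_eq_square[symmetric])
    finally show ?thesis using False by simp
  qed
  hence "cmod (cinner x y) = Re (cinner x (c *\<^sub>C y))"
    by (simp add: cinner_scaleC_right)
  also have "\<dots> \<le> norm x * norm (c *\<^sub>C y)"
    unfolding Re_cinner by (rule norm_cauchy_schwarz)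
  finally show ?thesis by (simp add: norm_scaleC c)
qed simp

lemma bounded_linear_scaleC: "bounded_linear (\<lambda>x::'a::complex_hilbert. c *\<^sub>C x)"
proof (rule bounded_linear_intro)
  fix r and x :: 'a
  show "c *\<^sub>C r *\<^sub>R x = r *\<^sub>R c *\<^sub>C x"
    by (simp add: scaleC_of_real[symmetric] scaleC_scaleC mult.commute)
  show "norm (c *\<^sub>C x) \<le> norm x * cmod c" by (simp add: norm_scaleC mult.commute)
qed (rule scaleC_add_right)

lemma tendsto_cinner:
  assumes "(f \<longlongrightarrow> x) F" "(g \<longlongrightarrow> (y::'a::complex_hilbert)) F"
  shows "((\<lambda>n. cinner (f n) (g n)) \<longlongrightarrow> cinner x y) F"
  unfolding complex_inner_eq
  by (intro tendsto_intros assms bounded_linear.tendsto[OF bounded_linear_scaleC])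

lemma scaleC_one [simp]: "1 *\<^sub>C x = (x::'a::complex_hilbert)"
  using scaleC_of_real[of 1 x] by simp

lemma scaleC_zero [simp]: "0 *\<^sub>C x = (0::'a::complex_hilbert)"
  using scaleC_of_real[of 0 x] by simp

lemma scaleC_minus1 [simp]: "(-1) *\<^sub>C x = - (x::'a::complex_hilbert)"
  using scaleC_of_real[of "-1" x] by simp

text \<open>
  \<open>V\<close> is not required to be closed. The case \<open>V = UNIV\<close> yields adjoints, the case
  \<open>f = inner x\<close> orthogonal projections. The vector \<open>\<zeta>\<close> is the limit of a minimizing
  sequence of \<open>v \<mapsto> |v|\<^sup>2/2 - f v\<close>.
\<close>

lemma riesz_subspace:
  fixes V :: "'a::{real_inner,complete_space} set" and f :: "'a \<Rightarrow> real"
  assumes V: "subspace V"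
    and add: "\<And>u v. u \<in> V \<Longrightarrow> v \<in> V \<Longrightarrow> f (u + v) = f u + f v"
    and scale: "\<And>r v. v \<in> V \<Longrightarrow> f (r *\<^sub>R v) = r * f v"
    and bound: "\<And>v. v \<in> V \<Longrightarrow> \<bar>f v\<bar> \<le> C * norm v"
  obtains \<zeta> where "\<zeta> \<in> closure V" "\<And>v. v \<in> V \<Longrightarrow> f v = inner \<zeta> v"
proof -
  define J where "J v = inner v v / 2 - f v" for v
  define m where "m = Inf (J ` V)"
  have "0 \<in> V" using V by (rule subspace_0)
  have lower: "- C\<^sup>2 / 2 \<le> J v" if "v \<in> V" for v
  proof -
    have "0 \<le> (norm v - C)\<^sup>2" by simp
    hence "0 \<le> inner v v + C\<^sup>2 - 2 * (C * norm v)"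
      by (simp add: power2_diff power2_norm_eq_inner ac_simps)
    hence "C * norm v \<le> inner v v / 2 + C\<^sup>2 / 2" by linarith
    thus ?thesis using bound[OF that] by (simp add: J_def abs_le_iff)
  qed
  have bdd: "bdd_below (J ` V)" using lower by (intro bdd_belowI2) auto
  have m_le: "m \<le> J v" if "v \<in> V" for v
    unfolding m_def using bdd that by (intro cInf_lower) auto
  have "\<exists>v\<in>V. J v < m + 1 / Suc n" for n
  proof -
    have "Inf (J ` V) < m + 1 / Suc n" by (simp add: m_def)
    thus ?thesis using \<open>0 \<in> V\<close> bdd by (subst (asm) cInf_less_iff) auto
  qed
  then obtain v where v: "\<And>n. v n \<in> V" and Jv: "\<And>n. J (v n) < m + 1 / Suc n" by metis
  \<comment> \<open>Parallelogram law: the midpoint again lies in V, so two near-minimizers of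
    \<open>J\<close> are close to each other.\<close>
  have para: "inner (a - b) (a - b) \<le> 4 * (J a + J b - 2 * m)" if "a \<in> V" "b \<in> V" for a b
  proof -
    have h: "(1/2) *\<^sub>R (a + b) \<in> V" using V that by (intro subspace_scale subspace_add)
    have "J ((1/2) *\<^sub>R (a + b)) = inner (a + b) (a + b) / 8 - (f a + f b) / 2"
      unfolding J_def scale[OF subspace_add[OF V that]] add[OF that] by simp
    also have "\<dots> = J a / 2 + J b / 2 - inner (a - b) (a - b) / 8"
      by (simp add: J_def inner_add inner_diff inner_commute[of b a] field_simps)
    finally show ?thesis using m_le[OF h] by simp
  qed
  have "Cauchy v"
  proof (rule CauchyI)
    fix e :: real assume "e > 0"
    then obtain N where N: "1 / Suc N < e\<^sup>2 / 8"
      using nat_approx_posE[of "e\<^sup>2 / 8"] by (metis divide_pos_pos zero_less_numeral zero_less_power)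
    have "norm (v i - v j) < e" if "i \<ge> N" "j \<ge> N" for i j
    proof -
      define \<delta> where "\<delta> = 1 / real (Suc N)"
      have le: "J (v k) < m + \<delta>" if "k \<ge> N" for k
      proof -
        have "1 / real (Suc k) \<le> \<delta>"
          unfolding \<delta>_def using that by (intro divide_left_mono) auto
        thus ?thesis using Jv[of k] by linarith
      qed
      have "(norm (v i - v j))\<^sup>2 \<le> 4 * (J (v i) + J (v j) - 2 * m)"
        unfolding power2_norm_eq_inner by (rule para[OF v v])
      also have "\<dots> < 8 * \<delta>"
      proof -
        have "J (v i) + J (v j) < (m + \<delta>) + (m + \<delta>)"
          by (rule add_strict_mono[OF le[OF that(1)] le[OF that(2)]])
        thus ?thesis by (simp add: algebra_simps)
      qed
      also have "\<dots> < e\<^sup>2" using N by (simp add: \<delta>_def)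
      finally show ?thesis using \<open>e > 0\<close> by (simp add: power_less_imp_less_base)
    qed
    thus "\<exists>M. \<forall>m\<ge>M. \<forall>n\<ge>M. norm (v m - v n) < e" by blast
  qed
  then obtain \<zeta> where \<zeta>: "v \<longlonglongrightarrow> \<zeta>"
    unfolding Cauchy_convergent_iff convergent_def by blast
  have lim_m: "(\<lambda>n. m + 1 / real (Suc n)) \<longlonglongrightarrow> m"
    using tendsto_add[OF tendsto_const LIMSEQ_inverse_real_of_nat, of m] by (simp add: field_simps)
  \<comment> \<open>First variation at the minimum, obtained by moving \<open>v n\<close> in the
    direction u and letting n grow.\<close>
  have ge: "0 \<le> t * (inner \<zeta> u - f u) + t\<^sup>2 / 2 * inner u u" if u: "u \<in> V" for u t
  proof -
    have "m \<le> (m + 1 / Suc n) + t * (inner (v n) u - f u) + t\<^sup>2 / 2 * inner u u" for n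
    proof -
      have tu: "t *\<^sub>R u \<in> V" using V u by (rule subspace_scale)
      have "J (v n + t *\<^sub>R u) = J (v n) + t * (inner (v n) u - f u) + t\<^sup>2 / 2 * inner u u"
      proof -
        have "inner (v n + t *\<^sub>R u) (v n + t *\<^sub>R u) = inner (v n) (v n) + 2 * t * inner (v n) u + t\<^sup>2 * inner u u"
          by (simp add: inner_add inner_commute[of u "v n"] power2_eq_square distrib_left)
        thus ?thesis unfolding J_def add[OF v tu] scale[OF u] by (simp add: algebra_simps)
      qed
      thus ?thesis using m_le[OF subspace_add[OF V v tu], of n] Jv[of n] by linarith
    qed
    hence ex: "\<exists>N. \<forall>n\<ge>N. m \<le> (m + 1 / Suc n) + t * (inner (v n) u - f u) + t\<^sup>2 / 2 * inner u u"
      by blast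
    have "m \<le> m + t * (inner \<zeta> u - f u) + t\<^sup>2 / 2 * inner u u"
      by (rule LIMSEQ_le_const[OF _ ex])
        (intro tendsto_add tendsto_mult tendsto_diff tendsto_const lim_m tendsto_inner \<zeta>)
    thus ?thesis by simp
  qed
  have "f u = inner \<zeta> u" if u: "u \<in> V" for u
  proof (cases "u = 0")
    case True
    thus ?thesis using scale[OF u, of 0] by simp
  next
    case False
    define d where "d = inner \<zeta> u - f u"
    define q where "q = inner u u"
    have q: "q > 0" using False by (simp add: q_def)
    \<comment> \<open>The value t = - d / q minimizes t d + t^2 q / 2.\<close>
    have "0 \<le> (- d / q) * d + (- d / q)\<^sup>2 / 2 * q"
      using ge[OF u, of "- d / q"] by (simp add: d_def q_def)
    also have "\<dots> = - (d\<^sup>2 / (2 * q))" using q by (simp add: power2_eq_square)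
    finally have "d\<^sup>2 / (2 * q) \<le> 0" by simp
    hence "d = 0" using q by (simp add: divide_le_0_iff)
    thus ?thesis by (simp add: d_def)
  qed
  moreover have "\<zeta> \<in> closure V" unfolding closure_sequential using \<zeta> v by blast
  ultimately show ?thesis using that by blast
qed


section \<open>Bounded operators and their adjoints\<close>

lemmas bop_rep [simp] = zero_bop.rep_eq one_bop.rep_eq plus_bop.rep_eq uminus_bop.rep_eq
  minus_bop.rep_eq times_bop.rep_eq scaleC_bop.rep_eq

lemma bop_add [simp]: "bop_apply a (x + y) = bop_apply a x + bop_apply a y"
  by (rule linear_add[OF bounded_linear.linear[OF bounded_linear_bop_apply]])

lemma bop_zero [simp]: "bop_apply a 0 = 0"
  by (rule linear_0[OF bounded_linear.linear[OF bounded_linear_bop_apply]])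

lemma bop_diff [simp]: "bop_apply a (x - y) = bop_apply a x - bop_apply a y"
  by (rule linear_diff[OF bounded_linear.linear[OF bounded_linear_bop_apply]])

lemma bop_scaleR [simp]: "bop_apply a (r *\<^sub>R x) = r *\<^sub>R bop_apply a x"
  by (rule linear_scale[OF bounded_linear.linear[OF bounded_linear_bop_apply]])

lemmas bop_scaleC [simp] = bop_apply_scaleC

lemma bop_sum_left: "bop_apply (sum f S) x = (\<Sum>i\<in>S. bop_apply (f i) x)"
  by (induction S rule: infinite_finite_induct) simp_all

lemma bop_existsI:
  assumes "\<And>x y. f (x + y) = f x + f y" "\<And>c x. f (c *\<^sub>C x) = c *\<^sub>C f x"
    and "\<And>x. norm (f x) \<le> C * norm (x::'a::complex_hilbert)"
  shows "\<exists>a. \<forall>x. bop_apply a x = f x"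
proof -
  have "bounded_linear f"
  proof (rule bounded_linear_intro)
    show "f (r *\<^sub>R x) = r *\<^sub>R f x" for r x
      using assms(2)[of "of_real r" x] by (simp add: scaleC_of_real)
    show "norm (f x) \<le> norm x * C" for x using assms(3)[of x] by (simp add: mult.commute)
  qed (rule assms(1))
  hence "bop_apply (Bop f) = f" using assms(2) by (intro Bop_inverse) simp
  thus ?thesis by metis
qed

definition opnorm :: "'a::complex_hilbert bop \<Rightarrow> real" where
  "opnorm a = onorm (bop_apply a)"

lemma opnorm: "norm (bop_apply a x) \<le> opnorm a * norm x"
  unfolding opnorm_def by (rule onorm[OF bounded_linear_bop_apply])

lemma opnorm_nonneg [simp]: "0 \<le> opnorm a"
  unfolding opnorm_def by (rule onorm_pos_le[OF bounded_linear_bop_apply])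

lemma opnorm_le: "0 \<le> C \<Longrightarrow> (\<And>x. norm (bop_apply a x) \<le> C * norm x) \<Longrightarrow> opnorm a \<le> C"
  unfolding opnorm_def by (rule onorm_bound)

lemma bop_tendsto: "(f \<longlongrightarrow> x) F \<Longrightarrow> ((\<lambda>n. bop_apply a (f n)) \<longlongrightarrow> bop_apply a x) F"
  by (rule bounded_linear.tendsto[OF bounded_linear_bop_apply])

lemma adj_exists: "\<exists>b. \<forall>x y. cinner (bop_apply b x) y = cinner x (bop_apply a (y::'a::complex_hilbert))"
proof -
  have "\<exists>\<zeta>. \<forall>y. cinner \<zeta> y = cinner x (bop_apply a y)" for x
  proof -
    obtain \<zeta> where \<zeta>: "\<And>y. inner x (bop_apply a y) = inner \<zeta> y"
    proof (rule riesz_subspace[of UNIV "\<lambda>y. inner x (bop_apply a y)" "norm x * opnorm a"])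
      fix v
      have "\<bar>inner x (bop_apply a v)\<bar> \<le> norm x * norm (bop_apply a v)"
        by (rule Cauchy_Schwarz_ineq2)
      also have "\<dots> \<le> norm x * (opnorm a * norm v)" by (intro mult_left_mono opnorm) simp
      finally show "\<bar>inner x (bop_apply a v)\<bar> \<le> norm x * opnorm a * norm v" by simp
    qed (auto simp: inner_add_right)
    \<comment> \<open>The Riesz vector matches real parts only; testing it at i y supplies the
      imaginary part.\<close>
    have "cinner \<zeta> y = cinner x (bop_apply a y)" for y
      using \<zeta>[of y] \<zeta>[of "\<i> *\<^sub>C y"] by (simp add: complex_inner_eq[of \<zeta>] complex_inner_eq[of x])
    thus ?thesis by blast
  qed
  then obtain f where f: "\<And>x y. cinner (f x) y = cinner x (bop_apply a y)" by metis
  have f': "cinner y (f x) = cinner (bop_apply a y) x" for x y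
    by (metis f cinner_commute)
  have "\<exists>b. \<forall>x. bop_apply b x = f x"
  proof (rule bop_existsI[where C = "opnorm a"])
    show "f (x + y) = f x + f y" for x y
      by (rule cinner_eqI) (simp add: f' cinner_add_right)
    show "f (c *\<^sub>C x) = c *\<^sub>C f x" for c x
      by (rule cinner_eqI) (simp add: f' cinner_scaleC_right)
    fix x
    have "norm (f x) * norm (f x) = Re (cinner x (bop_apply a (f x)))"
      by (simp add: f[symmetric] cinner_self power2_eq_square)
    also have "\<dots> \<le> norm x * norm (bop_apply a (f x))"
      unfolding Re_cinner by (rule norm_cauchy_schwarz)
    also have "\<dots> \<le> norm x * (opnorm a * norm (f x))" by (intro mult_left_mono opnorm) simp
    finally show "norm (f x) \<le> opnorm a * norm x"
      by (cases "norm (f x) = 0") (auto simp: mult.commute mult.left_commute)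
  qed
  then obtain b where "\<forall>x. bop_apply b x = f x" by blast
  hence "\<forall>x y. cinner (bop_apply b x) y = cinner x (bop_apply a y)" using f by simp
  thus ?thesis by blast
qed

lemma cinner_adj_left: "cinner (bop_apply (adj a) x) y = cinner x (bop_apply a y)"
proof -
  have "\<forall>x y. cinner (bop_apply (adj a) x) y = cinner x (bop_apply a y)"
    unfolding adj_def
  proof (rule theI')
    obtain b where b: "\<forall>x y. cinner (bop_apply b x) y = cinner x (bop_apply a y)"
      using adj_exists by blast
    have "b' = b" if "\<forall>x y. cinner (bop_apply b' x) y = cinner x (bop_apply a y)" for b'
    proof (rule bop_eqI, rule cinner_eqI)
      fix x y
      show "cinner y (bop_apply b' x) = cinner y (bop_apply b x)"
        using b that by (metis cinner_commute)
    qed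
    thus "\<exists>!b. \<forall>x y. cinner (bop_apply b x) y = cinner x (bop_apply a y)" using b by blast
  qed
  thus ?thesis by blast
qed

lemma cinner_adj_right: "cinner x (bop_apply (adj a) y) = cinner (bop_apply a x) y"
  by (metis cinner_adj_left cinner_commute)

lemma adj_eqI: "(\<And>x y. cinner (bop_apply b x) y = cinner x (bop_apply a y)) \<Longrightarrow> adj a = b"
  by (rule bop_eqI, rule cinner_eqI) (metis cinner_adj_left cinner_commute)

lemma adj_adj [simp]: "adj (adj a) = a"
  by (rule adj_eqI) (simp add: cinner_adj_right)

lemma adj_mult [simp]: "adj (a * b) = adj b * adj a"
  by (rule adj_eqI) (simp add: cinner_adj_left)

lemma adj_add [simp]: "adj (a + b) = adj a + adj b"
  by (rule adj_eqI) (simp add: cinner_adj_left cinner_add_left cinner_add_right)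

lemma adj_diff [simp]: "adj (a - b) = adj a - adj b"
  by (rule adj_eqI) (simp add: cinner_adj_left cinner_diff_left cinner_diff_right)

lemma adj_one [simp]: "adj 1 = 1"
  by (rule adj_eqI) simp

lemma adj_zero [simp]: "adj 0 = 0"
  by (rule adj_eqI) simp

lemma adj_scaleC [simp]: "adj (c *\<^sub>C a) = cnj c *\<^sub>C adj a"
  by (rule adj_eqI) (simp add: cinner_adj_left cinner_scaleC_left cinner_scaleC_right)

lemma adj_sum: "adj (sum f S) = (\<Sum>i\<in>S. adj (f i))"
  by (induction S rule: infinite_finite_induct) simp_all

lemma adj_power: "adj (a ^ n) = adj a ^ n"
  by (induction n) (simp_all add: power_commutes)

lemma norm_bop_eq: "(norm (bop_apply a x))\<^sup>2 = Re (cinner x (bop_apply (adj a * a) x))"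
  by (simp add: cinner_adj_right cinner_self)

lemma opnorm_adj_le: "opnorm (adj a) \<le> opnorm a"
proof (rule opnorm_le[OF opnorm_nonneg])
  fix x
  let ?y = "bop_apply (adj a) x"
  have "norm ?y * norm ?y = Re (cinner x (bop_apply a ?y))"
    by (simp add: cinner_adj_left[symmetric] cinner_self power2_eq_square)
  also have "\<dots> \<le> norm x * norm (bop_apply a ?y)"
    unfolding Re_cinner by (rule norm_cauchy_schwarz)
  also have "\<dots> \<le> norm x * (opnorm a * norm ?y)" by (intro mult_left_mono opnorm) simp
  finally show "norm ?y \<le> opnorm a * norm x"
    by (cases "norm ?y = 0") (auto simp: mult.commute mult.left_commute)
qed

lemma scaleC_bop_simps:
  fixes a b :: "'a::complex_hilbert bop"
  shows "(c *\<^sub>C a) * b = c *\<^sub>C (a * b)" "a * (c *\<^sub>C b) = c *\<^sub>C (a * b)"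
    "c *\<^sub>C d *\<^sub>C a = (c * d) *\<^sub>C a" "1 *\<^sub>C a = a" "(-1) *\<^sub>C a = - a" "0 *\<^sub>C a = 0"
    "c *\<^sub>C (a + b) = c *\<^sub>C a + c *\<^sub>C b" "c *\<^sub>C (a - b) = c *\<^sub>C a - c *\<^sub>C b"
    "(c + d) *\<^sub>C a = c *\<^sub>C a + d *\<^sub>C a"
  by (rule bop_eqI; simp add: scaleC_scaleC scaleC_add_right scaleC_diff_right scaleC_add_left)+


section \<open>Positive operators\<close>

text \<open>Polarization over the complex scalars: testing at u + v makes the form antisymmetric,
  and replacing v by i v makes it symmetric as well.\<close>

lemma bop_zeroI:
  assumes "\<And>x. cinner x (bop_apply d x) = 0"
  shows "d = 0"
proof (rule bop_eqI, rule cinner_eqI)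
  fix x y
  have s: "cinner u (bop_apply d v) + cinner v (bop_apply d u) = 0" for u v
    using assms[of "u + v"] assms[of u] assms[of v]
    by (simp add: cinner_add_left cinner_add_right add.commute)
  have "\<i> * (cinner y (bop_apply d x) - cinner x (bop_apply d y)) = 0"
    using s[of y "\<i> *\<^sub>C x"] by (simp add: cinner_scaleC_left cinner_scaleC_right algebra_simps)
  hence "cinner y (bop_apply d x) = cinner x (bop_apply d y)" by simp
  thus "cinner y (bop_apply d x) = cinner y (bop_apply 0 x)"
    using s[of y x] by simp
qed

text \<open>A quadratic form with real values belongs to a self-adjoint operator, by
  \<open>bop_zeroI\<close>.\<close>

lemma positive_bop_adj: "positive_bop a \<Longrightarrow> adj a = a"
proof -
  assume a: "positive_bop a"
  have "adj a - a = 0"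
  proof (rule bop_zeroI)
    fix x
    have "cinner x (bop_apply (adj a) x) = cnj (cinner x (bop_apply a x))"
      by (metis cinner_adj_right cinner_commute)
    also have "\<dots> = cinner x (bop_apply a x)"
      using a unfolding positive_bop_def by (auto simp: complex_nonneg_Reals_iff complex_eq_iff)
    finally show "cinner x (bop_apply (adj a - a) x) = 0" by (simp add: cinner_diff_right)
  qed
  thus ?thesis by simp
qed

lemma positive_bop_Re: "positive_bop a \<Longrightarrow> 0 \<le> Re (cinner x (bop_apply a x))"
  by (simp add: positive_bop_def complex_nonneg_Reals_iff)

lemma positive_bopI:
  assumes "adj a = a" "\<And>x. 0 \<le> Re (cinner x (bop_apply a x))"
  shows "positive_bop a"
  unfolding positive_bop_def
proof
  fix x
  have "cinner x (bop_apply a x) = cnj (cinner x (bop_apply a x))"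
    by (metis cinner_adj_left cinner_commute assms(1))
  thus "cinner x (bop_apply a x) \<in> \<real>\<^sub>\<ge>\<^sub>0"
    using assms(2)[of x] by (simp add: complex_nonneg_Reals_iff complex_eq_iff)
qed

lemma positive_bop_conj: "positive_bop p \<Longrightarrow> positive_bop (adj a * p * a)"
  unfolding positive_bop_def by (simp add: cinner_adj_right)

lemma positive_bop_0 [simp]: "positive_bop 0"
  by (simp add: positive_bop_def)

lemma positive_bop_1 [simp]: "positive_bop 1"
  by (simp add: positive_bop_def cinner_self complex_nonneg_Reals_iff)

lemma positive_bop_adj_mult [simp]: "positive_bop (adj a * a)"
  using positive_bop_conj[OF positive_bop_1, of a] by simp

lemma positive_bop_add: "positive_bop a \<Longrightarrow> positive_bop b \<Longrightarrow> positive_bop (a + b)"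
  by (auto simp: positive_bop_def cinner_add_right)

lemma positive_bop_scale: "positive_bop a \<Longrightarrow> 0 \<le> r \<Longrightarrow> positive_bop (of_real r *\<^sub>C a)"
  by (auto simp: positive_bop_def cinner_scaleC_right complex_nonneg_Reals_iff)

lemma positive_bop_sum: "(\<And>i. i \<in> S \<Longrightarrow> positive_bop (f i)) \<Longrightarrow> positive_bop (sum f S)"
  by (induction S rule: infinite_finite_induct) (simp_all add: positive_bop_add)

lemma positive_bop_limit:
  assumes "\<And>x. (\<lambda>n. bop_apply (f n) x) \<longlonglongrightarrow> bop_apply a x" "\<And>n. n \<ge> N \<Longrightarrow> positive_bop (f n)"
  shows "positive_bop a"
  unfolding positive_bop_def
proof
  fix x
  show "cinner x (bop_apply a x) \<in> \<real>\<^sub>\<ge>\<^sub>0"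
  proof (rule Lim_in_closed_set[OF closed_nonneg_Reals_complex])
    show "(\<lambda>n. cinner x (bop_apply (f n) x)) \<longlonglongrightarrow> cinner x (bop_apply a x)"
      by (intro tendsto_cinner tendsto_const assms)
    show "\<forall>\<^sub>F n in sequentially. cinner x (bop_apply (f n) x) \<in> \<real>\<^sub>\<ge>\<^sub>0"
      unfolding eventually_sequentially using assms(2) by (auto simp: positive_bop_def)
  qed simp
qed

lemma positive_bop_opnorm: "positive_bop (of_real ((opnorm a)\<^sup>2) *\<^sub>C 1 - adj a * a)"
proof (rule positive_bopI)
  fix x
  have "(norm (bop_apply a x))\<^sup>2 \<le> (opnorm a * norm x)\<^sup>2"
    by (intro power_mono opnorm) simp
  thus "0 \<le> Re (cinner x (bop_apply (of_real ((opnorm a)\<^sup>2) *\<^sub>C 1 - adj a * a) x))"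
    by (simp add: cinner_diff_right cinner_scaleC_right cinner_self cinner_adj_right power_mult_distrib)
qed simp

lemma positive_bop_contraction:
  assumes "\<And>x. norm (bop_apply a x) \<le> norm x"
  shows "positive_bop (1 - adj a * a)"
proof (rule positive_bopI)
  fix x
  have "(norm (bop_apply a x))\<^sup>2 \<le> (norm x)\<^sup>2" by (intro power_mono assms) simp
  thus "0 \<le> Re (cinner x (bop_apply (1 - adj a * a) x))"
    by (simp add: cinner_diff_right cinner_self cinner_adj_right)
qed simp

text \<open>The decomposition a - a^2 = a (1 - a) a + (1 - a) a (1 - a) works without square roots,
  whose construction below depends on this lemma.\<close>

lemma positive_bop_diff_square:
  assumes "positive_bop a" "positive_bop (1 - a)"
  shows "positive_bop (a - a * a)"
proof -
  have "a - a * a = adj a * (1 - a) * a + adj (1 - a) * a * (1 - a)"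
    using assms by (simp add: positive_bop_adj algebra_simps)
  thus ?thesis using assms by (simp only: positive_bop_add positive_bop_conj)
qed

text \<open>Smallness of the quadratic form becomes smallness of vectors; this turns monotone
  convergence of forms into strong convergence.\<close>

lemma norm_positive_square_le:
  assumes "positive_bop a" "positive_bop (1 - a)"
  shows "(norm (bop_apply a x))\<^sup>2 \<le> Re (cinner x (bop_apply a x))"
  using positive_bop_Re[OF positive_bop_diff_square[OF assms], of x]
  unfolding norm_bop_eq by (simp add: positive_bop_adj assms cinner_diff_right)

lemma norm_positive_le:
  assumes "positive_bop a" "positive_bop (1 - a)"
  shows "norm (bop_apply a x) \<le> norm x"
proof -
  have "Re (cinner x (bop_apply a x)) \<le> (norm x)\<^sup>2"
    using positive_bop_Re[OF assms(2), of x] by (simp add: cinner_diff_right cinner_self)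
  with norm_positive_square_le[OF assms, of x]
  have "(norm (bop_apply a x))\<^sup>2 \<le> (norm x)\<^sup>2" by (rule order_trans)
  thus ?thesis by (rule power2_le_imp_le) simp
qed


section \<open>Strong limits\<close>

lemma bop_strong_limit:
  assumes "\<And>x. Cauchy (\<lambda>n::nat. bop_apply (f n) x)" "\<And>n x. norm (bop_apply (f n) x) \<le> C * norm x"
  obtains a where "\<And>x. (\<lambda>n. bop_apply (f n) x) \<longlonglongrightarrow> bop_apply a x"
proof -
  have "\<forall>x. \<exists>y. (\<lambda>n. bop_apply (f n) x) \<longlonglongrightarrow> y"
    using assms(1) by (simp add: Cauchy_convergent_iff convergent_def)
  then obtain g where g: "\<And>x. (\<lambda>n. bop_apply (f n) x) \<longlonglongrightarrow> g x" by metis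
  have "\<exists>a. \<forall>x. bop_apply a x = g x"
  proof (rule bop_existsI)
    show "g (x + y) = g x + g y" for x y
      by (rule LIMSEQ_unique[OF g]) (simp add: tendsto_add g)
    show "g (c *\<^sub>C x) = c *\<^sub>C g x" for c x
      by (rule LIMSEQ_unique[OF g]) (simp add: bounded_linear.tendsto[OF bounded_linear_scaleC] g)
    show "norm (g x) \<le> C * norm x" for x
      by (rule LIMSEQ_le_const2[OF tendsto_norm[OF g]]) (use assms(2) in blast)
  qed
  thus ?thesis using that g by metis
qed

lemma mono_bop_diff:
  assumes "\<And>n. positive_bop (m (Suc n) - m n)" "i \<le> j"
  shows "positive_bop (m j - m i :: 'a::complex_hilbert bop)"
  using assms(2)
proof (induction j rule: dec_induct)
  case (step n)
  have "m (Suc n) - m i = (m (Suc n) - m n) + (m n - m i)" by simp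
  thus ?case using assms(1)[of n] step by (simp only: positive_bop_add)
qed simp

lemma bop_monotone_limit:
  fixes m :: "nat \<Rightarrow> 'a::complex_hilbert bop"
  assumes mono: "\<And>n. positive_bop (m (Suc n) - m n)"
    and pos: "positive_bop (m 0)" and le1: "\<And>n. positive_bop (1 - m n)"
  obtains a where "\<And>x. (\<lambda>n. bop_apply (m n) x) \<longlonglongrightarrow> bop_apply a x"
    "positive_bop a" "positive_bop (1 - a)" "\<And>n. positive_bop (a - m n)"
proof -
  have pos': "positive_bop (m n)" for n
    using positive_bop_add[OF pos mono_bop_diff[where m = m, OF mono, of 0 n]] by simp
  have "Cauchy (\<lambda>n. bop_apply (m n) x)" for x
  proof -
    define q where "q n = Re (cinner x (bop_apply (m n) x))" for n
    have q_mono: "q i \<le> q j" if "i \<le> j" for i j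
      using positive_bop_Re[OF mono_bop_diff[where m = m, OF mono that], of x] by (simp add: q_def cinner_diff_right)
    have "q n \<le> (norm x)\<^sup>2" for n
      using positive_bop_Re[OF le1, of x n] by (simp add: q_def cinner_diff_right cinner_self)
    then obtain L where "q \<longlonglongrightarrow> L"
      using incseq_convergent[of q] q_mono unfolding incseq_def by metis
    hence C: "Cauchy q" by (rule LIMSEQ_imp_Cauchy)
    show ?thesis
    proof (rule CauchyI)
      fix e :: real assume e: "0 < e"
      then obtain N where N: "\<And>i j. i \<ge> N \<Longrightarrow> j \<ge> N \<Longrightarrow> norm (q i - q j) < e\<^sup>2"
        using CauchyD[OF C, of "e\<^sup>2"] by auto
      have le: "norm (bop_apply (m j) x - bop_apply (m i) x) < e" if "i \<ge> N" "i \<le> j" for i j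
      proof -
        \<comment> \<open>The increment itself lies between 0 and 1, so its vectors are controlled
          by the increment of the form \<open>q\<close>.\<close>
        have "1 - (m j - m i) = (1 - m j) + m i" by simp
        hence "positive_bop (1 - (m j - m i))"
          using le1[of j] pos'[of i] by (simp only: positive_bop_add)
        hence "(norm (bop_apply (m j - m i) x))\<^sup>2 \<le> q j - q i"
          using norm_positive_square_le[OF mono_bop_diff[where m = m, OF mono that(2)], of x]
          by (simp add: q_def cinner_diff_right)
        also have "\<dots> < e\<^sup>2" using N[of j i] that by simp
        finally show ?thesis using e by (simp add: power_less_imp_less_base)
      qed
      have "norm (bop_apply (m i) x - bop_apply (m j) x) < e" if "i \<ge> N" "j \<ge> N" for i j
        using le[of i j] le[of j i] that by (cases "i \<le> j") (auto simp: norm_minus_commute)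
      thus "\<exists>M. \<forall>i\<ge>M. \<forall>j\<ge>M. norm (bop_apply (m i) x - bop_apply (m j) x) < e" by blast
    qed
  qed
  then obtain a where a: "\<And>x. (\<lambda>n. bop_apply (m n) x) \<longlonglongrightarrow> bop_apply a x"
    using norm_positive_le[OF pos' le1] by (rule_tac bop_strong_limit[of m 1]) auto
  show ?thesis
  proof (rule that[OF a])
    show "positive_bop a" by (rule positive_bop_limit[OF a pos'])
    show "positive_bop (1 - a)"
      by (rule positive_bop_limit[of "\<lambda>n. 1 - m n"]) (auto intro!: tendsto_intros a le1)
    show "positive_bop (a - m n)" for n
      by (rule positive_bop_limit[of "\<lambda>k. m k - m n" _ n])
        (auto intro!: tendsto_intros a mono_bop_diff[where m = m] mono)
  qed
qed

text \<open>Splits the error into f_n (g_n x - b x) and (f_n - a) b x; the uniform bound serves the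
  first term.\<close>

lemma strong_limit_mult:
  assumes "\<And>x. (\<lambda>n. bop_apply (f n) x) \<longlonglongrightarrow> bop_apply a x"
    and "\<And>x. (\<lambda>n. bop_apply (g n) x) \<longlonglongrightarrow> bop_apply b x"
    and "\<And>n x. norm (bop_apply (f n) x) \<le> C * norm x"
  shows "(\<lambda>n. bop_apply (f n * g n) x) \<longlonglongrightarrow> bop_apply (a * b) x"
proof -
  have "(\<lambda>n. bop_apply (f n) (bop_apply (g n) x - bop_apply b x)) \<longlonglongrightarrow> 0"
  proof (rule tendsto_norm_zero_cancel, rule tendsto_sandwich[OF _ _ tendsto_const])
    have "(\<lambda>n. C * norm (bop_apply (g n) x - bop_apply b x)) \<longlonglongrightarrow> C * norm (bop_apply b x - bop_apply b x)"
      by (intro tendsto_intros assms)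
    thus "(\<lambda>n. C * norm (bop_apply (g n) x - bop_apply b x)) \<longlonglongrightarrow> 0" by simp
  qed (simp_all only: assms(3) norm_ge_zero eventually_True)
  from tendsto_add[OF this assms(1)[of "bop_apply b x"]] show ?thesis by simp
qed

lemma strong_limit_unique:
  assumes "\<And>x. (\<lambda>n. bop_apply (f n) x) \<longlonglongrightarrow> bop_apply a x"
    and "\<And>x. (\<lambda>n. bop_apply (f n) x) \<longlonglongrightarrow> bop_apply b x"
  shows "a = b"
  by (rule bop_eqI, rule LIMSEQ_unique[OF assms])


section \<open>Commutants\<close>

lemma commutantD: "x \<in> commutant S \<Longrightarrow> s \<in> S \<Longrightarrow> x * s = s * x"
  by (simp add: commutant_def)

lemma commutantI: "(\<And>s. s \<in> S \<Longrightarrow> x * s = s * x) \<Longrightarrow> x \<in> commutant S"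
  by (simp add: commutant_def)

lemma commutant_antimono: "S \<subseteq> T \<Longrightarrow> commutant T \<subseteq> commutant S"
  by (auto simp: commutant_def)

lemma subset_bicommutant: "S \<subseteq> commutant (commutant S)"
  by (auto simp: commutant_def)

lemma commutant_3: "commutant (commutant (commutant S)) = commutant S"
  using subset_bicommutant[of "commutant S"] commutant_antimono[OF subset_bicommutant[of S]] by blast

lemma commutant_0: "0 \<in> commutant S"
  and commutant_1: "1 \<in> commutant S"
  by (simp_all add: commutant_def)

lemma commutant_add: "a \<in> commutant S \<Longrightarrow> b \<in> commutant S \<Longrightarrow> a + b \<in> commutant S"
  and commutant_diff: "a \<in> commutant S \<Longrightarrow> b \<in> commutant S \<Longrightarrow> a - b \<in> commutant S"
  by (simp_all add: commutant_def algebra_simps)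

lemma commutant_uminus: "a \<in> commutant S \<Longrightarrow> - a \<in> commutant S"
  by (simp add: commutant_def)

lemma commutant_mult: "a \<in> commutant S \<Longrightarrow> b \<in> commutant S \<Longrightarrow> a * b \<in> commutant S"
proof (rule commutantI)
  fix s assume "a \<in> commutant S" "b \<in> commutant S" "s \<in> S"
  hence "b * s = s * b" "a * s = s * a" by (auto dest: commutantD)
  thus "a * b * s = s * (a * b)" by (metis mult.assoc)
qed

lemma commutant_scaleC: "a \<in> commutant S \<Longrightarrow> c *\<^sub>C a \<in> commutant S"
  by (simp add: commutant_def scaleC_bop_simps)

lemma commutant_sum: "(\<And>i. i \<in> I \<Longrightarrow> f i \<in> commutant S) \<Longrightarrow> sum f I \<in> commutant S"
  by (induction I rule: infinite_finite_induct) (simp_all add: commutant_0 commutant_add)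

lemma commutant_adj:
  assumes "\<And>s. s \<in> S \<Longrightarrow> adj s \<in> S" "a \<in> commutant S"
  shows "adj a \<in> commutant S"
proof (rule commutantI)
  fix s assume "s \<in> S"
  hence "adj (a * adj s) = adj (adj s * a)" by (simp only: commutantD[OF assms(2) assms(1)])
  thus "adj a * s = s * adj a" by simp
qed

lemma commutant_limit:
  assumes "\<And>x. (\<lambda>n. bop_apply (f n) x) \<longlonglongrightarrow> bop_apply a x" "\<And>n. f n \<in> commutant S"
  shows "a \<in> commutant S"
proof (rule commutantI, rule bop_eqI)
  fix s x assume s: "s \<in> S"
  have "(\<lambda>n. bop_apply (f n * s) x) \<longlonglongrightarrow> bop_apply (a * s) x" by (simp add: assms(1))
  moreover have "(\<lambda>n. bop_apply (s * f n) x) \<longlonglongrightarrow> bop_apply (s * a) x"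
    by (simp add: bop_tendsto assms(1))
  moreover have "f n * s = s * f n" for n using assms(2) s by (rule commutantD)
  ultimately show "bop_apply (a * s) x = bop_apply (s * a) x"
    using LIMSEQ_unique by fastforce
qed

lemma von_neumann_algebra_bicommutant:
  assumes "\<And>s. s \<in> S \<Longrightarrow> adj s \<in> S"
  shows "von_neumann_algebra (commutant (commutant S))"
  unfolding von_neumann_algebra_def
  by (simp add: commutant_3) (blast intro: commutant_adj assms)

lemma von_neumann_algebra_vN_generated: "von_neumann_algebra (vN_generated S)"
  unfolding vN_generated_def by (rule von_neumann_algebra_bicommutant) auto

lemma subset_vN_generated: "S \<subseteq> vN_generated S"
  unfolding vN_generated_def using subset_bicommutant[of "S \<union> adj ` S"] by blast

context
  fixes A :: "'h::complex_hilbert bop set"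
  assumes A: "von_neumann_algebra A"
begin

lemma vN_bicommutant: "commutant (commutant A) = A"
  using A by (simp add: von_neumann_algebra_def)

lemma vN_adj: "a \<in> A \<Longrightarrow> adj a \<in> A"
  using A by (simp add: von_neumann_algebra_def)

lemma vN_zero: "0 \<in> A"
  using commutant_0[of "commutant A"] by (simp add: vN_bicommutant)

lemma vN_one: "1 \<in> A"
  using commutant_1[of "commutant A"] by (simp add: vN_bicommutant)

lemma vN_add: "a \<in> A \<Longrightarrow> b \<in> A \<Longrightarrow> a + b \<in> A"
  using commutant_add[of a "commutant A" b] by (simp add: vN_bicommutant)

lemma vN_diff: "a \<in> A \<Longrightarrow> b \<in> A \<Longrightarrow> a - b \<in> A"
  using commutant_diff[of a "commutant A" b] by (simp add: vN_bicommutant)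

lemma vN_uminus: "a \<in> A \<Longrightarrow> - a \<in> A"
  using commutant_uminus[of a "commutant A"] by (simp add: vN_bicommutant)

lemma vN_mult: "a \<in> A \<Longrightarrow> b \<in> A \<Longrightarrow> a * b \<in> A"
  using commutant_mult[of a "commutant A" b] by (simp add: vN_bicommutant)

lemma vN_scaleC: "a \<in> A \<Longrightarrow> c *\<^sub>C a \<in> A"
  using commutant_scaleC[of a "commutant A" c] by (simp add: vN_bicommutant)

lemma vN_sum: "(\<And>i. i \<in> I \<Longrightarrow> f i \<in> A) \<Longrightarrow> sum f I \<in> A"
  using commutant_sum[of I f "commutant A"] by (simp add: vN_bicommutant)

lemma vN_power: "a \<in> A \<Longrightarrow> a ^ n \<in> A"
  by (induction n) (simp_all add: vN_one vN_mult)

lemma vN_limit: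
  assumes "\<And>x. (\<lambda>n. bop_apply (f n) x) \<longlonglongrightarrow> bop_apply a x" "\<And>n. f n \<in> A"
  shows "a \<in> A"
  using commutant_limit[of f a "commutant A"] assms by (simp add: vN_bicommutant)

lemma vN_contains_bicommutant: "S \<subseteq> A \<Longrightarrow> commutant (commutant S) \<subseteq> A"
  using commutant_antimono[OF commutant_antimono, of S A] by (simp add: vN_bicommutant)

lemma commutant_vN_adj: "t \<in> commutant A \<Longrightarrow> adj t \<in> commutant A"
  by (rule commutant_adj[OF vN_adj])

lemmas vN_closed = vN_adj vN_zero vN_one vN_add vN_diff vN_uminus vN_mult vN_scaleC vN_power

end


section \<open>Orthogonal projections\<close>

lemma closure_invariant:
  assumes "\<And>x. x \<in> V \<Longrightarrow> f x \<in> V" "\<And>g x. g \<longlonglongrightarrow> x \<Longrightarrow> (\<lambda>n. f (g n)) \<longlonglongrightarrow> f x"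
    and "x \<in> closure (V :: 'a::real_normed_vector set)"
  shows "f x \<in> closure V"
  using assms unfolding closure_sequential by meson

text \<open>The vector representing \<open>inner x\<close> on V lies in the closure of V and is
  unique there; linearity and the fixed points of the projection come from this uniqueness.\<close>

lemma projection_onto_closure:
  fixes V :: "'a::complex_hilbert set"
  assumes zero: "0 \<in> V" and add: "\<And>x y. x \<in> V \<Longrightarrow> y \<in> V \<Longrightarrow> x + y \<in> V"
    and scale: "\<And>c x. x \<in> V \<Longrightarrow> c *\<^sub>C x \<in> V"
  obtains p where "projection p" "\<And>x. x \<in> closure V \<Longrightarrow> bop_apply p x = x"
    "\<And>x. bop_apply p x \<in> closure V"
proof -
  have sub: "subspace V"
    unfolding subspace_def using zero add scale by (metis scaleC_of_real)
  have c_scale: "c *\<^sub>C x \<in> closure V" if "x \<in> closure V" for c x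
    using scale bounded_linear.tendsto[OF bounded_linear_scaleC] that
    by (rule closure_invariant)
  have c_add: "x + y \<in> closure V" if xy: "x \<in> closure V" "y \<in> closure V" for x y
  proof -
    obtain f g where "\<And>n. f n \<in> V" "f \<longlonglongrightarrow> x" "\<And>n. g n \<in> V" "g \<longlonglongrightarrow> y"
      using xy unfolding closure_sequential by meson
    hence "(\<forall>n. f n + g n \<in> V) \<and> (\<lambda>n. f n + g n) \<longlonglongrightarrow> x + y"
      by (auto intro: add tendsto_add)
    thus ?thesis unfolding closure_sequential by (intro exI[of _ "\<lambda>n. f n + g n"]) simp
  qed
  have c_diff: "x - y \<in> closure V" if "x \<in> closure V" "y \<in> closure V" for x y
    using c_add[OF that(1) c_scale[OF that(2), of "-1"]] by simp
  have "\<exists>\<zeta>. \<zeta> \<in> closure V \<and> (\<forall>v\<in>closure V. cinner \<zeta> v = cinner x v)" for x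
  proof -
    obtain \<zeta> where \<zeta>: "\<zeta> \<in> closure V" "\<And>v. v \<in> V \<Longrightarrow> inner x v = inner \<zeta> v"
      by (rule riesz_subspace[OF sub, of "inner x" "norm x"])
        (auto simp: inner_add_right Cauchy_Schwarz_ineq2)
    have V: "cinner \<zeta> v = cinner x v" if "v \<in> V" for v
      using \<zeta>(2)[OF that] \<zeta>(2)[OF scale[OF that, of \<i>]]
      by (simp add: complex_inner_eq[of \<zeta>] complex_inner_eq[of x])
    have "cinner \<zeta> v = cinner x v" if "v \<in> closure V" for v
    proof -
      obtain f where f: "\<And>n. f n \<in> V" "f \<longlonglongrightarrow> v"
        using \<open>v \<in> closure V\<close> unfolding closure_sequential by blast
      have "(\<lambda>n. cinner \<zeta> (f n)) \<longlonglongrightarrow> cinner \<zeta> v" "(\<lambda>n. cinner x (f n)) \<longlonglongrightarrow> cinner x v"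
        by (intro tendsto_cinner tendsto_const f)+
      thus ?thesis unfolding V[OF f(1)] by (rule LIMSEQ_unique)
    qed
    thus ?thesis using \<zeta>(1) by blast
  qed
  then obtain P where P: "\<And>x. P x \<in> closure V"
    and Pv: "\<And>x v. v \<in> closure V \<Longrightarrow> cinner (P x) v = cinner x v"
    by metis
  have uniq: "u = P x" if "u \<in> closure V" "\<And>v. v \<in> closure V \<Longrightarrow> cinner u v = cinner x v" for u x
  proof -
    have "cinner (u - P x) (u - P x) = 0"
      using that(2) Pv c_diff[OF that(1) P[of x]] by (simp add: cinner_diff_left)
    thus ?thesis by (simp add: cinner_self)
  qed
  have "\<exists>p. \<forall>x. bop_apply p x = P x"
  proof (rule bop_existsI[where C = 1])
    show "P (x + y) = P x + P y" for x y
      by (rule uniq[symmetric]) (auto simp: c_add P Pv cinner_add_left)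
    show "P (c *\<^sub>C x) = c *\<^sub>C P x" for c x
      by (rule uniq[symmetric]) (auto simp: c_scale P Pv cinner_scaleC_left)
    fix x
    have "norm (P x) * norm (P x) = Re (cinner x (P x))"
      by (simp add: Pv[OF P, symmetric] cinner_self power2_eq_square)
    also have "\<dots> \<le> norm x * norm (P x)"
      unfolding Re_cinner by (rule norm_cauchy_schwarz)
    finally show "norm (P x) \<le> 1 * norm x"
      by (cases "norm (P x) = 0") auto
  qed
  then obtain p where p: "\<And>x. bop_apply p x = P x" by blast
  have fixP: "P x = x" if "x \<in> closure V" for x
    by (rule uniq[symmetric]) (auto simp: that)
  show ?thesis
  proof (rule that[of p])
    have "p * p = p" by (rule bop_eqI) (simp add: p fixP P)
    moreover have "adj p = p"
    proof (rule adj_eqI)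
      fix x y
      have "cinner (P x) y = cnj (cinner y (P x))" by (rule cinner_commute)
      also have "\<dots> = cnj (cinner (P y) (P x))" by (simp add: Pv P)
      also have "\<dots> = cinner (P x) (P y)" by (rule cinner_commute[symmetric])
      finally show "cinner (bop_apply p x) y = cinner x (bop_apply p y)" by (simp add: p Pv P)
    qed
    ultimately show "projection p" by (simp add: projection_def)
  qed (simp_all add: p fixP P)
qed

text \<open>Invariance of V under w gives p w p = w p; the adjoint of the same identity for adj w
  gives p w p = p w.\<close>

lemma projection_commutes:
  assumes p: "projection p" "\<And>x. x \<in> closure V \<Longrightarrow> bop_apply p x = x" "\<And>x. bop_apply p x \<in> closure V"
    and W: "\<And>w x. w \<in> W \<Longrightarrow> x \<in> V \<Longrightarrow> bop_apply w x \<in> V" "\<And>w. w \<in> W \<Longrightarrow> adj w \<in> W"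
  shows "p \<in> commutant W"
proof (rule commutantI)
  fix w assume w: "w \<in> W"
  have *: "p * w * p = w * p" if "w \<in> W" for w
  proof (rule bop_eqI)
    fix x
    have "bop_apply w (bop_apply p x) \<in> closure V"
      using W(1)[OF that] bop_tendsto p(3) by (rule closure_invariant)
    thus "bop_apply (p * w * p) x = bop_apply (w * p) x" by (simp add: p(2))
  qed
  have "adj (p * adj w * p) = adj (adj w * p)" using *[OF W(2)[OF w]] by simp
  hence "p * w * p = p * w" using p(1) by (simp add: projection_def mult.assoc)
  thus "p * w = w * p" using *[OF w] by simp
qed

lemma positive_bop_projection: "projection p \<Longrightarrow> positive_bop p"
  using positive_bop_adj_mult[of p] by (simp add: projection_def)

lemma projection_compl: "projection p \<Longrightarrow> projection (1 - p)"
  by (simp add: projection_def algebra_simps)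


section \<open>Square roots\<close>

text \<open>Polynomials in x with nonnegative coefficients. They commute and, for positive x, they
  are positive together with their products, a fact that for general commuting positive operators
  would call for square roots.\<close>

inductive_set power_cone :: "'a::complex_hilbert bop \<Rightarrow> 'a bop set" for x where
  power: "x ^ n \<in> power_cone x"
| zero: "0 \<in> power_cone x"
| add: "p \<in> power_cone x \<Longrightarrow> q \<in> power_cone x \<Longrightarrow> p + q \<in> power_cone x"
| scale: "p \<in> power_cone x \<Longrightarrow> 0 \<le> r \<Longrightarrow> of_real r *\<^sub>C p \<in> power_cone x"

lemma power_cone_mult:
  assumes "p \<in> power_cone x" "q \<in> power_cone x"
  shows "p * q \<in> power_cone x"
  using assms(1)
proof induction
  case (power n)
  show ?case using assms(2)
  proof induction
    case (power k)
    show ?case by (simp add: power_add[symmetric] power_cone.power)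
  qed (simp_all add: power_cone.intros distrib_left scaleC_bop_simps)
qed (simp_all add: power_cone.intros distrib_right scaleC_bop_simps)

lemma power_cone_commute_base: "p \<in> power_cone x \<Longrightarrow> x * p = p * x"
  by (induction rule: power_cone.induct)
    (simp_all add: power_commutes distrib_left distrib_right scaleC_bop_simps)

lemma power_cone_commute:
  assumes "p \<in> power_cone x" "q \<in> power_cone x"
  shows "p * q = q * p"
  using assms(1)
proof induction
  case (power n)
  show ?case
  proof (induction n)
    case (Suc n)
    show ?case using Suc power_cone_commute_base[OF assms(2)] by (simp add: mult.assoc) (simp add: mult.assoc[symmetric])
  qed simp
qed (simp_all add: distrib_left distrib_right scaleC_bop_simps)

lemma power_cone_positive:
  assumes "p \<in> power_cone x" "positive_bop x"
  shows "positive_bop p"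
  using assms(1)
proof induction
  case (power n)
  have sa: "adj (x ^ k) = x ^ k" for k by (simp add: adj_power positive_bop_adj assms(2))
  show ?case
  proof (cases "even n")
    case True
    then obtain k where "n = k + k" by (metis evenE mult_2)
    hence "x ^ n = adj (x ^ k) * x ^ k" by (simp add: sa power_add)
    thus ?thesis by (simp only: positive_bop_adj_mult)
  next
    case False
    then obtain k where "n = k + 1 + k" by (metis oddE add.commute add.left_commute mult_2)
    hence "x ^ n = adj (x ^ k) * x * x ^ k" by (simp only: sa power_add power_one_right)
    thus ?thesis using assms(2) by (simp only: positive_bop_conj)
  qed
qed (simp_all add: positive_bop_add positive_bop_scale)

text \<open>
  The square root is \<open>1 - y\<close>, where \<open>y\<close> is the limit of the increasing iteration
  \<open>y \<mapsto> (x + y\<^sup>2) / 2\<close> with \<open>x = 1 - k\<close>.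
\<close>

lemma positive_bop_sqrt:
  fixes k :: "'a::complex_hilbert bop"
  assumes k: "positive_bop k" "positive_bop (1 - k)"
  obtains b where "positive_bop b" "positive_bop (1 - b)" "b * b = k" "b \<in> commutant (commutant {k})"
proof -
  define x where "x = 1 - k"
  have x: "positive_bop x" "positive_bop (1 - x)" using k by (simp_all add: x_def)
  define F where "F y = of_real (1/2) *\<^sub>C (x + y * y)" for y
  define y where "y n = (F ^^ n) 0" for n
  have y0: "y 0 = 0" and ySuc: "y (Suc n) = F (y n)" for n by (simp_all add: y_def)
  have two: "F u - F v = of_real (1/2) *\<^sub>C (u * u - v * v)" for u v
    by (simp add: F_def scaleC_bop_simps)
  have x_cone: "x \<in> power_cone x" using power_cone.power[of x 1] by simp
  have cone: "y n \<in> power_cone x" for n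
  proof (induction n)
    case (Suc n)
    thus ?case unfolding ySuc F_def
      by (intro power_cone.scale power_cone.add power_cone_mult x_cone) auto
  qed (simp add: y0 power_cone.zero)
  have incr: "y (Suc n) - y n \<in> power_cone x" for n
  proof (induction n)
    case 0
    show ?case unfolding ySuc y0 F_def using power_cone.scale[OF x_cone, of "1/2"] by simp
  next
    case (Suc n)
    \<comment> \<open>Difference of squares of commuting elements, so the increments stay in the
      cone.\<close>
    have "y (Suc n) * y (Suc n) - y n * y n = (y (Suc n) - y n) * (y (Suc n) + y n)"
      using power_cone_commute[OF cone cone, of "Suc n" n] by (simp add: algebra_simps)
    hence "y (Suc (Suc n)) - y (Suc n) = of_real (1/2) *\<^sub>C ((y (Suc n) - y n) * (y (Suc n) + y n))"
      unfolding ySuc[of "Suc n"] by (subst ySuc[of n]) (simp only: two ySuc)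
    thus ?case
      by (simp only:) (intro power_cone.scale power_cone_mult power_cone.add Suc cone, simp)
  qed
  have pos: "positive_bop (y n)" for n by (rule power_cone_positive[OF cone x(1)])
  have contr: "norm (bop_apply (y n) u) \<le> norm u" for n u
  proof (induction n arbitrary: u)
    case (Suc n)
    have "norm (bop_apply x u + bop_apply (y n) (bop_apply (y n) u)) \<le> norm u + norm u"
      by (intro norm_triangle_mono norm_positive_le x order_trans[OF Suc Suc])
    thus ?case by (simp add: ySuc F_def norm_scaleC)
  qed (simp add: y0)
  have le1: "positive_bop (1 - y n)" for n
  proof (rule positive_bopI)
    show "adj (1 - y n) = 1 - y n" by (simp add: positive_bop_adj pos)
    fix u
    have "Re (cinner u (bop_apply (y n) u)) \<le> norm u * norm (bop_apply (y n) u)"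
      unfolding Re_cinner by (rule norm_cauchy_schwarz)
    also have "\<dots> \<le> norm u * norm u" by (intro mult_left_mono contr) simp
    finally show "0 \<le> Re (cinner u (bop_apply (1 - y n) u))"
      by (simp add: cinner_diff_right cinner_self power2_eq_square)
  qed
  obtain l where l: "\<And>u. (\<lambda>n. bop_apply (y n) u) \<longlonglongrightarrow> bop_apply l u"
    and lpos: "positive_bop l" "positive_bop (1 - l)"
    using bop_monotone_limit[of y] power_cone_positive[OF incr x(1)] pos le1 by metis
  have "(\<lambda>n. bop_apply (y n * y n) u) \<longlonglongrightarrow> bop_apply (l * l) u" for u
    using contr by (intro strong_limit_mult[where C = 1] l) simp
  hence "(\<lambda>n. bop_apply (F (y n)) u) \<longlonglongrightarrow> bop_apply (F l) u" for u
    by (auto simp: F_def intro!: bounded_linear.tendsto[OF bounded_linear_scaleC] tendsto_intros)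
  moreover have "(\<lambda>n. bop_apply (F (y n)) u) \<longlonglongrightarrow> bop_apply l u" for u
    using LIMSEQ_Suc[OF l, of u] by (simp add: ySuc)
  ultimately have Fl: "F l = l" by (rule strong_limit_unique)
  \<comment> \<open>The fixed point equation 2 l = x + l^2 says (1 - l)^2 = 1 - x = k.\<close>
  have "x + l * l = of_real 2 *\<^sub>C F l" by (simp add: F_def scaleC_bop_simps)
  also have "\<dots> = l + l" using scaleC_bop_simps(9)[of 1 1 l] by (simp add: Fl scaleC_bop_simps)
  finally have sq: "(1 - l) * (1 - l) = k" by (simp add: x_def algebra_simps)
  have "x \<in> commutant (commutant {k})"
    unfolding x_def using subset_bicommutant[of "{k}"] by (intro commutant_diff commutant_1) auto
  hence "y n \<in> commutant (commutant {k})" for n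
    by (induction n)
      (simp_all only: y0 ySuc F_def commutant_0 commutant_scaleC commutant_add commutant_mult)
  hence "l \<in> commutant (commutant {k})" by (rule commutant_limit[OF l])
  hence "1 - l \<in> commutant (commutant {k})" by (intro commutant_diff commutant_1)
  thus ?thesis using that[of "1 - l"] lpos sq by simp
qed

text \<open>Positivity of 1 - adj a a is witnessed inside A by its square root b, and this algebraic
  witness survives the homomorphism.\<close>

lemma star_isomorphism_contractive:
  assumes \<theta>: "star_isomorphism A B \<theta>" and A: "von_neumann_algebra A" and a: "a \<in> A"
    and one: "\<theta> 1 = 1"
    and contr: "\<And>x. norm (bop_apply a x) \<le> norm x"
  shows "norm (bop_apply (\<theta> a) x) \<le> norm x"
proof -
  have add: "\<theta> (u + v) = \<theta> u + \<theta> v" and mult: "\<theta> (u * v) = \<theta> u * \<theta> v" if "u \<in> A" "v \<in> A" for u v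
    using \<theta> that by (auto simp: star_isomorphism_def)
  have adj: "\<theta> (adj u) = adj (\<theta> u)" if "u \<in> A" for u
    using \<theta> that by (auto simp: star_isomorphism_def)
  have k: "positive_bop (1 - adj a * a)" "positive_bop (1 - (1 - adj a * a))"
    using positive_bop_contraction[of a] contr by auto
  have kA: "1 - adj a * a \<in> A" using A a by (intro vN_closed)
  obtain b where b: "positive_bop b" "b * b = 1 - adj a * a"
    "b \<in> commutant (commutant {1 - adj a * a})"
    using positive_bop_sqrt[OF k] by metis
  have bA: "b \<in> A" using vN_contains_bicommutant[OF A, of "{1 - adj a * a}"] kA b(3) by auto
  have aA: "adj a * a \<in> A" using A a by (intro vN_closed)
  have "1 = (adj a * a) + b * b" using b(2) by simp
  hence "\<theta> 1 = \<theta> ((adj a * a) + b * b)" by simp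
  also have "\<dots> = adj (\<theta> a) * \<theta> a + adj (\<theta> b) * \<theta> b"
    using add[OF aA vN_mult[OF A bA bA]] mult[OF vN_adj[OF A a] a] mult[OF vN_adj[OF A bA] bA]
      adj[OF a] adj[OF bA] positive_bop_adj[OF b(1)] by simp
  finally have "1 = adj (\<theta> a) * \<theta> a + adj (\<theta> b) * \<theta> b" by (simp only: one)
  hence "1 - adj (\<theta> a) * \<theta> a = adj (\<theta> b) * \<theta> b" by (metis add_diff_cancel_left')
  hence "positive_bop (1 - adj (\<theta> a) * \<theta> a)" by simp
  from positive_bop_Re[OF this, of x] have "(norm (bop_apply (\<theta> a) x))\<^sup>2 \<le> (norm x)\<^sup>2"
    unfolding norm_bop_eq by (simp add: cinner_diff_right cinner_self)
  thus ?thesis by (rule power2_le_imp_le) simp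
qed

lemma star_isomorphism_opnorm_le:
  assumes \<theta>: "star_isomorphism A B \<theta>" and A: "von_neumann_algebra A" and a: "a \<in> A"
    and one: "\<theta> 1 = 1"
  shows "opnorm (\<theta> a) \<le> opnorm a"
proof (rule field_le_epsilon)
  fix e :: real assume e: "e > 0"
  \<comment> \<open>The slack keeps the divisor positive even if a = 0.\<close>
  define r where "r = opnorm a + e"
  have r: "r > 0" using e opnorm_nonneg[of a] unfolding r_def by linarith
  have scale: "\<theta> (c *\<^sub>C a) = c *\<^sub>C \<theta> a" for c
    using \<theta> a by (auto simp: star_isomorphism_def)
  have "norm (bop_apply (\<theta> (of_real (1/r) *\<^sub>C a)) x) \<le> norm x" for x
  proof (rule star_isomorphism_contractive[OF \<theta> A vN_scaleC[OF A a] one])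
    fix x
    have "norm (bop_apply a x) \<le> r * norm x"
      using opnorm[of a x] e by (simp add: r_def distrib_right add_increasing2)
    thus "norm (bop_apply (of_real (1/r) *\<^sub>C a) x) \<le> norm x"
      using r by (simp add: norm_scaleC norm_divide field_simps)
  qed
  hence "norm (bop_apply (\<theta> a) x) \<le> r * norm x" for x
    using r unfolding scale by (simp add: norm_scaleC norm_divide field_simps)
  thus "opnorm (\<theta> a) \<le> opnorm a + e" using r by (intro opnorm_le) (auto simp: r_def)
qed


section \<open>Operators on spaces of square summable functions\<close>

lemma ell2_eqI: "(\<And>g. ell2_fun x g = ell2_fun y g) \<Longrightarrow> x = y"
  by (simp add: ell2_fun_inject[symmetric] fun_eq_iff)

lemmas ell2_rep [simp] = zero_ell2.rep_eq plus_ell2.rep_eq minus_ell2.rep_eq uminus_ell2.rep_eq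
  scaleR_ell2.rep_eq scaleC_ell2.rep_eq ell2_single.rep_eq ell2_translate.rep_eq

lemma cinner_ell2_single: "cinner (ell2_single g \<xi>) \<eta> = cinner \<xi> (ell2_fun \<eta> g)"
proof -
  have "cinner (ell2_single g \<xi>) \<eta> = (\<Sum>\<^sub>\<infinity>h\<in>{g}. cinner \<xi> (ell2_fun \<eta> h))"
    unfolding cinner_ell2_def by (rule infsum_cong_neutral) auto
  thus ?thesis by simp
qed

lemma ell2_single_scaleC: "ell2_single g (c *\<^sub>C \<xi>) = c *\<^sub>C ell2_single g \<xi>"
  by (rule ell2_eqI) simp

lemma ell2_pointwise_exists:
  fixes f :: "'g \<Rightarrow> 'h::complex_hilbert bop"
  assumes C: "0 \<le> C" and bound: "\<And>g x. norm (bop_apply (f g) x) \<le> C * norm x"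
  shows "\<exists>T. \<forall>\<xi> g. ell2_fun (bop_apply T \<xi>) g = bop_apply (f g) (ell2_fun \<xi> g)"
proof -
  have sq: "(norm (bop_apply (f g) x))\<^sup>2 \<le> C\<^sup>2 * (norm x)\<^sup>2" for g x
    using power_mono[OF bound[of g x], of 2] by (simp add: power_mult_distrib)
  have sC: "(\<lambda>g. C\<^sup>2 * (norm (ell2_fun \<xi> g))\<^sup>2) summable_on UNIV" for \<xi> :: "('g, 'h) ell2"
    using square_summable_ell2_fun[of \<xi>] unfolding square_summable_def
    by (rule summable_on_cmult_right)
  have ss: "square_summable (\<lambda>g. bop_apply (f g) (ell2_fun \<xi> g))" for \<xi> :: "('g, 'h) ell2"
    unfolding square_summable_def
    by (rule summable_on_comparison_test[OF sC[of \<xi>]]) (simp_all add: sq)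
  define T where "T \<xi> = Ell2 (\<lambda>g. bop_apply (f g) (ell2_fun \<xi> g))" for \<xi>
  have T: "ell2_fun (T \<xi>) g = bop_apply (f g) (ell2_fun \<xi> g)" for \<xi> g
    using ss[of \<xi>] by (simp add: T_def Ell2_inverse)
  have "\<exists>T'. \<forall>\<xi>. bop_apply T' \<xi> = T \<xi>"
  proof (rule bop_existsI)
    show "T (\<xi> + \<eta>) = T \<xi> + T \<eta>" for \<xi> \<eta> by (rule ell2_eqI) (simp add: T)
    show "T (c *\<^sub>C \<xi>) = c *\<^sub>C T \<xi>" for c \<xi> by (rule ell2_eqI) (simp add: T)
    fix \<xi>
    have "(norm (T \<xi>))\<^sup>2 \<le> (\<Sum>\<^sub>\<infinity>g. C\<^sup>2 * (norm (ell2_fun \<xi> g))\<^sup>2)"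
      unfolding norm_ell2_square T
      by (rule infsum_mono[OF ss[unfolded square_summable_def] sC]) (simp add: sq)
    also have "\<dots> = (C * norm \<xi>)\<^sup>2"
      by (simp add: infsum_cmult_right' norm_ell2_square power_mult_distrib)
    finally show "norm (T \<xi>) \<le> C * norm \<xi>"
      by (rule power2_le_imp_le) (simp add: C)
  qed
  then obtain T' where "\<And>\<xi>. bop_apply T' \<xi> = T \<xi>" by blast
  thus ?thesis using T by (intro exI[of _ T']) simp
qed

text \<open>The amplification 1 tensor t. For t in the commutant of A it commutes with the crossed
  product, for arbitrary t with the group von Neumann algebra; both facts are later read off at the
  matrix entries.\<close>

definition ell2_diag :: "'h::complex_hilbert bop \<Rightarrow> ('g, 'h) ell2 bop" where
  "ell2_diag t = (SOME T. \<forall>\<xi> g. ell2_fun (bop_apply T \<xi>) g = bop_apply t (ell2_fun \<xi> g))"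

lemma ell2_diag [simp]:
  fixes t :: "'h::complex_hilbert bop" and \<xi> :: "('g, 'h) ell2"
  shows "ell2_fun (bop_apply (ell2_diag t) \<xi>) g = bop_apply t (ell2_fun \<xi> g)"
proof -
  have "\<exists>T. \<forall>(\<xi>::('g, 'h) ell2) g. ell2_fun (bop_apply T \<xi>) g = bop_apply t (ell2_fun \<xi> g)"
    by (rule ell2_pointwise_exists[of "opnorm t" "\<lambda>_. t"]) (simp_all add: opnorm)
  from someI_ex[OF this] show ?thesis unfolding ell2_diag_def by blast
qed

lemma adj_ell2_diag: "adj (ell2_diag t) = ell2_diag (adj t)"
  by (rule adj_eqI) (simp add: cinner_ell2_def cinner_adj_left)

lemma bounded_linear_ell2_single: "bounded_linear (ell2_single g :: 'h::complex_hilbert \<Rightarrow> ('g, 'h) ell2)"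
proof (rule bounded_linear_intro)
  show "norm (ell2_single g \<xi> :: ('g, 'h) ell2) \<le> norm \<xi> * 1" for \<xi> :: 'h
    by (simp add: norm_ell2_single)
qed (rule ell2_eqI; simp)+

lemma bounded_linear_ell2_fun: "bounded_linear (\<lambda>\<eta> :: ('g, 'h::complex_hilbert) ell2. ell2_fun \<eta> g)"
proof (rule bounded_linear_intro)
  show "norm (ell2_fun \<eta> g) \<le> norm \<eta> * 1" for \<eta> :: "('g, 'h) ell2"
    by (simp add: norm_ell2_fun_le)
qed simp_all

lift_definition entry :: "('g, 'h::complex_hilbert) ell2 bop \<Rightarrow> 'g \<Rightarrow> 'g \<Rightarrow> 'h bop"
  is "\<lambda>x g h \<xi>. ell2_fun (x (ell2_single h \<xi>)) g"
proof (intro conjI allI)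
  fix x :: "('g, 'h) ell2 \<Rightarrow> ('g, 'h) ell2" and g h
  assume x: "bounded_linear x \<and> (\<forall>c \<xi>. x (c *\<^sub>C \<xi>) = c *\<^sub>C x \<xi>)"
  show "bounded_linear (\<lambda>\<xi>. ell2_fun (x (ell2_single h \<xi>)) g)"
    using bounded_linear_compose[OF bounded_linear_ell2_fun
        bounded_linear_compose[OF conjunct1[OF x] bounded_linear_ell2_single]] .
  show "ell2_fun (x (ell2_single h (c *\<^sub>C \<xi>))) g = c *\<^sub>C ell2_fun (x (ell2_single h \<xi>)) g" for c \<xi>
    using x by (simp add: ell2_single_scaleC)
qed

lemmas entry_apply = entry.rep_eq

lemma coeff_0_entry: "coeff_0 T = entry T 0 0"
  by (rule bop_eqI) (simp add: coeff_0.rep_eq entry_apply)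

lemma cinner_entry:
  "cinner \<xi> (bop_apply (entry T g h) \<eta>) = cinner (ell2_single g \<xi>) (bop_apply T (ell2_single h \<eta>))"
  by (simp add: entry_apply cinner_ell2_single)

lemma entry_add: "entry (S + T) g h = entry S g h + entry T g h"
  and entry_diff: "entry (S - T) g h = entry S g h - entry T g h"
  and entry_scaleC: "entry (c *\<^sub>C T) g h = c *\<^sub>C entry T g h"
  and entry_zero: "entry 0 g h = 0"
  by (rule bop_eqI; simp add: entry_apply)+

lemma entry_adj: "entry (adj T) g h = adj (entry T h g)"
proof (rule adj_eqI[symmetric])
  fix \<xi> \<eta>
  have "cinner (bop_apply (entry (adj T) g h) \<xi>) \<eta>
      = cnj (cinner (ell2_single g \<eta>) (bop_apply (adj T) (ell2_single h \<xi>)))"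
    by (simp add: cinner_commute[of _ \<eta>] cinner_entry)
  also have "\<dots> = cinner (ell2_single h \<xi>) (bop_apply T (ell2_single g \<eta>))"
    by (simp add: cinner_adj_right cinner_commute[symmetric])
  finally show "cinner (bop_apply (entry (adj T) g h) \<xi>) \<eta> = cinner \<xi> (bop_apply (entry T h g) \<eta>)"
    by (simp add: cinner_entry)
qed

lemma norm_entry_le: "norm (bop_apply (entry T g h) \<xi>) \<le> opnorm T * norm \<xi>"
proof -
  have "norm (bop_apply (entry T g h) \<xi>) \<le> norm (bop_apply T (ell2_single h \<xi>))"
    unfolding entry_apply by (rule norm_ell2_fun_le)
  also have "\<dots> \<le> opnorm T * norm (ell2_single h \<xi>)" by (rule opnorm)
  finally show ?thesis by (simp add: norm_ell2_single)
qed

lemma diag_single: "bop_apply (ell2_diag t) (ell2_single h \<xi>) = ell2_single h (bop_apply t \<xi>)"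
  by (rule ell2_eqI) simp

lemma entry_commute_diag:
  assumes "T * ell2_diag t = ell2_diag t * T"
  shows "entry T g h * t = t * entry T g h"
proof (rule bop_eqI)
  fix \<xi>
  have "bop_apply (T * ell2_diag t) (ell2_single h \<xi>) = bop_apply (ell2_diag t * T) (ell2_single h \<xi>)"
    by (simp only: assms)
  from arg_cong[OF this, of "\<lambda>\<eta>. ell2_fun \<eta> g"]
  show "bop_apply (entry T g h * t) \<xi> = bop_apply (t * entry T g h) \<xi>"
    by (simp add: entry_apply diag_single)
qed

lemma positive_entry: "positive_bop T \<Longrightarrow> positive_bop (entry T g g)"
  unfolding positive_bop_def by (simp add: cinner_entry)


section \<open>Passing from generators to the bicommutant\<close>

inductive_set complex_span :: "'a::complex_hilbert set \<Rightarrow> 'a set" for Z where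
  base: "z \<in> Z \<Longrightarrow> z \<in> complex_span Z"
| zero: "0 \<in> complex_span Z"
| add: "x \<in> complex_span Z \<Longrightarrow> y \<in> complex_span Z \<Longrightarrow> x + y \<in> complex_span Z"
| scale: "x \<in> complex_span Z \<Longrightarrow> c *\<^sub>C x \<in> complex_span Z"

lemma bool_ell2_entries:
  "ell2_fun (bop_apply P \<xi>) i
    = bop_apply (entry P i True) (ell2_fun \<xi> True) + bop_apply (entry P i False) (ell2_fun \<xi> False)"
proof -
  have "\<xi> = ell2_single True (ell2_fun \<xi> True) + ell2_single False (ell2_fun \<xi> False)"
  proof (rule ell2_eqI)
    show "ell2_fun \<xi> g = ell2_fun (ell2_single True (ell2_fun \<xi> True) + ell2_single False (ell2_fun \<xi> False)) g" for g
      by (cases g) simp_all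
  qed
  hence "bop_apply P \<xi> = bop_apply P (ell2_single True (ell2_fun \<xi> True) + ell2_single False (ell2_fun \<xi> False))"
    by simp
  thus ?thesis by (simp add: entry_apply)
qed

text \<open>
  The amplification by \<open>\<ell>\<^sup>2({True, False})\<close> turns the two vectors into one, for which the
  projection onto the cyclic subspace settles the claim.
\<close>

lemma bicommutant_two_vectors:
  fixes W :: "'h::complex_hilbert bop set"
  assumes one: "1 \<in> W" and mult: "\<And>v w. v \<in> W \<Longrightarrow> w \<in> W \<Longrightarrow> v * w \<in> W"
    and adj: "\<And>w. w \<in> W \<Longrightarrow> adj w \<in> W" and T: "T \<in> commutant (commutant W)"
    and eq: "\<And>w. w \<in> W \<Longrightarrow> cinner a1 (bop_apply w z1) = cinner a2 (bop_apply w z2)"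
  shows "cinner a1 (bop_apply T z1) = cinner a2 (bop_apply T z2)"
proof -
  define D where "D w = (ell2_diag w :: (bool, 'h) ell2 bop)" for w
  define \<zeta> where "\<zeta> = ell2_single True z1 + ell2_single False z2"
  \<comment> \<open>The minus sign turns equality of the two coefficients into orthogonality of this
    vector to the orbit of \<open>\<zeta>\<close>.\<close>
  define \<alpha> where "\<alpha> = ell2_single True a1 - ell2_single False a2"
  define V where "V = complex_span ((\<lambda>w. bop_apply (D w) \<zeta>) ` W)"
  have D\<zeta>: "cinner \<alpha> (bop_apply (D w) \<zeta>) = cinner a1 (bop_apply w z1) - cinner a2 (bop_apply w z2)" for w
    by (simp add: \<alpha>_def \<zeta>_def D_def cinner_diff_left cinner_ell2_single)
  obtain p where p: "projection p" "\<And>x. x \<in> closure V \<Longrightarrow> bop_apply p x = x"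
    "\<And>x. bop_apply p x \<in> closure V"
    by (rule projection_onto_closure[of V]) (auto simp: V_def intro: complex_span.intros)
  have "p \<in> commutant (D ` W)"
  proof (rule projection_commutes[OF p])
    fix w x assume "w \<in> D ` W" and x: "x \<in> V"
    then obtain w' where w: "w = D w'" "w' \<in> W" by blast
    show "bop_apply w x \<in> V" using x unfolding V_def
    proof induction
      case (base z)
      then obtain v where v: "v \<in> W" "z = bop_apply (D v) \<zeta>" by blast
      have "bop_apply w z = bop_apply (D (w' * v)) \<zeta>"
        unfolding v(2) w(1) by (rule ell2_eqI) (simp add: D_def)
      thus ?case using mult[OF w(2) v(1)] by (auto intro: complex_span.base)
    qed (simp_all add: complex_span.intros)
  qed (auto simp: D_def adj_ell2_diag adj)
  \<comment> \<open>The projection commutes with the amplification of W, so its four entries commute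
    with W and therefore with T.\<close>
  hence "entry p i j \<in> commutant W" for i j
    by (auto intro!: commutantI entry_commute_diag simp: D_def dest: commutantD)
  hence comm: "T * entry p i j = entry p i j * T" for i j using T commutantD by blast
  have pT: "bop_apply p (bop_apply (D T) \<xi>) = bop_apply (D T) (bop_apply p \<xi>)" for \<xi>
  proof (rule ell2_eqI)
    fix i
    have "bop_apply (entry p i j) (bop_apply T x) = bop_apply T (bop_apply (entry p i j) x)" for j x
      using arg_cong[OF comm[of i j], of "\<lambda>a. bop_apply a x"] by simp
    thus "ell2_fun (bop_apply p (bop_apply (D T) \<xi>)) i = ell2_fun (bop_apply (D T) (bop_apply p \<xi>)) i"
      by (simp add: bool_ell2_entries[of p] D_def)
  qed
  have "bop_apply (D 1) \<zeta> = \<zeta>" by (rule ell2_eqI) (simp add: D_def)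
  hence "\<zeta> \<in> V" unfolding V_def using one by (intro complex_span.base) force
  hence "bop_apply (D T) \<zeta> \<in> closure V"
    using p(3)[of "bop_apply (D T) \<zeta>"] pT[of \<zeta>] p(2)[of \<zeta>] closure_subset by fastforce
  moreover have V0: "cinner \<alpha> x = 0" if "x \<in> V" for x
    using that unfolding V_def
    by induction (auto simp: D\<zeta> eq cinner_add_right cinner_scaleC_right)
  have "cinner \<alpha> x = 0" if x: "x \<in> closure V" for x
  proof -
    obtain f where f: "\<And>n. f n \<in> V" "f \<longlonglongrightarrow> x"
      using x unfolding closure_sequential by blast
    have "(\<lambda>n. cinner \<alpha> (f n)) \<longlonglongrightarrow> cinner \<alpha> x" by (intro tendsto_cinner tendsto_const f)
    thus ?thesis using V0[OF f(1)] by (simp add: LIMSEQ_const_iff)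
  qed
  ultimately have "cinner \<alpha> (bop_apply (D T) \<zeta>) = 0" by blast
  thus ?thesis by (simp add: D\<zeta>)
qed


section \<open>States and their two-norms\<close>

text \<open>Cyclicity is left to \<open>vN_trace\<close>: on the crossed product the canonical trace
  is handled as a state, so both algebras share what follows.\<close>

locale vN_state =
  fixes A :: "'h::complex_hilbert bop set" and \<tau> :: "'h bop \<Rightarrow> complex"
  assumes vN: "von_neumann_algebra A"
    and state_add: "a \<in> A \<Longrightarrow> b \<in> A \<Longrightarrow> \<tau> (a + b) = \<tau> a + \<tau> b"
    and state_scaleC: "a \<in> A \<Longrightarrow> \<tau> (c *\<^sub>C a) = c * \<tau> a"
    and state_positive: "a \<in> A \<Longrightarrow> positive_bop a \<Longrightarrow> \<tau> a \<in> \<real>\<^sub>\<ge>\<^sub>0"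
    and state_one: "\<tau> 1 = 1"
begin

lemmas closed = vN_closed[OF vN] vN_sum[OF vN]

lemma state_zero [simp]: "\<tau> 0 = 0"
  using state_add[OF closed(2) closed(2)] by simp

lemma state_uminus: "a \<in> A \<Longrightarrow> \<tau> (- a) = - \<tau> a"
  using state_scaleC[of a "-1"] by (simp add: scaleC_bop_simps)

lemma state_diff: "a \<in> A \<Longrightarrow> b \<in> A \<Longrightarrow> \<tau> (a - b) = \<tau> a - \<tau> b"
  using state_add[of a "- b"] by (simp add: state_uminus closed)

lemma state_sum: "(\<And>i. i \<in> I \<Longrightarrow> f i \<in> A) \<Longrightarrow> \<tau> (sum f I) = (\<Sum>i\<in>I. \<tau> (f i))"
  by (induction I rule: infinite_finite_induct) (simp_all add: state_add closed)

lemma state_mono: "a \<in> A \<Longrightarrow> b \<in> A \<Longrightarrow> positive_bop (b - a) \<Longrightarrow> Re (\<tau> a) \<le> Re (\<tau> b)"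
  using state_positive[of "b - a"] by (simp add: state_diff closed complex_nonneg_Reals_iff)

lemma state_nonneg: "a \<in> A \<Longrightarrow> positive_bop a \<Longrightarrow> 0 \<le> Re (\<tau> a)"
  using state_positive by (simp add: complex_nonneg_Reals_iff)

lemma state_adj_mult_nonneg: "a \<in> A \<Longrightarrow> 0 \<le> Re (\<tau> (adj a * a))"
  by (intro state_nonneg closed) simp_all

lemma two_norm_square: "a \<in> A \<Longrightarrow> (two_norm \<tau> a)\<^sup>2 = Re (\<tau> (adj a * a))"
  by (simp add: two_norm_def state_adj_mult_nonneg)

lemma two_norm_nonneg: "a \<in> A \<Longrightarrow> 0 \<le> two_norm \<tau> a"
  by (simp add: two_norm_def state_adj_mult_nonneg)

lemma state_adj_mult: "a \<in> A \<Longrightarrow> \<tau> (adj a * a) = of_real ((two_norm \<tau> a)\<^sup>2)"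
  using state_positive[of "adj a * a"]
  by (simp add: two_norm_square closed complex_eq_iff complex_nonneg_Reals_iff)

lemma two_norm_scaleC:
  assumes "a \<in> A" shows "two_norm \<tau> (c *\<^sub>C a) = cmod c * two_norm \<tau> a"
proof -
  have "adj (c *\<^sub>C a) * (c *\<^sub>C a) = (cnj c * c) *\<^sub>C (adj a * a)"
    by (simp add: scaleC_bop_simps mult.commute)
  also have "cnj c * c = of_real ((cmod c)\<^sup>2)" by (simp only: complex_norm_square mult.commute)
  finally have "\<tau> (adj (c *\<^sub>C a) * (c *\<^sub>C a)) = of_real ((cmod c)\<^sup>2) * \<tau> (adj a * a)"
    using assms by (simp add: state_scaleC closed)
  thus ?thesis by (simp add: two_norm_def real_sqrt_mult)
qed

text \<open>Hermitian symmetry follows because \<tau> is real on adj x x for x = a + b and for x = a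
  + i b.\<close>

lemma state_adj_mult_commute:
  assumes a: "a \<in> A" and b: "b \<in> A"
  shows "\<tau> (adj b * a) = cnj (\<tau> (adj a * b))"
proof -
  have ex: "\<tau> (adj (a + c *\<^sub>C b) * (a + c *\<^sub>C b))
      = \<tau> (adj a * a) + c * \<tau> (adj a * b) + cnj c * \<tau> (adj b * a) + cnj c * c * \<tau> (adj b * b)" for c
  proof -
    have "adj (a + c *\<^sub>C b) * (a + c *\<^sub>C b)
        = adj a * a + c *\<^sub>C (adj a * b) + cnj c *\<^sub>C (adj b * a) + (cnj c * c) *\<^sub>C (adj b * b)"
      by (simp add: scaleC_bop_simps algebra_simps)
    thus ?thesis using a b by (simp add: state_add state_scaleC closed)
  qed
  have im: "Im (\<tau> (adj x * x)) = 0" if "x \<in> A" for x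
    using that by (simp add: state_adj_mult)
  have "Im (\<tau> (adj a * b) + \<tau> (adj b * a)) = 0"
    using ex[of 1] im[OF a] im[OF b] im[of "a + 1 *\<^sub>C b"] a b by (simp add: closed)
  moreover have "Im (\<i> * \<tau> (adj a * b) - \<i> * \<tau> (adj b * a)) = 0"
    using ex[of \<i>] im[OF a] im[OF b] im[of "a + \<i> *\<^sub>C b"] a b by (simp add: closed)
  ultimately show ?thesis by (simp add: complex_eq_iff)
qed

lemma two_norm_add_square:
  assumes a: "a \<in> A" and b: "b \<in> A"
  shows "(two_norm \<tau> (a + b))\<^sup>2 = (two_norm \<tau> a)\<^sup>2 + 2 * Re (\<tau> (adj a * b)) + (two_norm \<tau> b)\<^sup>2"
proof -
  have "adj (a + b) * (a + b) = adj a * a + adj a * b + adj b * a + adj b * b"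
    by (simp add: algebra_simps)
  thus ?thesis using a b
    by (simp add: two_norm_square state_add closed state_adj_mult_commute[of a b])
qed

lemma state_Cauchy_Schwarz:
  assumes a: "a \<in> A" and b: "b \<in> A"
  shows "cmod (\<tau> (adj a * b)) \<le> two_norm \<tau> a * two_norm \<tau> b"
proof -
  define m where "m = cmod (\<tau> (adj a * b))"
  obtain s where s: "cmod s = 1" "s * \<tau> (adj a * b) = of_real m"
  proof (cases "\<tau> (adj a * b) = 0")
    case True thus ?thesis using that[of 1] by (simp add: m_def)
  next
    case False
    show ?thesis
    proof (rule that[of "cnj (sgn (\<tau> (adj a * b)))"])
      show "cmod (cnj (sgn (\<tau> (adj a * b)))) = 1" using False by (simp add: norm_sgn)
      let ?z = "\<tau> (adj a * b)"
      have "cnj (sgn ?z) * ?z = (?z * cnj ?z) / of_real (cmod ?z)" by (simp add: sgn_eq)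
      also have "?z * cnj ?z = of_real (m * m)"
        by (simp only: m_def complex_norm_square[symmetric] power2_eq_square[symmetric])
      finally show "cnj (sgn ?z) * ?z = of_real m" using False by (simp add: m_def)
    qed
  qed
  define p where "p = two_norm \<tau> a"
  define q where "q = two_norm \<tau> b"
  have pq: "0 \<le> p" "0 \<le> q" using a b by (simp_all add: p_def q_def two_norm_nonneg)
  \<comment> \<open>The phase s absorbs the argument, so a real parameter t suffices for the
    discriminant argument.\<close>
  have ge: "0 \<le> p\<^sup>2 - 2 * t * m + t\<^sup>2 * q\<^sup>2" for t
  proof -
    let ?c = "of_real (- t) * s"
    have "0 \<le> (two_norm \<tau> (a + ?c *\<^sub>C b))\<^sup>2" by simp
    also have "\<dots> = p\<^sup>2 + 2 * Re (?c * \<tau> (adj a * b)) + (cmod ?c * q)\<^sup>2"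
      using a b by (simp add: two_norm_add_square two_norm_scaleC closed scaleC_bop_simps state_scaleC p_def q_def)
    also have "?c * \<tau> (adj a * b) = of_real (- t * m)" using s(2) by (simp add: mult.assoc)
    also have "cmod ?c = \<bar>t\<bar>" using s(1) by (simp add: norm_mult)
    finally show ?thesis by (simp add: power_mult_distrib)
  qed
  have "m \<le> p * q"
  proof (cases "q = 0")
    case True
    have "m = 0"
    proof (rule ccontr)
      assume "m \<noteq> 0"
      \<comment> \<open>With q = 0 the expression in \<open>ge\<close> is affine in t, and this t
        makes it equal to -1.\<close>
      hence "2 * ((p\<^sup>2 + 1) / (2 * m)) * m = p\<^sup>2 + 1" by simp
      thus False using ge[of "(p\<^sup>2 + 1) / (2 * m)"] True by simp
    qed
    thus ?thesis by (simp add: True)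
  next
    case False
    have "(m / q\<^sup>2)\<^sup>2 * q\<^sup>2 = m\<^sup>2 / q\<^sup>2" "2 * (m / q\<^sup>2) * m = 2 * (m\<^sup>2 / q\<^sup>2)"
      using False by (simp_all add: field_simps power2_eq_square)
    hence "m\<^sup>2 / q\<^sup>2 \<le> p\<^sup>2" using ge[of "m / q\<^sup>2"] by linarith
    hence "m\<^sup>2 \<le> (p * q)\<^sup>2" using False by (simp add: pos_divide_le_eq power_mult_distrib)
    thus ?thesis by (rule power2_le_imp_le) (simp add: pq)
  qed
  thus ?thesis by (simp add: m_def p_def q_def)
qed

lemma two_norm_triangle:
  assumes a: "a \<in> A" and b: "b \<in> A"
  shows "two_norm \<tau> (a + b) \<le> two_norm \<tau> a + two_norm \<tau> b"
proof -
  have "Re (\<tau> (adj a * b)) \<le> two_norm \<tau> a * two_norm \<tau> b"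
    using state_Cauchy_Schwarz[OF a b] complex_Re_le_cmod order_trans by blast
  hence "(two_norm \<tau> (a + b))\<^sup>2 \<le> (two_norm \<tau> a + two_norm \<tau> b)\<^sup>2"
    by (simp add: two_norm_add_square[OF a b] power2_sum)
  thus ?thesis by (rule power2_le_imp_le) (simp add: two_norm_nonneg a b)
qed

lemma two_norm_zero [simp]: "two_norm \<tau> 0 = 0"
  by (simp add: two_norm_def)

lemma two_norm_sum:
  "(\<And>i. i \<in> I \<Longrightarrow> f i \<in> A) \<Longrightarrow> two_norm \<tau> (sum f I) \<le> (\<Sum>i\<in>I. two_norm \<tau> (f i))"
proof (induction I rule: infinite_finite_induct)
  case (insert i I)
  have "two_norm \<tau> (f i + sum f I) \<le> two_norm \<tau> (f i) + two_norm \<tau> (sum f I)"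
    using insert.prems by (intro two_norm_triangle closed) auto
  thus ?case using insert by simp
qed simp_all

lemma two_norm_mult_left:
  assumes t: "t \<in> A" and a: "a \<in> A"
  shows "two_norm \<tau> (t * a) \<le> opnorm t * two_norm \<tau> a"
proof -
  have "positive_bop (adj a * (of_real ((opnorm t)\<^sup>2) *\<^sub>C 1 - adj t * t) * a)"
    by (intro positive_bop_conj positive_bop_opnorm)
  also have "adj a * (of_real ((opnorm t)\<^sup>2) *\<^sub>C 1 - adj t * t) * a
      = of_real ((opnorm t)\<^sup>2) *\<^sub>C (adj a * a) - adj (t * a) * (t * a)"
    by (simp add: algebra_simps scaleC_bop_simps)
  finally have "Re (\<tau> (adj (t * a) * (t * a))) \<le> Re (\<tau> (of_real ((opnorm t)\<^sup>2) *\<^sub>C (adj a * a)))"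
    using t a by (intro state_mono closed) simp_all
  hence "(two_norm \<tau> (t * a))\<^sup>2 \<le> (opnorm t * two_norm \<tau> a)\<^sup>2"
    using t a by (simp add: two_norm_square closed state_scaleC power_mult_distrib)
  thus ?thesis by (rule power2_le_imp_le) (simp add: two_norm_nonneg a)
qed

text \<open>Adjoint invariance is a hypothesis because it comes from cyclicity on A, but from
  Parseval on the crossed product.\<close>

lemma two_norm_mult_right_if:
  assumes adj: "\<And>a. a \<in> A \<Longrightarrow> two_norm \<tau> (adj a) = two_norm \<tau> a" and "t \<in> A" "a \<in> A"
  shows "two_norm \<tau> (a * t) \<le> opnorm t * two_norm \<tau> a"
proof -
  have "two_norm \<tau> (a * t) = two_norm \<tau> (adj t * adj a)"
    using adj[of "a * t"] assms by (simp add: closed)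
  also have "\<dots> \<le> opnorm (adj t) * two_norm \<tau> (adj a)"
    using assms by (intro two_norm_mult_left closed)
  also have "\<dots> \<le> opnorm t * two_norm \<tau> a"
    using assms by (intro mult_mono opnorm_adj_le) (simp_all add: adj two_norm_nonneg)
  finally show ?thesis .
qed

lemma two_norm_one: "two_norm \<tau> 1 = 1"
  by (simp add: two_norm_def state_one)

lemma cmod_state_le:
  assumes a: "a \<in> A" shows "cmod (\<tau> a) \<le> two_norm \<tau> a"
  using state_Cauchy_Schwarz[OF closed(3) a] by (simp add: two_norm_one)

end

text \<open>For the vector functional of \<open>\<xi>\<close>, the element \<open>m\<close> below plays the role of the negative
  part in a Hahn decomposition of \<open>C \<langle>\<xi>, \<cdot> \<xi>\<rangle> - \<tau>\<close>; it is built greedily as a countable sum.\<close>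

lemma (in vN_state) exists_dominated_complement:
  assumes C: "0 < C"
  obtains m where "m \<in> A" "positive_bop m" "positive_bop (1 - m)"
    "C * Re (cinner \<xi> (bop_apply m \<xi>)) \<le> 1"
    "\<And>y. y \<in> A \<Longrightarrow> positive_bop y \<Longrightarrow> positive_bop (1 - m - y) \<Longrightarrow>
      Re (\<tau> y) \<le> C * Re (cinner \<xi> (bop_apply y \<xi>))"
proof -
  define \<omega> where "\<omega> y = Re (cinner \<xi> (bop_apply y \<xi>))" for y
  have \<omega>_add: "\<omega> (x + y) = \<omega> x + \<omega> y" for x y by (simp add: \<omega>_def cinner_add_right)
  \<comment> \<open>Pieces that still fit under 1 - m and on which \<tau> dominates C times the
    vector functional. Each stage adds one whose trace is at least half of the supremum
    \<open>R m\<close>.\<close>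
  define S where "S m = {y \<in> A. positive_bop y \<and> positive_bop (1 - m - y) \<and> C * \<omega> y \<le> Re (\<tau> y)}" for m
  define R where "R m = (SUP y\<in>S m. Re (\<tau> y))" for m
  have bdd: "bdd_above ((\<lambda>y. Re (\<tau> y)) ` S m)" if "positive_bop m" for m
  proof (rule bdd_aboveI2)
    fix y assume y: "y \<in> S m"
    have "1 - y = (1 - m - y) + m" by simp
    hence "positive_bop (1 - y)" using y that by (simp only: positive_bop_add S_def mem_Collect_eq)
    thus "Re (\<tau> y) \<le> 1" using state_mono[of y 1] y by (simp add: S_def closed state_one)
  qed
  have "\<exists>y\<in>S m. R m / 2 \<le> Re (\<tau> y)" if "positive_bop m" "positive_bop (1 - m)" for m
  proof -
    have 0: "0 \<in> S m" using that by (simp add: S_def closed \<omega>_def)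
    show ?thesis
    proof (cases "R m \<le> 0")
      case True
      thus ?thesis using 0 by (intro bexI[of _ 0]) simp_all
    next
      case False
      hence "R m / 2 < R m" by simp
      hence "\<exists>y\<in>S m. R m / 2 < Re (\<tau> y)"
        unfolding R_def using 0 by (subst (asm) less_cSUP_iff) (auto intro: bdd that)
      thus ?thesis by (auto intro: less_imp_le)
    qed
  qed
  then obtain Y where Y: "\<And>m. positive_bop m \<Longrightarrow> positive_bop (1 - m) \<Longrightarrow> Y m \<in> S m"
    and YR: "\<And>m. positive_bop m \<Longrightarrow> positive_bop (1 - m) \<Longrightarrow> R m / 2 \<le> Re (\<tau> (Y m))"
    by metis
  define m where "m n = ((\<lambda>x. x + Y x) ^^ n) 0" for n
  have m0: "m 0 = 0" and mSuc: "m (Suc n) = m n + Y (m n)" for n by (simp_all add: m_def)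
  have inv: "m n \<in> A \<and> positive_bop (m n) \<and> positive_bop (1 - m n) \<and> C * \<omega> (m n) \<le> Re (\<tau> (m n))" for n
  proof (induction n)
    case 0
    show ?case by (simp add: m0 closed \<omega>_def)
  next
    case (Suc n)
    hence "Y (m n) \<in> S (m n)" using Y by blast
    moreover have "1 - m (Suc n) = 1 - m n - Y (m n)" by (simp add: mSuc)
    ultimately show ?case using Suc
      by (auto simp: S_def mSuc \<omega>_add state_add closed positive_bop_add distrib_left diff_diff_eq)
  qed
  have YS: "Y (m n) \<in> S (m n)" for n using inv Y by blast
  obtain l where l: "\<And>x. (\<lambda>n. bop_apply (m n) x) \<longlonglongrightarrow> bop_apply l x" "positive_bop l"
    "positive_bop (1 - l)" "\<And>n. positive_bop (l - m n)"
  proof (rule bop_monotone_limit[of m])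
    show "positive_bop (m (Suc n) - m n)" for n using YS by (simp add: mSuc S_def)
  qed (use inv in auto)
  have lA: "l \<in> A" using vN_limit[OF vN l(1)] inv by blast
  show ?thesis
  proof (rule that[OF lA l(2,3)])
    have "(\<lambda>n. C * \<omega> (m n)) \<longlonglongrightarrow> C * \<omega> l"
      unfolding \<omega>_def by (intro tendsto_intros tendsto_cinner l(1))
    moreover have "C * \<omega> (m n) \<le> 1" for n
      using inv[of n] state_mono[of "m n" 1] by (simp add: closed state_one)
    ultimately show "C * Re (cinner \<xi> (bop_apply l \<xi>)) \<le> 1"
      unfolding \<omega>_def[symmetric] by (intro LIMSEQ_le_const2) auto
    fix y assume y: "y \<in> A" "positive_bop y" "positive_bop (1 - l - y)"
    show "Re (\<tau> y) \<le> C * Re (cinner \<xi> (bop_apply y \<xi>))"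
    proof (rule ccontr)
      assume "\<not> ?thesis"
      hence lt: "C * \<omega> y < Re (\<tau> y)" by (simp add: \<omega>_def)
      have "0 \<le> \<omega> y" unfolding \<omega>_def by (rule positive_bop_Re[OF y(2)])
      hence pos: "0 < Re (\<tau> y)" using lt C by (smt (verit) mult_nonneg_nonneg)
      \<comment> \<open>A violating y remains available at every stage, so each stage gains at least
        half of its trace, against the total bound 1.\<close>
      have "y \<in> S (m n)" for n
      proof -
        have "1 - m n - y = (1 - l - y) + (l - m n)" by simp
        hence "positive_bop (1 - m n - y)" using y(3) l(4)[of n] by (simp only: positive_bop_add)
        thus ?thesis using y lt by (simp add: S_def)
      qed
      hence "Re (\<tau> y) \<le> R (m n)" for n
        unfolding R_def using inv by (intro cSUP_upper bdd) blast+
      hence step: "Re (\<tau> y) / 2 \<le> Re (\<tau> (Y (m n)))" for n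
        using YR[of "m n"] inv[of n] by (smt (verit) divide_right_mono)
      have "real n * (Re (\<tau> y) / 2) \<le> Re (\<tau> (m n))" for n
      proof (induction n)
        case (Suc n)
        have "Re (\<tau> (m (Suc n))) = Re (\<tau> (m n)) + Re (\<tau> (Y (m n)))"
          using inv[of n] YS[of n] by (simp add: mSuc state_add S_def)
        thus ?case using Suc step[of n] by (simp add: distrib_right)
      qed (simp add: m0)
      moreover have "Re (\<tau> (m n)) \<le> 1" for n
        using inv[of n] state_mono[of "m n" 1] by (simp add: closed state_one)
      ultimately have "real n * (Re (\<tau> y) / 2) \<le> 1" for n by (meson order_trans)
      moreover obtain n where "1 < real n * (Re (\<tau> y) / 2)"
        using reals_Archimedean3[OF half_gt_zero[OF pos]] by blast
      ultimately show False by (meson not_le)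
    qed
  qed
qed


section \<open>Faithful traces\<close>

locale vN_trace = vN_state +
  assumes trace_mult: "a \<in> A \<Longrightarrow> b \<in> A \<Longrightarrow> \<tau> (a * b) = \<tau> (b * a)"
    and faithful: "a \<in> A \<Longrightarrow> \<tau> (adj a * a) = 0 \<Longrightarrow> a = 0"
begin

lemma two_norm_adj: "a \<in> A \<Longrightarrow> two_norm \<tau> (adj a) = two_norm \<tau> a"
  by (simp add: two_norm_def trace_mult[of a "adj a"] closed)

lemmas two_norm_mult_right = two_norm_mult_right_if[OF two_norm_adj]

definition vector_dominated :: "'a bop \<Rightarrow> bool" where
  "vector_dominated r \<longleftrightarrow> r \<in> A \<and>
     (\<exists>\<eta> C. \<forall>a\<in>A. two_norm \<tau> (a * r) \<le> C * norm (bop_apply a \<eta>))"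

text \<open>On the right this uses the trace through \<open>two_norm_mult_right\<close>; on the
  left, in the next lemma, the vector just moves from \<eta> to b \<eta>.\<close>

lemma vector_dominated_mult_right:
  assumes "vector_dominated r" "b \<in> A" shows "vector_dominated (r * b)"
proof -
  obtain \<eta> C where C: "\<And>a. a \<in> A \<Longrightarrow> two_norm \<tau> (a * r) \<le> C * norm (bop_apply a \<eta>)"
    and r: "r \<in> A"
    using assms(1) by (auto simp: vector_dominated_def)
  have "two_norm \<tau> (a * (r * b)) \<le> (opnorm b * C) * norm (bop_apply a \<eta>)" if a: "a \<in> A" for a
  proof -
    have "two_norm \<tau> (a * (r * b)) \<le> opnorm b * two_norm \<tau> (a * r)"
      using two_norm_mult_right[of b "a * r"] a r assms(2) by (simp add: closed mult.assoc)
    also have "\<dots> \<le> opnorm b * (C * norm (bop_apply a \<eta>))" by (intro mult_left_mono C a) simp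
    finally show ?thesis by (simp add: mult.assoc)
  qed
  thus ?thesis using r assms(2) unfolding vector_dominated_def by (blast intro: closed)
qed

lemma vector_dominated_mult_left:
  assumes "vector_dominated r" "b \<in> A" shows "vector_dominated (b * r)"
proof -
  obtain \<eta> C where C: "\<And>a. a \<in> A \<Longrightarrow> two_norm \<tau> (a * r) \<le> C * norm (bop_apply a \<eta>)"
    and r: "r \<in> A"
    using assms(1) by (auto simp: vector_dominated_def)
  have "two_norm \<tau> (a * (b * r)) \<le> C * norm (bop_apply a (bop_apply b \<eta>))" if a: "a \<in> A" for a
    using C[of "a * b"] a assms(2) by (simp add: closed mult.assoc)
  thus ?thesis using r assms(2) unfolding vector_dominated_def by (blast intro: closed)
qed

text \<open>Domination makes the functional well defined and bounded on the orbit of \<eta>, where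
  the Riesz theorem yields \<zeta>. One \<eta> serves all b.\<close>

lemma vector_dominated_functional:
  assumes "vector_dominated r"
  obtains \<eta> where "\<And>b. b \<in> A \<Longrightarrow> \<exists>\<zeta>. \<forall>a\<in>A. \<tau> (b * a * r) = cinner \<zeta> (bop_apply a \<eta>)"
proof -
  obtain \<eta> C where C: "\<And>a. a \<in> A \<Longrightarrow> two_norm \<tau> (a * r) \<le> C * norm (bop_apply a \<eta>)"
    and r: "r \<in> A"
    using assms(1) by (auto simp: vector_dominated_def)
  show ?thesis
  proof (rule that)
    fix b assume b: "b \<in> A"
    define V where "V = (\<lambda>a. bop_apply a \<eta>) ` A"
    define f where "f v = Re (\<tau> (b * (SOME a. a \<in> A \<and> bop_apply a \<eta> = v) * r))" for v
    define C' where "C' = two_norm \<tau> (adj b) * C"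
    have bound: "cmod (\<tau> (b * a * r)) \<le> C' * norm (bop_apply a \<eta>)" if a: "a \<in> A" for a
    proof -
      have "cmod (\<tau> (b * a * r)) \<le> two_norm \<tau> (adj b) * two_norm \<tau> (a * r)"
        using state_Cauchy_Schwarz[of "adj b" "a * r"] a b r by (simp add: closed mult.assoc)
      also have "\<dots> \<le> two_norm \<tau> (adj b) * (C * norm (bop_apply a \<eta>))"
        using b by (intro mult_left_mono C a two_norm_nonneg closed)
      finally show ?thesis by (simp add: C'_def mult.assoc)
    qed
    have f: "f (bop_apply a \<eta>) = Re (\<tau> (b * a * r))" if a: "a \<in> A" for a
    proof -
      define a' where "a' = (SOME a'. a' \<in> A \<and> bop_apply a' \<eta> = bop_apply a \<eta>)"
      have a': "a' \<in> A" "bop_apply a' \<eta> = bop_apply a \<eta>"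
        using someI_ex[of "\<lambda>a'. a' \<in> A \<and> bop_apply a' \<eta> = bop_apply a \<eta>"] a
        by (auto simp: a'_def)
      have "cmod (\<tau> (b * (a' - a) * r)) \<le> C' * norm (bop_apply (a' - a) \<eta>)"
        using a a'(1) by (intro bound closed)
      hence "\<tau> (b * (a' - a) * r) = 0" by (simp add: a'(2))
      hence "\<tau> (b * a' * r) = \<tau> (b * a * r)"
        using a a'(1) b r by (simp add: right_diff_distrib left_diff_distrib state_diff closed)
      thus ?thesis by (simp add: f_def a'_def)
    qed
    have addV: "f (u + v) = f u + f v \<and> u + v \<in> V" if uv: "u \<in> V" "v \<in> V" for u v
    proof -
      obtain x y where xy: "x \<in> A" "y \<in> A" "u = bop_apply x \<eta>" "v = bop_apply y \<eta>"
        using uv by (auto simp: V_def)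
      have eq: "u + v = bop_apply (x + y) \<eta>" by (simp add: xy)
      have "b * (x + y) * r = b * x * r + b * y * r" by (simp add: algebra_simps)
      hence "f (bop_apply (x + y) \<eta>) = f u + f v"
        unfolding xy(3,4) using xy(1,2) b r by (simp add: f closed state_add del: bop_rep)
      thus ?thesis unfolding eq V_def using closed(4)[OF xy(1,2)] by blast
    qed
    have scaleV: "f (t *\<^sub>R v) = t * f v \<and> t *\<^sub>R v \<in> V" if v: "v \<in> V" for t v
    proof -
      obtain x where x: "x \<in> A" "v = bop_apply x \<eta>" using v by (auto simp: V_def)
      have eq: "t *\<^sub>R v = bop_apply (of_real t *\<^sub>C x) \<eta>" by (simp add: x scaleC_of_real)
      have "f (t *\<^sub>R v) = t * f v"
        unfolding eq using x b r by (simp add: f closed state_scaleC scaleC_bop_simps del: bop_rep)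
      moreover have "t *\<^sub>R v \<in> V" unfolding eq V_def using closed(8)[OF x(1)] by blast
      ultimately show ?thesis by blast
    qed
    obtain \<zeta> where \<zeta>: "\<And>v. v \<in> V \<Longrightarrow> f v = inner \<zeta> v"
    proof (rule riesz_subspace[of V f C'])
      show "subspace V"
        unfolding subspace_def using addV scaleV closed(2) by (auto simp: V_def intro!: image_eqI[of _ _ 0])
      show "\<bar>f v\<bar> \<le> C' * norm v" if "v \<in> V" for v
        using that bound abs_Re_le_cmod order_trans by (fastforce simp: V_def f)
    qed (use addV scaleV in auto)
    have "\<tau> (b * a * r) = cinner \<zeta> (bop_apply a \<eta>)" if a: "a \<in> A" for a
    proof (rule complex_eqI)
      have Re: "Re (\<tau> (b * x * r)) = inner \<zeta> (bop_apply x \<eta>)" if "x \<in> A" for x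
        using \<zeta>[of "bop_apply x \<eta>"] that by (simp add: f V_def)
      show "Re (\<tau> (b * a * r)) = Re (cinner \<zeta> (bop_apply a \<eta>))" by (simp add: Re a Re_cinner)
      show "Im (\<tau> (b * a * r)) = Im (cinner \<zeta> (bop_apply a \<eta>))"
        using Re[OF closed(8)[OF a, of \<i>]] a b r
        by (simp add: scaleC_bop_simps state_scaleC closed Im_cinner)
    qed
    thus "\<exists>\<zeta>. \<forall>a\<in>A. \<tau> (b * a * r) = cinner \<zeta> (bop_apply a \<eta>)" by blast
  qed
qed

text \<open>For every \<xi> and C the element r = 1 - m is dominated by the vector r \<xi>, so x = x
  m and the squared norm of x \<xi> is at most |x|^2 / C; then C grows.\<close>

lemma vector_dominated_separating:
  assumes x: "x \<in> A" and ann: "\<And>r. vector_dominated r \<Longrightarrow> x * r = 0"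
  shows "x = 0"
proof (rule bop_eqI)
  fix \<xi>
  have "(norm (bop_apply x \<xi>))\<^sup>2 \<le> (opnorm x)\<^sup>2 / real (Suc n)" for n
  proof -
    define C where "C = real (Suc n)"
    have C: "0 < C" by (simp add: C_def)
    obtain m where m: "m \<in> A" "positive_bop m" "positive_bop (1 - m)"
      "C * Re (cinner \<xi> (bop_apply m \<xi>)) \<le> 1"
      and dom: "\<And>y. y \<in> A \<Longrightarrow> positive_bop y \<Longrightarrow> positive_bop (1 - m - y) \<Longrightarrow>
        Re (\<tau> y) \<le> C * Re (cinner \<xi> (bop_apply y \<xi>))"
      using exists_dominated_complement[OF C] by blast
    define r where "r = 1 - m"
    have r: "r \<in> A" "positive_bop r" "positive_bop (1 - r)" "adj r = r"
      using m by (simp_all add: r_def closed positive_bop_adj)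
    have "vector_dominated r"
      unfolding vector_dominated_def
    proof (intro conjI exI ballI)
      fix a assume a: "a \<in> A"
      \<comment> \<open>Scaling that makes k adj a a at most 1, so that y fits under 1 - m; it
        cancels at the end.\<close>
      define k where "k = 1 / ((opnorm a)\<^sup>2 + 1)"
      have k: "0 < k" unfolding k_def by (intro divide_pos_pos add_nonneg_pos) simp_all
      have kle: "k * (opnorm a)\<^sup>2 \<le> 1"
        using zero_le_power2[of "opnorm a"] by (simp add: k_def divide_le_eq add_nonneg_pos)
      define y where "y = of_real k *\<^sub>C (adj (a * r) * (a * r))"
      have yA: "y \<in> A" using a r by (simp add: y_def closed)
      have ypos: "positive_bop y"
        unfolding y_def using k by (intro positive_bop_scale positive_bop_adj_mult) simp
      have "positive_bop (1 - of_real k *\<^sub>C (adj a * a))"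
      proof (rule positive_bopI)
        fix v
        have "k * (norm (bop_apply a v))\<^sup>2 \<le> k * (opnorm a * norm v)\<^sup>2"
          using k by (intro mult_left_mono power_mono opnorm) simp_all
        also have "\<dots> = (k * (opnorm a)\<^sup>2) * (norm v)\<^sup>2" by (simp add: power_mult_distrib)
        also have "\<dots> \<le> 1 * (norm v)\<^sup>2" by (intro mult_right_mono kle) simp
        finally show "0 \<le> Re (cinner v (bop_apply (1 - of_real k *\<^sub>C (adj a * a)) v))"
          by (simp add: cinner_diff_right cinner_self cinner_scaleC_right cinner_adj_right)
      qed simp
      hence "positive_bop (adj r * (1 - of_real k *\<^sub>C (adj a * a)) * r)" by (rule positive_bop_conj)
      moreover have "1 - m - y = (r - r * r) + adj r * (1 - of_real k *\<^sub>C (adj a * a)) * r"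
        by (simp add: y_def r(4) algebra_simps scaleC_bop_simps) (simp add: r_def algebra_simps)
      ultimately have "positive_bop (1 - m - y)"
        using positive_bop_diff_square[OF r(2,3)] by (simp only: positive_bop_add)
      from dom[OF yA ypos this]
      have "k * Re (\<tau> (adj (a * r) * (a * r))) \<le> C * (k * (norm (bop_apply a (bop_apply r \<xi>)))\<^sup>2)"
        using a r by (simp add: y_def state_scaleC closed cinner_scaleC_right cinner_adj_right cinner_self
            del: adj_mult)
      hence "k * (two_norm \<tau> (a * r))\<^sup>2 \<le> k * (C * (norm (bop_apply a (bop_apply r \<xi>)))\<^sup>2)"
        using a r by (simp add: two_norm_square closed mult.left_commute)
      hence "(two_norm \<tau> (a * r))\<^sup>2 \<le> (sqrt C * norm (bop_apply a (bop_apply r \<xi>)))\<^sup>2"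
        using k C by (simp add: power_mult_distrib)
      thus "two_norm \<tau> (a * r) \<le> sqrt C * norm (bop_apply a (bop_apply r \<xi>))"
        by (rule power2_le_imp_le) (simp add: C less_imp_le)
    qed (rule r)
    hence "x * r = 0" by (rule ann)
    hence xm: "x = x * m" by (simp add: r_def right_diff_distrib)
    have "(norm (bop_apply x \<xi>))\<^sup>2 = (norm (bop_apply x (bop_apply m \<xi>)))\<^sup>2"
      by (subst xm) simp
    also have "\<dots> \<le> (opnorm x * norm (bop_apply m \<xi>))\<^sup>2" by (intro power_mono opnorm) simp
    also have "\<dots> = (opnorm x)\<^sup>2 * (norm (bop_apply m \<xi>))\<^sup>2" by (simp add: power_mult_distrib)
    also have "\<dots> \<le> (opnorm x)\<^sup>2 * Re (cinner \<xi> (bop_apply m \<xi>))"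
      by (intro mult_left_mono norm_positive_square_le m) simp
    also have "\<dots> \<le> (opnorm x)\<^sup>2 * (1 / C)"
      using m(4) C by (intro mult_left_mono) (simp_all add: pos_le_divide_eq mult.commute)
    finally show ?thesis by (simp add: C_def)
  qed
  moreover have "(\<lambda>n. (opnorm x)\<^sup>2 / real (Suc n)) \<longlonglongrightarrow> 0"
    using LIMSEQ_Suc[OF lim_const_over_n] by blast
  ultimately have "(norm (bop_apply x \<xi>))\<^sup>2 \<le> 0" by (intro LIMSEQ_le_const) auto
  thus "bop_apply x \<xi> = bop_apply 0 \<xi>" by simp
qed

end


section \<open>Crossed products\<close>

lemma crossed_unitary_apply [simp]:
  "ell2_fun (bop_apply (crossed_unitary g) \<xi>) h = ell2_fun \<xi> (- g + h)"
  by (simp add: crossed_unitary.rep_eq)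

lemma crossed_unitary_add: "crossed_unitary (g + h) = crossed_unitary g * crossed_unitary h"
proof (rule bop_eqI, rule ell2_eqI)
  fix \<xi> k
  have "- (g + h) + k = - h + (- g + k)" by (simp only: minus_add add.assoc)
  thus "ell2_fun (bop_apply (crossed_unitary (g + h)) \<xi>) k
      = ell2_fun (bop_apply (crossed_unitary g * crossed_unitary h) \<xi>) k"
    by (simp only: crossed_unitary_apply bop_rep)
qed

lemma crossed_unitary_zero [simp]: "crossed_unitary 0 = 1"
  by (rule bop_eqI, rule ell2_eqI) simp

lemma bij_left_translation: "bij ((+) (g::'g::group_add))"
  by (rule bij_betwI[of _ _ _ "(+) (- g)"]) (auto simp: add.assoc[symmetric])

lemma adj_crossed_unitary [simp]: "adj (crossed_unitary g) = crossed_unitary (- g)"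
proof (rule adj_eqI)
  fix x y :: "('a, 'b) ell2"
  have "cinner (bop_apply (crossed_unitary (- g)) x) y = (\<Sum>\<^sub>\<infinity>h. cinner (ell2_fun x (g + h)) (ell2_fun y (- g + (g + h))))"
    by (simp add: cinner_ell2_def)
  also have "\<dots> = (\<Sum>\<^sub>\<infinity>h. cinner (ell2_fun x h) (ell2_fun y (- g + h)))"
    by (rule infsum_reindex_bij_betw[OF bij_left_translation])
  finally show "cinner (bop_apply (crossed_unitary (- g)) x) y = cinner x (bop_apply (crossed_unitary g) y)"
    by (simp add: cinner_ell2_def)
qed

lemma crossed_unitary_single: "bop_apply (crossed_unitary g) (ell2_single h \<xi>) = ell2_single (g + h) \<xi>"
  by (rule ell2_eqI) (auto simp: add.assoc[symmetric])

lemma entry_unitary_right: "entry (T * crossed_unitary k) g h = entry T g (k + h)"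
  by (rule bop_eqI) (simp add: entry_apply crossed_unitary_single)

lemma diag_commute_unitary: "ell2_diag t * crossed_unitary g = crossed_unitary g * ell2_diag t"
  by (rule bop_eqI, rule ell2_eqI) simp

lemma opnorm_crossed_unitary: "opnorm (crossed_unitary g) \<le> 1"
  by (rule opnorm_le) (simp_all add: crossed_unitary.rep_eq norm_ell2_translate)

text \<open>Commuting with the rank one operator that sends \<eta> to a multiple of \<zeta> forces d
  \<zeta> to be a multiple of \<zeta>, with a factor that depends only on the fixed \<eta>. The zero
  space is treated apart.\<close>

lemma scalar_if_central:
  fixes d :: "'k::complex_hilbert bop"
  assumes "\<And>t. d * t = t * d"
  obtains c where "d = c *\<^sub>C 1"
proof (cases "\<exists>\<eta>::'k. \<eta> \<noteq> 0")
  case False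
  hence "d = 0 *\<^sub>C 1" by (intro bop_eqI) metis
  thus ?thesis by (rule that)
next
  case True
  then obtain \<eta> :: 'k where \<eta>: "\<eta> \<noteq> 0" by blast
  show ?thesis
  proof (rule that, rule bop_eqI)
    fix \<zeta> :: 'k
    have "norm (cinner \<eta> x *\<^sub>C \<zeta>) \<le> (norm \<eta> * norm \<zeta>) * norm x" for x
      using mult_right_mono[OF cmod_cinner_le[of \<eta> x] norm_ge_zero[of \<zeta>]]
      by (simp add: norm_scaleC mult.assoc mult.commute[of "norm x"])
    hence "\<exists>t. \<forall>x. bop_apply t x = cinner \<eta> x *\<^sub>C \<zeta>"
      by (intro bop_existsI)
        (simp_all add: cinner_add_right scaleC_add_left cinner_scaleC_right scaleC_scaleC)
    then obtain t where t: "\<And>x. bop_apply t x = cinner \<eta> x *\<^sub>C \<zeta>" by blast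
    have "bop_apply (d * t) \<eta> = bop_apply (t * d) \<eta>" by (simp only: assms)
    hence "cinner \<eta> \<eta> *\<^sub>C bop_apply d \<zeta> = cinner \<eta> (bop_apply d \<eta>) *\<^sub>C \<zeta>" by (simp add: t)
    hence "(1 / cinner \<eta> \<eta>) *\<^sub>C (cinner \<eta> \<eta> *\<^sub>C bop_apply d \<zeta>)
        = (cinner \<eta> (bop_apply d \<eta>) / cinner \<eta> \<eta>) *\<^sub>C \<zeta>"
      by (simp only: scaleC_scaleC times_divide_eq_left mult_1)
    thus "bop_apply d \<zeta> = bop_apply ((cinner \<eta> (bop_apply d \<eta>) / cinner \<eta> \<eta>) *\<^sub>C 1) \<zeta>"
      using \<eta> by (simp add: scaleC_scaleC cinner_self)
  qed
qed

section \<open>Embedded base algebra, covariance and matrix entries\<close>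

locale tracial_action =
  fixes A :: "'h::complex_hilbert bop set" and \<tau> :: "'h bop \<Rightarrow> complex"
    and \<sigma> :: "'g::group_add \<Rightarrow> 'h bop \<Rightarrow> 'h bop"
  assumes tracial: "tracial_von_neumann_algebra A \<tau>"
    and action: "trace_preserving_action \<sigma> A \<tau>"
begin

sublocale base: vN_trace A \<tau>
  using tracial
  by unfold_locales (auto simp: tracial_von_neumann_algebra_def faithful_normal_tracial_state_def)

lemma star_iso: "star_isomorphism A A (\<sigma> g)"
  using action by (simp add: trace_preserving_action_def)

lemma act_closed: "a \<in> A \<Longrightarrow> \<sigma> g a \<in> A"
  using star_iso[of g] by (auto simp: star_isomorphism_def bij_betw_def)

lemma act_add: "a \<in> A \<Longrightarrow> b \<in> A \<Longrightarrow> \<sigma> g (a + b) = \<sigma> g a + \<sigma> g b"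
  and act_mult: "a \<in> A \<Longrightarrow> b \<in> A \<Longrightarrow> \<sigma> g (a * b) = \<sigma> g a * \<sigma> g b"
  and act_adj: "a \<in> A \<Longrightarrow> \<sigma> g (adj a) = adj (\<sigma> g a)"
  using star_iso[of g] by (auto simp: star_isomorphism_def)

lemma act_zero_group [simp]: "a \<in> A \<Longrightarrow> \<sigma> 0 a = a"
  and act_plus: "a \<in> A \<Longrightarrow> \<sigma> (g + h) a = \<sigma> g (\<sigma> h a)"
  and act_trace: "a \<in> A \<Longrightarrow> \<tau> (\<sigma> g a) = \<tau> a"
  using action by (auto simp: trace_preserving_action_def)

lemma act_inverse: "a \<in> A \<Longrightarrow> \<sigma> (- g) (\<sigma> g a) = a" "a \<in> A \<Longrightarrow> \<sigma> g (\<sigma> (- g) a) = a"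
  by (simp_all add: act_plus[symmetric])

lemma act_zero: "\<sigma> g 0 = 0"
  using act_add[OF base.closed(2) base.closed(2), of g] by simp

lemma act_eq_0: "a \<in> A \<Longrightarrow> \<sigma> g a = 0 \<Longrightarrow> a = 0"
  by (metis act_inverse(1) act_zero)

lemma act_one: "\<sigma> g 1 = 1"
proof -
  have "\<sigma> g 1 = \<sigma> g 1 * \<sigma> g (\<sigma> (- g) 1)" by (simp add: act_inverse base.closed)
  also have "\<dots> = \<sigma> g (1 * \<sigma> (- g) 1)" by (simp only: act_mult base.closed act_closed)
  also have "\<dots> = 1" by (simp add: act_inverse base.closed)
  finally show ?thesis .
qed

lemma act_two_norm: "a \<in> A \<Longrightarrow> two_norm \<tau> (\<sigma> g a) = two_norm \<tau> a"
  by (simp add: two_norm_def act_adj[symmetric] act_mult[symmetric] act_trace base.closed)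

lemma act_opnorm_le: "a \<in> A \<Longrightarrow> opnorm (\<sigma> g a) \<le> opnorm a"
  by (rule star_isomorphism_opnorm_le[OF star_iso base.vN _ act_one])

abbreviation "\<pi> \<equiv> crossed_emb \<sigma>"
abbreviation u :: "'g \<Rightarrow> ('g, 'h) ell2 bop" where "u \<equiv> crossed_unitary"
abbreviation "M \<equiv> crossed_product \<sigma> A"
abbreviation "\<tau>M \<equiv> crossed_trace \<tau> :: ('g, 'h) ell2 bop \<Rightarrow> complex"

text \<open>The pointwise formula defines an operator because star isomorphisms do not increase
  operator norms, which bounds all \<open>\<sigma> (- g) a\<close> uniformly by the norm of
  a.\<close>

lemma emb_apply [simp]:
  assumes a: "a \<in> A"
  shows "ell2_fun (bop_apply (\<pi> a) \<xi>) g = bop_apply (\<sigma> (- g) a) (ell2_fun \<xi> g)"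
proof -
  have "norm (bop_apply (\<sigma> (- g) a) x) \<le> opnorm a * norm x" for g x
    by (rule order_trans[OF opnorm mult_right_mono[OF act_opnorm_le[OF a] norm_ge_zero]])
  then obtain T where T: "\<forall>\<xi> g. ell2_fun (bop_apply T \<xi>) g = bop_apply (\<sigma> (- g) a) (ell2_fun \<xi> g)"
    using ell2_pointwise_exists[of "opnorm a" "\<lambda>g. \<sigma> (- g) a"] by auto
  have "\<forall>\<xi> g. ell2_fun (bop_apply (\<pi> a) \<xi>) g = bop_apply (\<sigma> (- g) a) (ell2_fun \<xi> g)"
    unfolding crossed_emb_def
  proof (rule theI[of _ T])
    fix S assume "\<forall>\<xi> g. ell2_fun (bop_apply S \<xi>) g = bop_apply (\<sigma> (- g) a) (ell2_fun \<xi> g)"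
    thus "S = T" using T by (intro bop_eqI ell2_eqI) simp
  qed (rule T)
  thus ?thesis by blast
qed

lemma emb_mult: "a \<in> A \<Longrightarrow> b \<in> A \<Longrightarrow> \<pi> (a * b) = \<pi> a * \<pi> b"
  by (rule bop_eqI, rule ell2_eqI) (simp add: base.closed act_mult)

lemma emb_one: "\<pi> 1 = 1"
  by (rule bop_eqI, rule ell2_eqI) (simp add: base.closed act_one)

lemma emb_adj: "a \<in> A \<Longrightarrow> \<pi> (adj a) = adj (\<pi> a)"
  by (rule adj_eqI[symmetric])
    (simp add: cinner_ell2_def base.closed act_adj cinner_adj_left)

lemma unitary_emb: "a \<in> A \<Longrightarrow> u g * \<pi> a = \<pi> (\<sigma> g a) * u g"
  by (rule bop_eqI, rule ell2_eqI) (simp add: act_closed minus_add act_plus[symmetric])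

lemma emb_single: "a \<in> A \<Longrightarrow> bop_apply (\<pi> a) (ell2_single h \<xi>) = ell2_single h (bop_apply (\<sigma> (- h) a) \<xi>)"
  by (rule ell2_eqI) simp

lemma entry_emb_left: "a \<in> A \<Longrightarrow> entry (\<pi> a * T) g h = \<sigma> (- g) a * entry T g h"
  by (rule bop_eqI) (simp add: entry_apply)

lemma entry_emb_right: "a \<in> A \<Longrightarrow> entry (T * \<pi> a) g h = entry T g h * \<sigma> (- h) a"
  by (rule bop_eqI) (simp add: entry_apply emb_single)

lemma entry_emb_unitary:
  "a \<in> A \<Longrightarrow> entry (\<pi> a * u k) g h = (if g = k + h then \<sigma> (- g) a else 0)"
  by (rule bop_eqI) (simp add: entry_apply crossed_unitary_single emb_single)

lemma vN_crossed: "von_neumann_algebra M"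
  unfolding crossed_product_def by (rule von_neumann_algebra_vN_generated)

lemma emb_in_crossed: "a \<in> A \<Longrightarrow> \<pi> a \<in> M"
  and unitary_in_crossed: "u g \<in> M"
  unfolding crossed_product_def
  using subset_vN_generated[of "crossed_emb \<sigma> ` A \<union> range crossed_unitary"] by auto

lemma unitary_in_group_vN: "u g \<in> group_vN"
  unfolding group_vN_def using subset_vN_generated[of "range u"] by auto

lemma group_vN_subset: "group_vN \<subseteq> M"
proof -
  have "range u \<union> adj ` range u \<subseteq> M" using unitary_in_crossed by auto
  thus ?thesis unfolding group_vN_def vN_generated_def by (rule vN_contains_bicommutant[OF vN_crossed])
qed

text \<open>Testing generators suffices, as the crossed product is a bicommutant. At matrix entries
  this gives commutation with the commutant of A, and the bicommutant of A then contains every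
  entry.\<close>

lemma crossed_commute_diag:
  assumes T: "T \<in> M" and t: "t \<in> commutant A"
  shows "T * ell2_diag t = ell2_diag t * T"
proof -
  have emb: "ell2_diag t * \<pi> a = \<pi> a * ell2_diag t" if "a \<in> A" for a
  proof (rule bop_eqI, rule ell2_eqI)
    fix \<xi> g
    show "ell2_fun (bop_apply (ell2_diag t * \<pi> a) \<xi>) g = ell2_fun (bop_apply (\<pi> a * ell2_diag t) \<xi>) g"
      using arg_cong[OF commutantD[OF t act_closed[OF that, of "- g"]], of "\<lambda>b. bop_apply b (ell2_fun \<xi> g)"]
      by (simp add: that)
  qed
  have "ell2_diag t \<in> commutant ((\<pi> ` A \<union> range u) \<union> adj ` (\<pi> ` A \<union> range u))"
  proof (rule commutantI)
    fix s assume "s \<in> (\<pi> ` A \<union> range u) \<union> adj ` (\<pi> ` A \<union> range u)"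
    thus "ell2_diag t * s = s * ell2_diag t"
      by (auto simp: emb emb_adj[symmetric] vN_adj[OF base.vN] diag_commute_unitary)
  qed
  thus ?thesis using T unfolding crossed_product_def vN_generated_def by (rule_tac commutantD)
qed

lemma entry_in_base: "T \<in> M \<Longrightarrow> entry T g h \<in> A"
  using vN_bicommutant[OF base.vN]
  by (metis commutantI crossed_commute_diag entry_commute_diag)

text \<open>Contains the generators and is stable under products and adjoints, the closure
  properties that \<open>bicommutant_two_vectors\<close> asks of W.\<close>

definition monomials :: "('g, 'h) ell2 bop set" where
  "monomials = {\<pi> a * u k | a k. a \<in> A}"

lemma crossed_subset_bicommutant_monomials: "M \<subseteq> commutant (commutant monomials)"
proof -
  have "\<pi> a \<in> monomials" if "a \<in> A" for a
    unfolding monomials_def using that by (intro CollectI exI[of _ a] exI[of _ 0]) simp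
  moreover have "u g \<in> monomials" for g
    unfolding monomials_def by (intro CollectI exI[of _ 1] exI[of _ g]) (simp add: emb_one base.closed)
  ultimately have "\<pi> ` A \<union> range u \<union> adj ` (\<pi> ` A \<union> range u) \<subseteq> monomials"
    by (auto simp: emb_adj[symmetric] base.closed)
  thus ?thesis unfolding crossed_product_def vN_generated_def by (intro commutant_antimono)
qed

lemma monomials_one: "1 \<in> monomials"
  unfolding monomials_def by (intro CollectI exI[of _ 1] exI[of _ 0]) (simp add: emb_one base.closed)

lemma monomials_mult:
  assumes "v \<in> monomials" "w \<in> monomials" shows "v * w \<in> monomials"
proof -
  obtain a k b l where vw: "v = \<pi> a * u k" "w = \<pi> b * u l" and ab: "a \<in> A" "b \<in> A"
    using assms by (auto simp: monomials_def)
  have "v * w = \<pi> a * (u k * \<pi> b) * u l" by (simp add: vw mult.assoc)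
  also have "\<dots> = \<pi> (a * \<sigma> k b) * u (k + l)"
    using ab by (simp add: unitary_emb emb_mult act_closed crossed_unitary_add mult.assoc)
  finally show ?thesis using ab by (auto simp: monomials_def base.closed act_closed)
qed

lemma monomials_adj:
  assumes "w \<in> monomials" shows "adj w \<in> monomials"
proof -
  obtain a k where w: "w = \<pi> a * u k" and a: "a \<in> A" using assms by (auto simp: monomials_def)
  have "adj w = \<pi> (\<sigma> (- k) (adj a)) * u (- k)"
    using a by (simp add: w unitary_emb[symmetric] base.closed emb_adj)
  thus ?thesis using a by (auto simp: monomials_def base.closed act_closed)
qed

text \<open>
  For \<open>T = \<pi>(a) u\<^sub>k\<close> this is a direct computation, but weak continuity of \<open>\<sigma>\<^bsub>-g\<^esub>\<close> is not available.
  Multiplied by an element \<open>c\<close> such that both \<open>c\<close> and \<open>\<sigma>\<^sub>g(c)\<close> are dominated by vectors, the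
  relation becomes an equality of matrix coefficients of \<open>T\<close>.
\<close>

lemma entry_column:
  assumes T: "T \<in> M"
  shows "entry T g 0 = \<sigma> (- g) (entry T 0 (- g))"
proof -
  define x where "x = entry T g 0 - \<sigma> (- g) (entry T 0 (- g))"
  have xA: "x \<in> A" unfolding x_def by (intro base.closed act_closed entry_in_base T)
  have ann: "x * (r * \<sigma> (- g) r') = 0"
    if r: "base.vector_dominated r" and r': "base.vector_dominated r'" for r r'
  proof -
    have rA: "r \<in> A" "r' \<in> A" using r r' by (simp_all add: base.vector_dominated_def)
    \<comment> \<open>Chosen so that \<open>\<sigma> g c\<close> equals
      \<open>\<sigma> g r * r'\<close>: domination passes to c from r, and to its image from
      r'.\<close>
    define c where "c = r * \<sigma> (- g) r'"
    have cA: "c \<in> A" using rA by (simp add: c_def base.closed act_closed)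
    have c: "base.vector_dominated c"
      unfolding c_def by (intro base.vector_dominated_mult_right r act_closed rA)
    have "\<sigma> g c = \<sigma> g r * r'" using rA by (simp add: c_def act_mult act_closed act_inverse)
    hence c': "base.vector_dominated (\<sigma> g c)"
      using base.vector_dominated_mult_left[OF r', of "\<sigma> g r"] rA by (simp add: act_closed)
    obtain \<eta> where \<eta>: "\<And>b. b \<in> A \<Longrightarrow> \<exists>\<zeta>. \<forall>a\<in>A. \<tau> (b * a * c) = cinner \<zeta> (bop_apply a \<eta>)"
      using base.vector_dominated_functional[OF c] by blast
    obtain \<eta>' where \<eta>': "\<And>b. b \<in> A \<Longrightarrow> \<exists>\<zeta>. \<forall>a\<in>A. \<tau> (b * a * \<sigma> g c) = cinner \<zeta> (bop_apply a \<eta>')"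
      using base.vector_dominated_functional[OF c'] by blast
    have "\<tau> (b * x * c) = 0" if b: "b \<in> A" for b
    proof -
      obtain \<zeta> where \<zeta>: "\<And>a. a \<in> A \<Longrightarrow> \<tau> (b * a * c) = cinner \<zeta> (bop_apply a \<eta>)"
        using \<eta>[OF b] by blast
      obtain \<zeta>' where \<zeta>': "\<And>a. a \<in> A \<Longrightarrow> \<tau> (\<sigma> g b * a * \<sigma> g c) = cinner \<zeta>' (bop_apply a \<eta>')"
        using \<eta>'[OF act_closed[OF b]] by blast
      \<comment> \<open>Multiplied by b and c and traced, the two sides of the claim become matrix
        coefficients of S at fixed vectors.\<close>
      have left: "cinner (ell2_single g \<zeta>) (bop_apply S (ell2_single 0 \<eta>)) = \<tau> (b * entry S g 0 * c)"
        if "S \<in> M" for S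
        using \<zeta>[OF entry_in_base[OF that]] by (simp add: cinner_entry)
      have right: "cinner (ell2_single 0 \<zeta>') (bop_apply S (ell2_single (- g) \<eta>'))
          = \<tau> (b * \<sigma> (- g) (entry S 0 (- g)) * c)" if S: "S \<in> M" for S
      proof -
        let ?q = "entry S 0 (- g)"
        have q: "?q \<in> A" by (rule entry_in_base[OF S])
        have "\<sigma> g (b * \<sigma> (- g) ?q * c) = \<sigma> g b * ?q * \<sigma> g c"
          using b cA q by (simp add: act_mult base.closed act_closed act_inverse)
        hence "\<tau> (\<sigma> g b * ?q * \<sigma> g c) = \<tau> (b * \<sigma> (- g) ?q * c)"
          using act_trace[of "b * \<sigma> (- g) ?q * c" g] b cA q by (simp add: base.closed act_closed)
        thus ?thesis using \<zeta>'[OF q] by (simp add: cinner_entry)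
      qed
      have "cinner (ell2_single g \<zeta>) (bop_apply T (ell2_single 0 \<eta>))
          = cinner (ell2_single 0 \<zeta>') (bop_apply T (ell2_single (- g) \<eta>'))"
      proof (rule bicommutant_two_vectors[OF monomials_one monomials_mult monomials_adj])
        show "T \<in> commutant (commutant monomials)"
          using T crossed_subset_bicommutant_monomials by blast
        fix w assume "w \<in> monomials"
        then obtain a k where w: "w = \<pi> a * u k" and a: "a \<in> A" by (auto simp: monomials_def)
        have wM: "w \<in> M" unfolding w by (intro vN_mult[OF vN_crossed] emb_in_crossed unitary_in_crossed a)
        have "entry w g 0 = \<sigma> (- g) (entry w 0 (- g))"
          using a by (auto simp: w entry_emb_unitary act_zero eq_neg_iff_add_eq_0 add_eq_0_iff)
        thus "cinner (ell2_single g \<zeta>) (bop_apply w (ell2_single 0 \<eta>))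
            = cinner (ell2_single 0 \<zeta>') (bop_apply w (ell2_single (- g) \<eta>'))"
          by (simp add: left[OF wM] right[OF wM])
      qed
      hence "\<tau> (b * entry T g 0 * c) = \<tau> (b * \<sigma> (- g) (entry T 0 (- g)) * c)"
        by (simp add: left[OF T] right[OF T])
      thus ?thesis
        using b cA entry_in_base[OF T] act_closed[OF entry_in_base[OF T]]
        by (simp add: x_def right_diff_distrib left_diff_distrib base.state_diff base.closed)
    qed
    \<comment> \<open>For this b the trace is taken of the adjoint of x c times x c, and
      faithfulness applies.\<close>
    from this[of "adj (x * c)"] have "x * c = 0"
      using xA cA by (intro base.faithful) (simp_all add: base.closed mult.assoc)
    thus ?thesis by (simp add: c_def)
  qed
  have "x * r = 0" if r: "base.vector_dominated r" for r
  proof -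
    have rA: "r \<in> A" using r by (simp add: base.vector_dominated_def)
    \<comment> \<open>Transport by \<open>\<sigma> g\<close> isolates r' on the right, so that the
      separation property removes first r' and then, below, r.\<close>
    have "\<sigma> g (x * r) = 0"
    proof (rule base.vector_dominated_separating)
      show "\<sigma> g (x * r) \<in> A" by (intro act_closed base.closed xA rA)
      fix r' assume r': "base.vector_dominated r'"
      hence r'A: "r' \<in> A" by (simp add: base.vector_dominated_def)
      have "\<sigma> g (x * r) * r' = \<sigma> g (x * r * \<sigma> (- g) r')"
        using xA rA r'A by (simp add: act_mult base.closed act_closed act_inverse)
      thus "\<sigma> g (x * r) * r' = 0" using ann[OF r r'] by (simp add: mult.assoc act_zero)
    qed
    thus ?thesis using xA rA by (intro act_eq_0[of "x * r"]) (simp_all add: base.closed)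
  qed
  hence "x = 0" by (rule base.vector_dominated_separating[OF xA])
  thus ?thesis by (simp add: x_def)
qed

section \<open>The canonical trace, Fourier coefficients and Parseval\<close>

sublocale cp: vN_state M \<tau>M
proof
  show "von_neumann_algebra M" by (rule vN_crossed)
  show "\<tau>M (S + T) = \<tau>M S + \<tau>M T" if "S \<in> M" "T \<in> M" for S T
    using that by (simp add: crossed_trace_def coeff_0_entry entry_add base.state_add entry_in_base)
  show "\<tau>M (c *\<^sub>C T) = c * \<tau>M T" if "T \<in> M" for c T
    using that by (simp add: crossed_trace_def coeff_0_entry entry_scaleC base.state_scaleC entry_in_base)
  show "\<tau>M T \<in> \<real>\<^sub>\<ge>\<^sub>0" if "T \<in> M" "positive_bop T" for T
    using that by (simp add: crossed_trace_def coeff_0_entry base.state_positive entry_in_base positive_entry)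
  have "entry (1 :: ('g, 'h) ell2 bop) 0 0 = 1" by (rule bop_eqI) (simp add: entry_apply)
  thus "\<tau>M 1 = 1" by (simp add: crossed_trace_def coeff_0_entry base.state_one)
qed

lemma trace_normal:
  assumes "X \<subseteq> A" "\<forall>x\<in>X. positive_bop x" "upward_directed X" "is_lub_in A X s"
  shows "Re (\<tau> s) = (SUP x\<in>X. Re (\<tau> x))"
proof -
  have "\<forall>X s. X \<subseteq> A \<and> (\<forall>x\<in>X. positive_bop x) \<and> upward_directed X \<and> is_lub_in A X s \<longrightarrow>
        Re (\<tau> s) = (SUP x\<in>X. Re (\<tau> x))"
    using tracial unfolding tracial_von_neumann_algebra_def faithful_normal_tracial_state_def
    by (elim conjE)
  thus ?thesis using assms by (elim allE impE) (intro conjI)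
qed

text \<open>The finite partial sums of the adjoint of \<open>f i\<close> times \<open>f i\<close>
  form an upward directed family with supremum s, so order normality passes the sum through
  \<tau>.\<close>

lemma trace_normal_sum:
  assumes f: "\<And>i. f i \<in> A" and s: "s \<in> A" "adj s = s"
    and sum: "\<And>\<xi>. ((\<lambda>i. (norm (bop_apply (f i) \<xi>))\<^sup>2) has_sum Re (cinner \<xi> (bop_apply s \<xi>))) UNIV"
  shows "((\<lambda>i. (two_norm \<tau> (f i))\<^sup>2) has_sum Re (\<tau> s)) UNIV"
proof -
  define p where "p F = (\<Sum>i\<in>F. adj (f i) * f i)" for F
  define X where "X = p ` {F. finite F \<and> F \<subseteq> UNIV}"
  have pA: "p F \<in> A" for F unfolding p_def by (intro base.closed f)
  have ppos: "positive_bop (p F)" for F unfolding p_def by (intro positive_bop_sum) simp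
  have tp: "Re (\<tau> (p F)) = (\<Sum>i\<in>F. (two_norm \<tau> (f i))\<^sup>2)" for F
    unfolding p_def using f by (simp add: base.state_sum base.closed base.two_norm_square)
  have qp: "Re (cinner \<xi> (bop_apply (p F) \<xi>)) = (\<Sum>i\<in>F. (norm (bop_apply (f i) \<xi>))\<^sup>2)" for F \<xi>
    by (simp add: p_def bop_sum_left cinner_sum_right norm_bop_eq)
  have le: "positive_bop (s - p F)" if "finite F" for F
  proof (rule positive_bopI)
    fix \<xi>
    have "(\<Sum>i\<in>F. (norm (bop_apply (f i) \<xi>))\<^sup>2) \<le> Re (cinner \<xi> (bop_apply s \<xi>))"
      by (rule has_sum_mono'[OF has_sum_finite[OF that] sum]) simp_all
    thus "0 \<le> Re (cinner \<xi> (bop_apply (s - p F) \<xi>))" by (simp add: cinner_diff_right qp)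
  qed (simp add: s positive_bop_adj ppos)
  have mono: "positive_bop (p G - p F)" if "finite G" "F \<subseteq> G" for F G
  proof -
    have "p G - p F = p (G - F)" using that by (simp add: p_def sum_diff)
    thus ?thesis by (simp add: ppos)
  qed
  have "upward_directed X"
    unfolding upward_directed_def
  proof (intro conjI ballI)
    show "X \<noteq> {}" by (auto simp: X_def)
    fix x y assume "x \<in> X" "y \<in> X"
    then obtain F G where "finite F" "x = p F" "finite G" "y = p G" by (auto simp: X_def)
    thus "\<exists>z\<in>X. positive_bop (z - x) \<and> positive_bop (z - y)"
      by (intro bexI[of _ "p (F \<union> G)"]) (auto simp: X_def intro!: mono)
  qed
  moreover have "is_lub_in A X s"
    unfolding is_lub_in_def
  proof (intro conjI ballI impI s)
    show "positive_bop (s - x)" if "x \<in> X" for x using that le by (auto simp: X_def)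
    fix t assume t: "t \<in> A" "adj t = t" "\<forall>x\<in>X. positive_bop (t - x)"
    show "positive_bop (t - s)"
    proof (rule positive_bopI)
      fix \<xi>
      have "(\<Sum>i\<in>F. (norm (bop_apply (f i) \<xi>))\<^sup>2) \<le> Re (cinner \<xi> (bop_apply t \<xi>))" if "finite F" for F
      proof -
        have "positive_bop (t - p F)" using t(3) that by (auto simp: X_def)
        from positive_bop_Re[OF this, of \<xi>] show ?thesis by (simp add: cinner_diff_right qp)
      qed
      hence "Re (cinner \<xi> (bop_apply s \<xi>)) \<le> Re (cinner \<xi> (bop_apply t \<xi>))"
        by (intro has_sum_le_finite_sums[OF sum]) auto
      thus "0 \<le> Re (cinner \<xi> (bop_apply (t - s) \<xi>))" by (simp add: cinner_diff_right)
    qed (simp add: t s)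
  qed
  moreover have "X \<subseteq> A" "\<forall>x\<in>X. positive_bop x" by (auto simp: X_def pA ppos)
  ultimately have SUP: "Re (\<tau> s) = (SUP x\<in>X. Re (\<tau> x))" by (intro trace_normal)
  have "((\<lambda>i. (two_norm \<tau> (f i))\<^sup>2) has_sum
      (SUP F\<in>{F. finite F \<and> F \<subseteq> UNIV}. \<Sum>i\<in>F. (two_norm \<tau> (f i))\<^sup>2)) UNIV"
  proof (rule nonneg_bdd_above_has_sum)
    show "bdd_above (sum (\<lambda>i. (two_norm \<tau> (f i))\<^sup>2) ` {F. F \<subseteq> UNIV \<and> finite F})"
      by (rule bdd_aboveI2[of _ _ "Re (\<tau> s)"])
        (auto simp: tp[symmetric] intro!: base.state_mono pA s le)
  qed simp
  also have "(SUP F\<in>{F. finite F \<and> F \<subseteq> UNIV}. \<Sum>i\<in>F. (two_norm \<tau> (f i))\<^sup>2) = Re (\<tau> s)"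
    by (simp add: SUP X_def image_image tp)
  finally show ?thesis .
qed

text \<open>The coefficient of \<open>u g\<close>, read in row 0. Square summability in ell2
  concerns column 0 instead; \<open>entry_column\<close> connects the two.\<close>

definition fourier :: "('g, 'h) ell2 bop \<Rightarrow> 'g \<Rightarrow> 'h bop" where
  "fourier T g = entry T 0 (- g)"

lemma fourier_in_base: "T \<in> M \<Longrightarrow> fourier T g \<in> A"
  by (simp add: fourier_def entry_in_base)

lemma fourier_coeff_0: "fourier T g = coeff_0 (T * u (- g))"
  by (simp add: fourier_def coeff_0_entry entry_unitary_right)

lemma trace_unitary: "\<tau>M (T * u (- g)) = \<tau> (fourier T g)"
  by (simp add: crossed_trace_def fourier_coeff_0)

text \<open>Parseval. Column 0 of T is summable at each vector, normality lifts this to \<tau>, and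
  trace preservation replaces column entries by Fourier coefficients.\<close>

lemma two_norm_has_sum:
  assumes T: "T \<in> M"
  shows "((\<lambda>g. (two_norm \<tau> (fourier T g))\<^sup>2) has_sum (two_norm \<tau>M T)\<^sup>2) UNIV"
proof -
  define s where "s = entry (adj T * T) 0 0"
  have TT: "adj T * T \<in> M" by (intro cp.closed T)
  have "((\<lambda>g. (two_norm \<tau> (entry T g 0))\<^sup>2) has_sum Re (\<tau> s)) UNIV"
  proof (rule trace_normal_sum)
    show "entry T g 0 \<in> A" for g by (rule entry_in_base[OF T])
    show "s \<in> A" unfolding s_def by (rule entry_in_base[OF TT])
    show "adj s = s" by (simp add: s_def entry_adj[symmetric])
    fix \<xi>
    let ?v = "bop_apply T (ell2_single 0 \<xi>)"
    have "(\<lambda>g. (norm (ell2_fun ?v g))\<^sup>2) summable_on UNIV"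
      using square_summable_ell2_fun[of ?v] by (simp add: square_summable_def)
    hence "((\<lambda>g. (norm (ell2_fun ?v g))\<^sup>2) has_sum (norm ?v)\<^sup>2) UNIV"
      unfolding norm_ell2_square by (rule has_sum_infsum)
    moreover have "(norm ?v)\<^sup>2 = Re (cinner \<xi> (bop_apply s \<xi>))"
      by (simp add: s_def cinner_entry norm_bop_eq)
    ultimately show "((\<lambda>g. (norm (bop_apply (entry T g 0) \<xi>))\<^sup>2) has_sum Re (cinner \<xi> (bop_apply s \<xi>))) UNIV"
      by (simp add: entry_apply)
  qed
  moreover have "two_norm \<tau> (entry T g 0) = two_norm \<tau> (fourier T g)" for g
    unfolding entry_column[OF T, of g] fourier_def by (rule act_two_norm[OF entry_in_base[OF T]])
  moreover have "(two_norm \<tau>M T)\<^sup>2 = Re (\<tau> s)"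
    using T by (simp add: cp.two_norm_square crossed_trace_def coeff_0_entry s_def)
  ultimately show ?thesis by simp
qed

text \<open>The coefficient of adj T at g is the adjoint of \<open>\<sigma> g\<close> applied to
  that of T at - g, so the two Parseval series differ by inversion in the group.\<close>

lemma two_norm_crossed_adj:
  assumes T: "T \<in> M"
  shows "two_norm \<tau>M (adj T) = two_norm \<tau>M T"
proof -
  have "two_norm \<tau> (fourier (adj T) g) = two_norm \<tau> (fourier T (- g))" for g
  proof -
    have "fourier (adj T) g = adj (\<sigma> g (fourier T (- g)))"
      using entry_column[OF T, of "- g"] by (simp add: fourier_def entry_adj)
    thus ?thesis
      using fourier_in_base[OF T] by (simp add: base.two_norm_adj act_two_norm act_closed)
  qed
  hence "((\<lambda>g. (two_norm \<tau> (fourier T (- g)))\<^sup>2) has_sum (two_norm \<tau>M (adj T))\<^sup>2) UNIV"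
    using two_norm_has_sum[OF cp.closed(1)[OF T]] by simp
  moreover have "bij (uminus :: 'g \<Rightarrow> 'g)" by (rule bij_uminus)
  ultimately have "((\<lambda>g. (two_norm \<tau> (fourier T g))\<^sup>2) has_sum (two_norm \<tau>M (adj T))\<^sup>2) UNIV"
    using has_sum_reindex_bij_betw[of uminus UNIV UNIV "\<lambda>g. (two_norm \<tau> (fourier T g))\<^sup>2"] by simp
  hence "(two_norm \<tau>M (adj T))\<^sup>2 = (two_norm \<tau>M T)\<^sup>2"
    using two_norm_has_sum[OF T] by (rule has_sum_unique)
  thus ?thesis using T by (simp add: cp.two_norm_nonneg cp.closed)
qed

lemmas two_norm_crossed_mult_right = cp.two_norm_mult_right_if[OF two_norm_crossed_adj]

lemma fourier_diff: "fourier (S - T) g = fourier S g - fourier T g"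
  by (simp add: fourier_def entry_diff)

lemma fourier_sum: "fourier (sum f I) g = (\<Sum>i\<in>I. fourier (f i) g)"
  by (induction I rule: infinite_finite_induct) (simp_all add: fourier_def entry_add entry_zero)

lemma fourier_monomial: "a \<in> A \<Longrightarrow> fourier (\<pi> a * u k) g = (if k = g then a else 0)"
  by (auto simp: fourier_def entry_emb_unitary add_eq_0_iff2)

text \<open>The squared error of a finite Fourier sum is a tail of the Parseval series.\<close>

lemma two_norm_approximation:
  assumes T: "T \<in> M" and e: "0 < e"
  obtains F where "finite F" "two_norm \<tau>M (T - (\<Sum>g\<in>F. \<pi> (fourier T g) * u g)) \<le> e"
proof -
  let ?t = "\<lambda>g. (two_norm \<tau> (fourier T g))\<^sup>2"
  obtain F where F: "finite F" "dist (sum ?t F) ((two_norm \<tau>M T)\<^sup>2) \<le> e\<^sup>2"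
    using has_sum_finite_approximation[OF two_norm_has_sum[OF T], of "e\<^sup>2"] e by auto
  let ?S = "\<Sum>g\<in>F. \<pi> (fourier T g) * u g"
  have SM: "?S \<in> M"
    by (intro cp.closed emb_in_crossed unitary_in_crossed fourier_in_base T)
  have fS: "fourier ?S g = (if g \<in> F then fourier T g else 0)" for g
  proof -
    have "fourier ?S g = (\<Sum>k\<in>F. if k = g then fourier T k else 0)"
      unfolding fourier_sum by (rule sum.cong) (simp_all add: fourier_monomial fourier_in_base T)
    thus ?thesis using F(1) by simp
  qed
  have "(?t has_sum ((two_norm \<tau>M T)\<^sup>2 - sum ?t F)) (UNIV - F)"
    by (rule has_sum_Diff[OF two_norm_has_sum[OF T] has_sum_finite[OF F(1)]]) simp
  moreover have "((\<lambda>g. (two_norm \<tau> (fourier (T - ?S) g))\<^sup>2) has_sum x) UNIV \<longleftrightarrow> (?t has_sum x) (UNIV - F)" for x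
    by (rule has_sum_cong_neutral) (auto simp: fourier_diff fS)
  ultimately have "((\<lambda>g. (two_norm \<tau> (fourier (T - ?S) g))\<^sup>2) has_sum ((two_norm \<tau>M T)\<^sup>2 - sum ?t F)) UNIV"
    by blast
  moreover have "((\<lambda>g. (two_norm \<tau> (fourier (T - ?S) g))\<^sup>2) has_sum (two_norm \<tau>M (T - ?S))\<^sup>2) UNIV"
    by (intro two_norm_has_sum cp.closed T SM)
  ultimately have "(two_norm \<tau>M (T - ?S))\<^sup>2 = (two_norm \<tau>M T)\<^sup>2 - sum ?t F"
    using has_sum_unique by blast
  also have "\<dots> \<le> e\<^sup>2" using F(2) by (simp add: dist_real_def abs_le_iff)
  finally have "two_norm \<tau>M (T - ?S) \<le> e"
    by (rule power2_le_imp_le) (use e in simp)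
  thus ?thesis using that[of F] F(1) by blast
qed

text \<open>z commutes with the amplification of every bounded operator, so its entries commute with
  all operators and are scalar.\<close>

lemma fourier_group_vN:
  assumes z: "z \<in> group_vN"
  shows "fourier z g = \<tau>M (z * u (- g)) *\<^sub>C 1"
proof -
  have "fourier z g * t = t * fourier z g" for t
    unfolding fourier_def
  proof (rule entry_commute_diag)
    have "ell2_diag t \<in> commutant (range u \<union> adj ` range u)"
      by (rule commutantI) (auto simp: diag_commute_unitary)
    thus "z * ell2_diag t = ell2_diag t * z"
      using z unfolding group_vN_def vN_generated_def by (rule_tac commutantD)
  qed
  then obtain c where c: "fourier z g = c *\<^sub>C 1" by (rule scalar_if_central)
  thus ?thesis by (simp add: trace_unitary base.state_scaleC base.closed base.state_one)
qed

section \<open>The conditional expectation onto the group von Neumann algebra\<close>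

context
  fixes E
  assumes E: "trace_preserving_cond_exp \<tau>M M group_vN E"
begin

lemma cond_exp_closed: "T \<in> M \<Longrightarrow> E T \<in> M"
  using E group_vN_subset by (auto simp: trace_preserving_cond_exp_def)

lemma cond_exp_add: "S \<in> M \<Longrightarrow> T \<in> M \<Longrightarrow> E (S + T) = E S + E T"
  using E by (auto simp: trace_preserving_cond_exp_def)

lemma cond_exp_zero: "E 0 = 0"
  using cond_exp_add[OF cp.closed(2) cp.closed(2)] by simp

lemma cond_exp_sum: "(\<And>i. i \<in> I \<Longrightarrow> f i \<in> M) \<Longrightarrow> E (sum f I) = (\<Sum>i\<in>I. E (f i))"
  by (induction I rule: infinite_finite_induct) (simp_all add: cond_exp_zero cond_exp_add cp.closed)

lemma cond_exp_unitary: "T \<in> M \<Longrightarrow> E (u g * T * u h) = u g * E T * u h"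
  using E unitary_in_group_vN unfolding trace_preserving_cond_exp_def by blast

text \<open>Bimodularity and trace preservation show that E T has the scalar coefficients
  \<open>\<tau>M (T * u (- g))\<close>, to which Parseval applies.\<close>

lemma two_norm_cond_exp_has_sum:
  assumes T: "T \<in> M"
  shows "((\<lambda>g. (cmod (\<tau>M (T * u (- g))))\<^sup>2) has_sum (two_norm \<tau>M (E T))\<^sup>2) UNIV"
proof -
  have "two_norm \<tau> (fourier (E T) g) = cmod (\<tau>M (T * u (- g)))" for g
  proof -
    have "\<tau>M (E T * u (- g)) = \<tau>M (E (T * u (- g)))"
      using cond_exp_unitary[OF T, of 0 "- g"] by simp
    also have "\<dots> = \<tau>M (T * u (- g))"
      using E cp.closed(7)[OF T unitary_in_crossed] by (auto simp: trace_preserving_cond_exp_def)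
    finally have "fourier (E T) g = \<tau>M (T * u (- g)) *\<^sub>C 1"
      using fourier_group_vN[of "E T" g] E T by (auto simp: trace_preserving_cond_exp_def)
    thus ?thesis by (simp add: base.two_norm_scaleC base.closed base.two_norm_one)
  qed
  thus ?thesis using two_norm_has_sum[OF cond_exp_closed[OF T]] by simp
qed

text \<open>Comparison of the two Parseval series term by term.\<close>

lemma two_norm_cond_exp_le:
  assumes T: "T \<in> M"
  shows "two_norm \<tau>M (E T) \<le> two_norm \<tau>M T"
proof -
  have "(two_norm \<tau>M (E T))\<^sup>2 \<le> (two_norm \<tau>M T)\<^sup>2"
  proof (rule has_sum_mono[OF two_norm_cond_exp_has_sum[OF T] two_norm_has_sum[OF T]])
    show "(cmod (\<tau>M (T * u (- g))))\<^sup>2 \<le> (two_norm \<tau> (fourier T g))\<^sup>2" for g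
      unfolding trace_unitary by (intro power_mono base.cmod_state_le fourier_in_base T) simp
  qed
  thus ?thesis by (rule power2_le_imp_le) (rule cp.two_norm_nonneg[OF T])
qed

end

end


section \<open>Polar parts of normal elements with central modulus\<close>

lemma selfadjoint_square_zero: "adj d = d \<Longrightarrow> d * d = 0 \<Longrightarrow> d = 0"
proof (rule bop_eqI)
  fix x assume "adj d = d" "d * d = 0"
  hence "(norm (bop_apply d x))\<^sup>2 = 0" unfolding norm_bop_eq by simp
  thus "bop_apply d x = bop_apply 0 x" by simp
qed

lemma adj_mult_zero: "adj d * d = 0 \<Longrightarrow> d = 0"
proof (rule bop_eqI)
  fix x assume "adj d * d = 0"
  hence "(norm (bop_apply d x))\<^sup>2 = 0" unfolding norm_bop_eq by simp
  thus "bop_apply d x = bop_apply 0 x" by simp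
qed

text \<open>
  With \<open>b = (c\<^sup>* c)\<^bsup>1/2\<^esup>\<close> and \<open>h = (1 - b)\<^sup>2\<close> the powers \<open>h\<^sup>n\<close> decrease to the projection \<open>e\<close> onto the
  kernel of \<open>b\<close>. The partial isometry is the limit of \<open>c q\<^sub>n\<close>, where \<open>b q\<^sub>n = 1 - h\<^sup>n\<close>.
\<close>

lemma central_polar_part:
  fixes c :: "'h::complex_hilbert bop"
  assumes A: "von_neumann_algebra A" and c: "c \<in> A" "\<And>x. norm (bop_apply c x) \<le> norm x"
    and normal: "c * adj c = adj c * c" and central: "adj c * c \<in> commutant A"
  obtains w z where "w \<in> A" "z \<in> center A" "projection z" "adj w * w = z" "w * adj w = z"
    "w * z = w" "z = 0 \<Longrightarrow> c = 0"
    "\<And>a a'. a \<in> A \<Longrightarrow> c * a = a' * c \<Longrightarrow> w * a = a' * w"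
proof -
  define k where "k = adj c * c"
  have kA: "k \<in> A" unfolding k_def using A c by (intro vN_closed)
  have k: "positive_bop k" "positive_bop (1 - k)"
    using positive_bop_contraction[OF c(2)] by (simp_all add: k_def)
  obtain b where b: "positive_bop b" "positive_bop (1 - b)" "b * b = k" "b \<in> commutant (commutant {k})"
    using positive_bop_sqrt[OF k] .
  have bsa: "adj b = b" by (rule positive_bop_adj[OF b(1)])
  have bA: "b \<in> A" using vN_contains_bicommutant[OF A, of "{k}"] kA b(4) by auto
  have "A \<subseteq> commutant {k}"
  proof
    fix a assume "a \<in> A"
    hence "k * a = a * k" unfolding k_def by (rule commutantD[OF central])
    thus "a \<in> commutant {k}" by (intro commutantI) simp
  qed
  hence bC: "b \<in> commutant A" using b(4) commutant_antimono by blast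
  define Z where "Z = A \<inter> commutant A"
  have Z_one: "1 \<in> Z" and Z_diff: "\<And>x y. x \<in> Z \<Longrightarrow> y \<in> Z \<Longrightarrow> x - y \<in> Z"
    and Z_add: "\<And>x y. x \<in> Z \<Longrightarrow> y \<in> Z \<Longrightarrow> x + y \<in> Z"
    and Z_mult: "\<And>x y. x \<in> Z \<Longrightarrow> y \<in> Z \<Longrightarrow> x * y \<in> Z" and Z_zero: "0 \<in> Z"
    by (auto simp: Z_def vN_closed[OF A] commutant_0 commutant_1 commutant_add commutant_diff commutant_mult)
  have Z_limit: "a \<in> Z" if "\<And>x. (\<lambda>n. bop_apply (f n) x) \<longlonglongrightarrow> bop_apply a x" "\<And>n. f n \<in> Z" for f a
    using vN_limit[OF A that(1)] commutant_limit[OF that(1)] that(2) by (auto simp: Z_def)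
  have ZD: "x * a = a * x" if "x \<in> Z" "a \<in> A" for x a
    using that by (auto simp: Z_def dest: commutantD)
  have bZ: "b \<in> Z" using bA bC by (simp add: Z_def)
  have c_norm: "norm (bop_apply c x) = norm (bop_apply b x)" for x
  proof -
    have "(norm (bop_apply c x))\<^sup>2 = (norm (bop_apply b x))\<^sup>2"
      unfolding norm_bop_eq by (simp only: bsa b(3) k_def)
    thus ?thesis by simp
  qed
  have cadj_norm: "norm (bop_apply (adj c) x) = norm (bop_apply b x)" for x
  proof -
    have "(norm (bop_apply (adj c) x))\<^sup>2 = (norm (bop_apply b x))\<^sup>2"
      unfolding norm_bop_eq by (simp only: bsa b(3) k_def adj_adj normal)
    thus ?thesis by simp
  qed
  define e0 where "e0 = 1 - b"
  have e0: "positive_bop e0" "positive_bop (1 - e0)" "adj e0 = e0"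
    using b by (simp_all add: e0_def bsa)
  define h where "h = e0 * e0"
  have hZ: "h \<in> Z" unfolding h_def e0_def by (intro Z_mult Z_diff Z_one bZ)
  have hn: "h ^ n = adj (e0 ^ n) * e0 ^ n" for n
    by (simp add: h_def adj_power e0(3) power_mult_distrib[symmetric] power_add[symmetric]
        mult_2[symmetric] power_mult power2_eq_square)
  have hnZ: "h ^ n \<in> Z" for n by (induction n) (simp_all add: Z_one Z_mult hZ)
  define s where "s n = 1 - h ^ n" for n
  have sZ: "s n \<in> Z" for n unfolding s_def by (intro Z_diff Z_one hnZ)
  have s_incr: "positive_bop (s (Suc n) - s n)" for n
  proof -
    have "positive_bop (1 - adj e0 * e0)" by (intro positive_bop_contraction norm_positive_le e0)
    hence "positive_bop (adj (e0 ^ n) * (1 - h) * e0 ^ n)"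
      unfolding h_def e0(3) by (rule positive_bop_conj)
    moreover have "adj (e0 ^ n) * (1 - h) * e0 ^ n = s (Suc n) - s n"
    proof -
      have "e0 ^ n * h = h * e0 ^ n" by (simp add: h_def power_commutes mult.assoc[symmetric])
          (simp add: mult.assoc power_commutes)
      hence "adj (e0 ^ n) * (1 - h) * e0 ^ n = h ^ n - adj (e0 ^ n) * e0 ^ n * h"
        by (simp add: algebra_simps hn)
      also have "\<dots> = s (Suc n) - s n" by (simp add: s_def hn[symmetric] power_commutes)
      finally show ?thesis .
    qed
    ultimately show ?thesis by simp
  qed
  have s_le: "positive_bop (1 - s n)" for n by (simp add: s_def hn)
  have s_0: "positive_bop (s 0)" by (simp add: s_def)
  \<comment> \<open>P becomes the central projection z; it is the support of b.\<close>
  obtain P where P: "\<And>x. (\<lambda>n. bop_apply (s n) x) \<longlonglongrightarrow> bop_apply P x" "positive_bop P"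
    "positive_bop (1 - P)"
    using bop_monotone_limit[of s, OF s_incr s_0 s_le] by metis
  define e where "e = 1 - P"
  have e_lim: "(\<lambda>n. bop_apply (h ^ n) x) \<longlonglongrightarrow> bop_apply e x" for x
    using tendsto_diff[OF tendsto_const P(1), of x x] by (simp add: s_def e_def)
  have PZ: "P \<in> Z" by (rule Z_limit[OF P(1) sZ])
  have h_contr: "norm (bop_apply (h ^ n) x) \<le> 1 * norm x" for n x
    unfolding mult_1 by (rule norm_positive_le)
      (use mono_bop_diff[of s, OF s_incr, of 0 n] in \<open>simp_all add: hn s_def\<close>)
  have "e * e = e"
  proof (rule strong_limit_unique)
    show "(\<lambda>n. bop_apply (h ^ n * h ^ n) x) \<longlonglongrightarrow> bop_apply (e * e) x" for x
      by (rule strong_limit_mult[OF e_lim e_lim h_contr])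
    show "(\<lambda>n. bop_apply (h ^ n * h ^ n) x) \<longlonglongrightarrow> bop_apply e x" for x
      using LIMSEQ_subseq_LIMSEQ[OF e_lim[of x], of "\<lambda>n. n + n"]
      by (simp add: power_add o_def strict_mono_def)
  qed
  hence eproj: "projection e" using positive_bop_adj[OF P(2)] by (simp add: projection_def e_def)
  have zproj: "projection P" using projection_compl[OF eproj] by (simp add: e_def)
  have he: "h * e = e"
  proof (rule strong_limit_unique)
    show "(\<lambda>n. bop_apply (h ^ Suc n) x) \<longlonglongrightarrow> bop_apply (h * e) x" for x
      using bop_tendsto[OF e_lim, of h x] by simp
    show "(\<lambda>n. bop_apply (h ^ Suc n) x) \<longlonglongrightarrow> bop_apply e x" for x
      by (rule LIMSEQ_Suc[OF e_lim])
  qed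
  have hne: "h ^ n * e = e" for n by (induction n) (simp_all add: he mult.assoc)
  have be: "b * e = 0"
  proof (rule bop_eqI)
    fix x
    let ?v = "bop_apply (b * e) x"
    \<comment> \<open>As h e = e, this vanishes, and 1 + e0 is injective because e0 is
      positive.\<close>
    have "(1 + e0) * (b * e) = e - h * e" by (simp add: h_def e0_def algebra_simps)
    hence "(1 + e0) * (b * e) = 0" by (simp add: he)
    hence "bop_apply ((1 + e0) * (b * e)) x = 0" by simp
    hence "?v + bop_apply e0 ?v = 0" by simp
    hence "cinner ?v (?v + bop_apply e0 ?v) = 0" by (simp only: cinner_zero_right)
    hence "(norm ?v)\<^sup>2 + Re (cinner ?v (bop_apply e0 ?v)) = 0"
      by (simp add: cinner_add_right cinner_self complex_eq_iff)
    hence "(norm ?v)\<^sup>2 \<le> 0" using positive_bop_Re[OF e0(1), of ?v] by linarith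
    thus "?v = bop_apply 0 x" by simp
  qed
  \<comment> \<open>Since b (1 + e0) = 1 - h, the geometric sum makes this an approximate inverse of
    b on its support.\<close>
  define q where "q n = (1 + e0) * (\<Sum>j<n. h ^ j)" for n
  have SZ: "(\<Sum>j<n. h ^ j) \<in> Z" for n by (induction n) (simp_all add: Z_zero Z_add hnZ)
  have e1Z: "1 + e0 \<in> Z" unfolding e0_def by (intro Z_add Z_diff Z_one bZ)
  have qZ: "q n \<in> Z" for n unfolding q_def by (intro Z_mult SZ e1Z)
  have bq: "b * q n = s n" for n
  proof -
    have "b * (1 + e0) = 1 - h" by (simp add: h_def e0_def algebra_simps)
    moreover have "(1 - h) * (\<Sum>j<n. h ^ j) = 1 - h ^ n" for n
    proof (induction n)
      case (Suc n)
      have "(1 - h) * (\<Sum>j<Suc n. h ^ j) = (1 - h) * (\<Sum>j<n. h ^ j) + (1 - h) * h ^ n"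
        by (simp add: distrib_left)
      also have "\<dots> = 1 - h ^ Suc n" unfolding Suc by (simp add: left_diff_distrib)
      finally show ?case .
    qed simp
    ultimately show ?thesis by (simp add: q_def s_def mult.assoc[symmetric])
  qed
  have qsa: "adj (q n) = q n" for n
  proof -
    have hsa: "adj (h ^ j) = h ^ j" for j by (simp add: hn)
    have "adj (q n) = (\<Sum>j<n. h ^ j) * (1 + e0)" by (simp add: q_def adj_sum hsa e0(3))
    also have "\<dots> = q n"
      unfolding q_def using e1Z by (intro ZD SZ) (simp add: Z_def)
    finally show ?thesis .
  qed
  \<comment> \<open>d and b have equal norms at every vector, so \<open>d * q n\<close> converges
    along with \<open>b * q n\<close>, which is \<open>s n\<close>. Normality of c allows d to be c
    or its adjoint.\<close>
  have cauchy: "\<exists>v. (\<forall>x. (\<lambda>n. bop_apply (d * q n) x) \<longlonglongrightarrow> bop_apply v x)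
      \<and> (\<forall>x. norm (bop_apply v x) = norm (bop_apply P x))"
    if d: "\<And>x. norm (bop_apply d x) = norm (bop_apply b x)" for d
  proof -
    have nd: "norm (bop_apply (d * q m) x - bop_apply (d * q n) x)
        = norm (bop_apply (s m) x - bop_apply (s n) x)" for m n x
      using d[of "bop_apply (q m) x - bop_apply (q n) x"] by (simp add: bq[symmetric])
    have "Cauchy (\<lambda>n. bop_apply (d * q n) x)" for x
      using LIMSEQ_imp_Cauchy[OF P(1)[of x]] unfolding Cauchy_iff nd .
    moreover have n1: "norm (bop_apply (d * q n) x) = norm (bop_apply (s n) x)" for n x
      using d[of "bop_apply (q n) x"] by (simp add: bq[symmetric])
    moreover have "norm (bop_apply (s n) x) \<le> 1 * norm x" for n x
      unfolding mult_1 by (rule norm_positive_le)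
        (use mono_bop_diff[of s, OF s_incr, of 0 n] s_le in \<open>simp_all add: s_def\<close>)
    ultimately obtain v where v: "\<And>x. (\<lambda>n. bop_apply (d * q n) x) \<longlonglongrightarrow> bop_apply v x"
      using bop_strong_limit[of "\<lambda>n. d * q n" 1] by metis
    have "norm (bop_apply v x) = norm (bop_apply P x)" for x
      using tendsto_norm[OF v[of x]] tendsto_norm[OF P(1)[of x]] unfolding n1 by (rule LIMSEQ_unique)
    thus ?thesis using v by blast
  qed
  obtain w where w: "\<And>x. (\<lambda>n. bop_apply (c * q n) x) \<longlonglongrightarrow> bop_apply w x"
    and wn: "\<And>x. norm (bop_apply w x) = norm (bop_apply P x)"
    using cauchy[OF c_norm] by blast
  obtain w' where w': "\<And>x. (\<lambda>n. bop_apply (adj c * q n) x) \<longlonglongrightarrow> bop_apply w' x"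
    and wn': "\<And>x. norm (bop_apply w' x) = norm (bop_apply P x)"
    using cauchy[OF cadj_norm] by blast
  have adjw: "adj w = w'"
  proof (rule adj_eqI)
    fix x y
    have "adj (c * q n) = adj c * q n" for n
      using ZD[OF qZ vN_adj[OF A c(1)]] by (simp add: qsa)
    hence "cinner (bop_apply (adj c * q n) x) y = cinner x (bop_apply (c * q n) y)" for n
      by (metis cinner_adj_left)
    moreover have "(\<lambda>n. cinner (bop_apply (adj c * q n) x) y) \<longlonglongrightarrow> cinner (bop_apply w' x) y"
      "(\<lambda>n. cinner x (bop_apply (c * q n) y)) \<longlonglongrightarrow> cinner x (bop_apply w y)"
      by (intro tendsto_cinner tendsto_const w w')+
    ultimately show "cinner (bop_apply w' x) y = cinner x (bop_apply w y)"
      using LIMSEQ_unique by simp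
  qed
  have initial: "adj v * v = P" if "\<And>x. norm (bop_apply v x) = norm (bop_apply P x)" for v
  proof -
    have "adj v * v - adj P * P = 0"
      by (rule bop_zeroI) (simp add: cinner_diff_right cinner_adj_right cinner_self that)
    thus ?thesis using zproj by (simp add: projection_def)
  qed
  have "w * e = 0"
  proof (rule bop_eqI)
    fix x
    have "bop_apply P (bop_apply e x) = 0"
      using eproj by (simp add: e_def projection_def algebra_simps)
        (metis bop_rep(5,6) eq_iff_diff_eq_0 mult_1_left)
    thus "bop_apply (w * e) x = bop_apply 0 x" using wn[of "bop_apply e x"] by simp
  qed
  hence wP: "w * P = w" by (simp add: e_def right_diff_distrib)
  have qA: "q n \<in> A" for n using qZ by (simp add: Z_def)
  show ?thesis
  proof (rule that[of w P])
    show "w \<in> A" by (rule vN_limit[OF A w]) (intro vN_mult[OF A] c qA)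
    show "P \<in> center A" using PZ by (simp add: Z_def center_def)
    show "adj w * w = P" by (rule initial[OF wn])
    show "w * adj w = P" using initial[of w'] wn' adjw by (metis adj_adj)
    show "c = 0" if "P = 0"
    proof -
      have "b = 0" using be that by (simp add: e_def)
      hence "adj c * c = 0" using b(3) by (simp add: k_def)
      thus ?thesis by (rule adj_mult_zero)
    qed
    fix a a' assume a: "a \<in> A" "c * a = a' * c"
    have "c * q n * a = a' * (c * q n)" for n
    proof -
      have "c * q n * a = c * a * q n" using ZD[OF qZ a(1)] by (simp add: mult.assoc)
      thus ?thesis by (simp add: a(2) mult.assoc)
    qed
    hence eq: "bop_apply (c * q n) (bop_apply a x) = bop_apply a' (bop_apply (c * q n) x)" for n x
      by (metis times_bop.rep_eq)
    show "w * a = a' * w"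
    proof (rule bop_eqI)
      fix x
      show "bop_apply (w * a) x = bop_apply (a' * w) x"
        using w[of "bop_apply a x"] bop_tendsto[OF w[of x], of a'] unfolding eq
        by (simp add: LIMSEQ_unique)
    qed
  qed (rule zproj wP)+
qed

text \<open>The closure of the range of a is invariant under the commutant of A, so the projection
  onto it lies in the bicommutant.\<close>

lemma range_projection:
  assumes A: "von_neumann_algebra A" and a: "a \<in> A"
  obtains p where "p \<in> A" "projection p" "p * a = a" "\<And>d. d * a = 0 \<Longrightarrow> d * p = 0"
proof -
  define V where "V = range (bop_apply a)"
  obtain p where p: "projection p" "\<And>x. x \<in> closure V \<Longrightarrow> bop_apply p x = x"
    "\<And>x. bop_apply p x \<in> closure V"
  proof (rule projection_onto_closure[of V])
    show "0 \<in> V" unfolding V_def by (rule range_eqI[of _ _ 0]) simp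
    show "x + y \<in> V" if "x \<in> V" "y \<in> V" for x y
      using that unfolding V_def by (auto simp: bop_add[symmetric] simp del: bop_add)
    show "r *\<^sub>C x \<in> V" if "x \<in> V" for r x
      using that unfolding V_def by (auto simp: bop_scaleC[symmetric] simp del: bop_scaleC)
  qed blast
  show ?thesis
  proof (rule that[of p])
    have "p \<in> commutant (commutant A)"
    proof (rule projection_commutes[OF p _ commutant_vN_adj[OF A]])
      fix t v assume t: "t \<in> commutant A" and "v \<in> V"
      then obtain y where "v = bop_apply a y" by (auto simp: V_def)
      hence "bop_apply t v = bop_apply (t * a) y" by simp
      also have "\<dots> = bop_apply a (bop_apply t y)" by (simp add: commutantD[OF t a])
      finally show "bop_apply t v \<in> V" by (simp add: V_def)
    qed
    thus "p \<in> A" by (simp add: vN_bicommutant[OF A])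
    show "p * a = a"
      by (rule bop_eqI) (simp add: p(2)[OF subsetD[OF closure_subset]] V_def)
    show "d * p = 0" if d: "d * a = 0" for d
    proof (rule bop_eqI)
      fix x
      obtain f where f: "\<And>n. f n \<in> V" "f \<longlonglongrightarrow> bop_apply p x"
        using p(3)[of x] unfolding closure_sequential by blast
      have "bop_apply d (f n) = 0" for n
      proof -
        obtain y where "f n = bop_apply a y" using f(1)[of n] by (auto simp: V_def)
        thus ?thesis using arg_cong[OF d, of "\<lambda>t. bop_apply t y"] by simp
      qed
      thus "bop_apply (d * p) x = bop_apply 0 x"
        using bop_tendsto[OF f(2), of d] by (simp add: LIMSEQ_const_iff)
    qed
  qed (rule p)
qed

lemma opnorm_mult: "opnorm (a * b) \<le> opnorm a * opnorm b"
proof (rule opnorm_le)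
  fix x
  have "norm (bop_apply a (bop_apply b x)) \<le> opnorm a * (opnorm b * norm x)"
    by (rule order_trans[OF opnorm mult_left_mono[OF opnorm opnorm_nonneg]])
  thus "norm (bop_apply (a * b) x) \<le> opnorm a * opnorm b * norm x" by (simp add: mult.assoc)
qed simp

section \<open>Intertwiners of properly outer actions\<close>

context tracial_action
begin

text \<open>After scaling c to a contraction d, both adj d d and d adj d are central and they agree,
  so \<open>central_polar_part\<close> supplies the unitary of a corner that contradicts
  outerness.\<close>

lemma intertwiner_zero:
  assumes outer: "properly_outer_over_center \<sigma> A" and g: "g \<noteq> 0" and c: "c \<in> A"
    and tw: "\<And>b. b \<in> A \<Longrightarrow> c * b = \<sigma> g b * c"
  shows "c = 0"
proof (rule ccontr)
  assume c0: "c \<noteq> 0"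
  define r where "r = 1 / (opnorm c + 1)"
  have r: "0 < r" unfolding r_def by (intro divide_pos_pos add_nonneg_pos) simp_all
  define d where "d = of_real r *\<^sub>C c"
  have dA: "d \<in> A" unfolding d_def by (intro base.closed c)
  have dtw: "d * b = \<sigma> g b * d" if "b \<in> A" for b
    using tw[OF that] by (simp add: d_def scaleC_bop_simps)
  have d_contr: "norm (bop_apply d x) \<le> norm x" for x
  proof -
    have "norm (bop_apply d x) = r * norm (bop_apply c x)" using r by (simp add: d_def norm_scaleC)
    also have "\<dots> \<le> r * (opnorm c * norm x)" using r by (intro mult_left_mono opnorm) simp
    also have "\<dots> = (r * opnorm c) * norm x" by simp
    also have "\<dots> \<le> 1 * norm x"
      using add_nonneg_pos[OF opnorm_nonneg zero_less_one, of c]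
      by (intro mult_right_mono) (simp_all add: r_def divide_le_eq)
    finally show ?thesis by simp
  qed
  define k where "k = adj d * d"
  define k' where "k' = d * adj d"
  have dadj: "adj d * \<sigma> g b = b * adj d" if b: "b \<in> A" for b
    using arg_cong[OF dtw[of "adj b"], of adj] b by (simp add: base.closed act_adj)
  have kC: "k * b = b * k" if b: "b \<in> A" for b
  proof -
    have "k * b = (adj d * \<sigma> g b) * d" by (simp add: k_def mult.assoc dtw[OF b])
    thus ?thesis by (simp only: dadj[OF b] k_def mult.assoc)
  qed
  have kC': "k' * b = b * k'" if b: "b \<in> A" for b
  proof -
    define b' where "b' = \<sigma> (- g) b"
    have b': "b' \<in> A" "\<sigma> g b' = b" using b by (simp_all add: b'_def act_closed act_inverse)
    have "k' * b = (d * b') * adj d" using dadj[OF b'(1)] by (simp add: k'_def mult.assoc b'(2))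
    thus ?thesis by (simp only: dtw[OF b'(1)] b'(2) k'_def mult.assoc)
  qed
  \<comment> \<open>Centrality of k and k' gives k' k = k^2 and k k' = k'^2, so their self-adjoint
    difference squares to 0.\<close>
  have "k' = k"
  proof -
    have "k' * k = adj d * k' * d"
      unfolding k_def using kC'[OF base.closed(1)[OF dA]] by (simp add: mult.assoc[symmetric])
    hence 1: "k' * k = k * k" by (simp add: k_def k'_def mult.assoc)
    have "k * k' = d * k * adj d"
      unfolding k'_def using kC[OF dA] by (simp add: mult.assoc[symmetric])
    hence 2: "k * k' = k' * k'" by (simp add: k_def k'_def mult.assoc)
    have "(k' - k) * (k' - k) = k' * k' - k' * k - k * k' + k * k"
      by (simp add: algebra_simps)
    also have "\<dots> = 0" by (simp only: 1 2) simp
    finally have "(k' - k) * (k' - k) = 0" .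
    moreover have "adj (k' - k) = k' - k" by (simp add: k_def k'_def)
    ultimately have "k' - k = 0" by (rule selfadjoint_square_zero[rotated])
    thus ?thesis by simp
  qed
  hence normal: "d * adj d = adj d * d" by (simp add: k_def k'_def)
  have central: "adj d * d \<in> commutant A" by (rule commutantI) (use kC in \<open>simp add: k_def\<close>)
  obtain w z where wz: "w \<in> A" "z \<in> center A" "projection z" "adj w * w = z" "w * adj w = z"
    "w * z = w" and z0: "z = 0 \<Longrightarrow> d = 0"
    and wtw: "\<And>a a'. a \<in> A \<Longrightarrow> d * a = a' * d \<Longrightarrow> w * a = a' * w"
    by (rule central_polar_part[OF base.vN dA d_contr normal central]) blast
  have tww: "w * a = \<sigma> g a * w" if "a \<in> A" for a by (rule wtw[OF that dtw[OF that]])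
  have zA: "z \<in> A" using wz(2) by (simp add: center_def)
  have "d \<noteq> 0"
  proof
    assume "d = 0"
    hence "of_real (1 / r) *\<^sub>C d = 0" by (intro bop_eqI) simp
    moreover have "of_real (1 / r) *\<^sub>C d = c" using r by (simp add: d_def scaleC_bop_simps)
    ultimately show False using c0 by simp
  qed
  hence "z \<noteq> 0" using z0 by blast
  \<comment> \<open>Intertwining z puts z below \<open>\<sigma> g z\<close>; equal traces and
    faithfulness make the two projections coincide.\<close>
  moreover have sz: "\<sigma> g z = z"
  proof -
    have szA: "\<sigma> g z \<in> A" by (rule act_closed[OF zA])
    have "\<sigma> g z * w * adj w = w * z * adj w" using tww[OF zA] by simp
    hence 1: "\<sigma> g z * z = z" by (simp add: mult.assoc wz(5)) (simp add: mult.assoc[symmetric] wz)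
    have sa: "adj z = z" "z * z = z" using wz(3) by (simp_all add: projection_def)
    have ssa: "adj (\<sigma> g z) = \<sigma> g z" "\<sigma> g z * \<sigma> g z = \<sigma> g z"
      using zA sa by (simp_all add: act_adj[symmetric] act_mult[symmetric])
    have 2: "z * \<sigma> g z = z" using arg_cong[OF 1, of adj] by (simp add: sa ssa)
    have "adj (\<sigma> g z - z) * (\<sigma> g z - z) = \<sigma> g z - z"
      by (simp add: sa ssa algebra_simps 1 2)
    hence "\<tau> (adj (\<sigma> g z - z) * (\<sigma> g z - z)) = 0"
      using zA szA by (simp add: base.state_diff act_trace)
    hence "\<sigma> g z - z = 0" using zA szA by (intro base.faithful base.closed)
    thus ?thesis by simp
  qed
  moreover have "inner_on_corner A z (\<sigma> g)"
    unfolding inner_on_corner_def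
  proof (intro bexI[of _ w] conjI ballI)
    show "w \<in> (\<lambda>a. a * z) ` A" using wz(1,6) by (metis imageI)
    fix a assume "a \<in> (\<lambda>a. a * z) ` A"
    then obtain a' where a': "a' \<in> A" "a = a' * z" by blast
    have aA: "a \<in> A" using a' zA by (simp add: base.closed)
    have "a * z = a" using wz(3) a' by (simp add: projection_def mult.assoc)
    hence "\<sigma> g a = \<sigma> g a * z" using act_mult[OF aA zA, of g] sz by metis
    also have "\<dots> = w * a * adj w" by (simp only: tww[OF aA] mult.assoc wz(5))
    finally show "\<sigma> g a = w * a * adj w" .
  qed (rule wz)+
  ultimately show False
    using outer g wz(2,3) unfolding properly_outer_over_center_def by blast
qed


section \<open>Unitaries normalizing the base algebra\<close>

text \<open>The last two clauses say that conjugation by x maps the embedded A into, respectively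
  onto, itself; no automorphism of A has to be named.\<close>

definition normalizing_unitary :: "('g, 'h) ell2 bop \<Rightarrow> bool" where
  "normalizing_unitary x \<longleftrightarrow> x \<in> M \<and> adj x * x = 1 \<and> x * adj x = 1 \<and>
     (\<forall>a\<in>A. \<exists>a'\<in>A. x * \<pi> a = \<pi> a' * x) \<and> (\<forall>a'\<in>A. \<exists>a\<in>A. x * \<pi> a = \<pi> a' * x)"

lemma opnorm_isometry: "adj x * x = 1 \<Longrightarrow> opnorm x \<le> 1"
proof (rule opnorm_le)
  fix v assume "adj x * x = 1"
  hence "(norm (bop_apply x v))\<^sup>2 = (norm v)\<^sup>2" unfolding norm_bop_eq by (simp add: cinner_self)
  thus "norm (bop_apply x v) \<le> 1 * norm v" by simp
qed simp

lemma fourier_emb: "b \<in> A \<Longrightarrow> c \<in> A \<Longrightarrow> fourier (\<pi> b * T * \<pi> c) g = b * fourier T g * \<sigma> g c"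
  by (simp add: fourier_def entry_emb_right entry_emb_left mult.assoc)

text \<open>
  The Fourier coefficients of \<open>x\<close> have mutually orthogonal range projections, so that their
  traces sum up to at most one; this bounds the sum of \<open>|\<tau>(b x c u\<^sub>g\<^sup>*)|\<close> over \<open>g\<close>.
\<close>

lemma normalizing_unitary_trace_sum:
  assumes outer: "properly_outer_over_center \<sigma> A" and x: "normalizing_unitary x"
    and b: "b \<in> A" and c: "c \<in> A" and F: "finite F"
  shows "(\<Sum>g\<in>F. cmod (\<tau>M (\<pi> b * x * \<pi> c * u (- g)))) \<le> opnorm b * opnorm c"
proof -
  have xM: "x \<in> M" and un: "adj x * x = 1" "x * adj x = 1"
    and N1: "\<And>a. a \<in> A \<Longrightarrow> \<exists>a'\<in>A. x * \<pi> a = \<pi> a' * x"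
    and N2: "\<And>a'. a' \<in> A \<Longrightarrow> \<exists>a\<in>A. x * \<pi> a = \<pi> a' * x"
    using x by (auto simp: normalizing_unitary_def)
  define a where "a = fourier x"
  have aA: "a g \<in> A" for g by (simp add: a_def fourier_in_base xM)
  have rel: "a g * \<sigma> g y = y' * a g" if "y \<in> A" "y' \<in> A" "x * \<pi> y = \<pi> y' * x" for g y y'
    using fourier_emb[of 1 y x g] fourier_emb[of y' 1 x g] that
    by (simp add: a_def emb_one base.closed act_one)
  \<comment> \<open>Placing the relation between two factors adj x and taking adjoints gives it for
    adj y and adj y', to which \<open>rel\<close> applies.\<close>
  have rel_adj: "adj (a g) * y' = \<sigma> g y * adj (a g)" if y: "y \<in> A" "y' \<in> A" "x * \<pi> y = \<pi> y' * x" for g y y'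
  proof -
    have "adj x * (x * \<pi> y) * adj x = adj x * (\<pi> y' * x) * adj x" by (simp only: y(3))
    moreover have "adj x * (x * \<pi> y) * adj x = (adj x * x) * (\<pi> y * adj x)"
      "adj x * (\<pi> y' * x) * adj x = adj x * \<pi> y' * (x * adj x)"
      by (simp_all only: mult.assoc)
    ultimately have "\<pi> y * adj x = adj x * \<pi> y'" by (simp only: un mult_1_left mult_1_right)
    hence "adj (\<pi> y * adj x) = adj (adj x * \<pi> y')" by simp
    hence "x * \<pi> (adj y) = \<pi> (adj y') * x" using y by (simp add: emb_adj)
    from rel[OF _ _ this, of g] have "adj (a g * \<sigma> g (adj y)) = adj (adj y' * a g)"
      using y by (simp add: base.closed)
    thus ?thesis using y by (simp add: act_adj)
  qed
  have orth: "adj (a g) * a h = 0" if "g \<noteq> h" for g h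
  proof (rule intertwiner_zero[OF outer])
    show "g + - h \<noteq> 0" using that by (simp add: add_eq_0_iff2)
    show "adj (a g) * a h \<in> A" by (intro base.closed aA)
    fix d assume d: "d \<in> A"
    define y where "y = \<sigma> (- h) d"
    have y: "y \<in> A" "\<sigma> h y = d" using d by (simp_all add: y_def act_closed act_inverse)
    obtain y' where y': "y' \<in> A" "x * \<pi> y = \<pi> y' * x" using N1[OF y(1)] by blast
    have "adj (a g) * a h * d = adj (a g) * y' * a h"
      using rel[OF y(1) y', of h] y(2) by (simp add: mult.assoc)
    also have "\<dots> = \<sigma> g y * (adj (a g) * a h)"
      using rel_adj[OF y(1) y', of g] by (simp add: mult.assoc)
    also have "\<sigma> g y = \<sigma> (g + - h) d" unfolding y_def by (rule act_plus[OF d, symmetric])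
    finally show "adj (a g) * a h * d = \<sigma> (g + - h) d * (adj (a g) * a h)" .
  qed
  have "\<exists>p. p \<in> A \<and> projection p \<and> p * a g = a g \<and> (\<forall>d. d * a g = 0 \<longrightarrow> d * p = 0)" for g
  proof -
    obtain p where "p \<in> A" "projection p" "p * a g = a g" "\<And>d. d * a g = 0 \<Longrightarrow> d * p = 0"
      by (rule range_projection[OF base.vN aA[of g]]) blast
    thus ?thesis by blast
  qed
  then obtain p where pA: "\<And>g. p g \<in> A" and p: "\<And>g. projection (p g)" "\<And>g. p g * a g = a g"
    and p0: "\<And>g d. d * a g = 0 \<Longrightarrow> d * p g = 0" by metis
  have psa: "adj (p g) = p g" "p g * p g = p g" for g using p(1) by (simp_all add: projection_def)
  have porth: "p h * p g = 0" if "g \<noteq> h" for g h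
  proof (rule p0)
    have "adj (adj (a g) * p h) = adj 0" by (simp only: p0[OF orth[OF that]])
    thus "p h * a g = 0" by (simp add: psa)
  qed
  \<comment> \<open>A finite sum of orthogonal projections is a projection, so the traces of the
    \<open>p g\<close> add up to at most 1.\<close>
  define P where "P = (\<Sum>g\<in>F. p g)"
  have "P * P = (\<Sum>g\<in>F. \<Sum>h\<in>F. p g * p h)" by (simp add: P_def sum_product)
  also have "\<dots> = (\<Sum>g\<in>F. \<Sum>h\<in>F. if h = g then p g else 0)"
    by (intro sum.cong refl) (auto simp: psa porth)
  also have "\<dots> = P" using F by (simp add: P_def)
  finally have "projection P" by (simp add: projection_def P_def adj_sum psa)
  hence Ppos: "positive_bop (1 - P)" by (intro positive_bop_projection projection_compl)
  have PA: "P \<in> A" unfolding P_def by (intro base.closed pA)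
  have p_norm: "(two_norm \<tau> (p g))\<^sup>2 = Re (\<tau> (p g))" for g
    by (simp add: base.two_norm_square pA psa)
  have sum_p: "(\<Sum>g\<in>F. (two_norm \<tau> (p g))\<^sup>2) \<le> 1"
    using base.state_mono[OF PA base.closed(3) Ppos]
    by (simp add: p_norm P_def base.state_sum pA base.state_one)
  have a1: "opnorm (a g) \<le> 1" for g
  proof (rule opnorm_le)
    show "norm (bop_apply (a g) v) \<le> 1 * norm v" for v
      unfolding a_def fourier_def
      by (rule order_trans[OF norm_entry_le mult_right_mono[OF opnorm_isometry[OF un(1)] norm_ge_zero]])
  qed simp
  have bound: "cmod (\<tau>M (\<pi> b * x * \<pi> c * u (- g))) \<le> (opnorm b * opnorm c) * (two_norm \<tau> (p g))\<^sup>2" for g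
  proof -
    define y where "y = \<sigma> g c * b"
    have yA: "y \<in> A" unfolding y_def by (intro base.closed act_closed b c)
    have "\<tau>M (\<pi> b * x * \<pi> c * u (- g)) = \<tau> (b * a g * \<sigma> g c)"
      by (simp add: trace_unitary fourier_emb b c a_def)
    also have "\<dots> = \<tau> (\<sigma> g c * (b * a g))"
      by (intro base.trace_mult base.closed act_closed aA b c)
    also have "\<dots> = \<tau> (y * (p g * a g))" by (simp add: y_def p(2) mult.assoc)
    \<comment> \<open>The second copy of \<open>p g\<close> gives both Cauchy-Schwarz factors the
      2-norm of \<open>p g\<close>, hence its trace rather than the root of it.\<close>
    also have "\<dots> = \<tau> (adj (p g * adj y) * (p g * a g))"
    proof -
      have "p g * (p g * a g) = p g * a g" by (simp only: mult.assoc[symmetric] psa(2))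
      thus ?thesis by (simp only: adj_mult adj_adj psa(1) mult.assoc)
    qed
    finally have "cmod (\<tau>M (\<pi> b * x * \<pi> c * u (- g))) \<le> two_norm \<tau> (p g * adj y) * two_norm \<tau> (p g * a g)"
      using base.state_Cauchy_Schwarz[of "p g * adj y" "p g * a g"] pA aA yA by (simp add: base.closed)
    also have "\<dots> \<le> (opnorm (adj y) * two_norm \<tau> (p g)) * (opnorm (a g) * two_norm \<tau> (p g))"
      using pA aA yA
      by (intro mult_mono base.two_norm_mult_right base.closed base.two_norm_nonneg mult_nonneg_nonneg) simp_all
    also have "\<dots> = (opnorm (adj y) * opnorm (a g)) * (two_norm \<tau> (p g))\<^sup>2"
      by (simp add: power2_eq_square)
    also have "\<dots> \<le> ((opnorm b * opnorm c) * 1) * (two_norm \<tau> (p g))\<^sup>2"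
    proof (intro mult_right_mono mult_mono a1)
      have "opnorm (adj y) \<le> opnorm (\<sigma> g c) * opnorm b"
        unfolding y_def by (rule order_trans[OF opnorm_adj_le opnorm_mult])
      also have "\<dots> \<le> opnorm c * opnorm b" by (intro mult_right_mono act_opnorm_le c) simp
      finally show "opnorm (adj y) \<le> opnorm b * opnorm c" by (simp add: mult.commute)
    qed simp_all
    finally show ?thesis by simp
  qed
  have "(\<Sum>g\<in>F. cmod (\<tau>M (\<pi> b * x * \<pi> c * u (- g)))) \<le> (opnorm b * opnorm c) * (\<Sum>g\<in>F. (two_norm \<tau> (p g))\<^sup>2)"
    unfolding sum_distrib_left by (intro sum_mono bound)
  also have "\<dots> \<le> (opnorm b * opnorm c) * 1" by (intro mult_left_mono sum_p) simp
  finally show ?thesis by simp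
qed

section \<open>From small coefficients to the uniform lower bound\<close>

lemma two_norm_cond_exp_normalizing_le:
  assumes outer: "properly_outer_over_center \<sigma> A" and x: "normalizing_unitary x"
    and b: "b \<in> A" and c: "c \<in> A" and E: "trace_preserving_cond_exp \<tau>M M group_vN E"
    and D: "0 \<le> D" "\<And>g. cmod (\<tau>M (\<pi> b * x * \<pi> c * u g)) \<le> D"
  shows "two_norm \<tau>M (E (\<pi> b * x * \<pi> c)) \<le> sqrt (opnorm b * opnorm c) * sqrt D"
proof -
  let ?T = "\<pi> b * x * \<pi> c"
  have TM: "?T \<in> M"
    using x by (intro cp.closed emb_in_crossed b c) (simp add: normalizing_unitary_def)
  have "(two_norm \<tau>M (E ?T))\<^sup>2 \<le> D * (opnorm b * opnorm c)"
  proof (rule has_sum_le_finite_sums[OF two_norm_cond_exp_has_sum[OF E TM]])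
    fix F :: "'g set" assume F: "finite F"
    have "(\<Sum>g\<in>F. (cmod (\<tau>M (?T * u (- g))))\<^sup>2) \<le> (\<Sum>g\<in>F. D * cmod (\<tau>M (?T * u (- g))))"
      unfolding power2_eq_square by (intro sum_mono mult_right_mono D) simp
    also have "\<dots> \<le> D * (opnorm b * opnorm c)"
      unfolding sum_distrib_left[symmetric]
      by (intro mult_left_mono normalizing_unitary_trace_sum outer x b c F D)
    finally show "(\<Sum>g\<in>F. (cmod (\<tau>M (?T * u (- g))))\<^sup>2) \<le> D * (opnorm b * opnorm c)" .
  qed
  also have "\<dots> = (sqrt (opnorm b * opnorm c) * sqrt D)\<^sup>2"
    using D(1) by (simp add: power_mult_distrib)
  finally show ?thesis by (rule power2_le_imp_le) (simp add: D(1))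
qed

text \<open>Applied with \<open>E (b * x * c)\<close> for \<open>T b c\<close>: if all of these were
  small, so would be the approximant in (ii), with a constant that depends only on K. Both one-sided
  2-norm bounds enter.\<close>

lemma sum_quadruple_le:
  assumes TM: "\<And>b c. b \<in> K \<Longrightarrow> c \<in> K \<Longrightarrow> T b c \<in> M" and K: "K \<subseteq> M"
    and small: "\<And>b c. b \<in> K \<Longrightarrow> c \<in> K \<Longrightarrow> two_norm \<tau>M (T b c) \<le> \<delta>"
  shows "two_norm \<tau>M (\<Sum>a\<in>K. \<Sum>b\<in>K. \<Sum>c\<in>K. \<Sum>d\<in>K. a * T b c * d)
    \<le> (\<Sum>a\<in>K. \<Sum>b\<in>K. \<Sum>c\<in>K. \<Sum>d\<in>K. opnorm a * opnorm d) * \<delta>"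
proof -
  have bound: "two_norm \<tau>M (a * T b c * d) \<le> (opnorm a * opnorm d) * \<delta>"
    if "a \<in> K" "b \<in> K" "c \<in> K" "d \<in> K" for a b c d
  proof -
    have M: "a \<in> M" "d \<in> M" "T b c \<in> M" using that K TM by auto
    have "two_norm \<tau>M (a * T b c * d) \<le> opnorm d * two_norm \<tau>M (a * T b c)"
      by (intro two_norm_crossed_mult_right cp.closed M)
    also have "\<dots> \<le> opnorm d * (opnorm a * two_norm \<tau>M (T b c))"
      by (intro mult_left_mono cp.two_norm_mult_left M) simp
    also have "\<dots> \<le> opnorm d * (opnorm a * \<delta>)"
      by (intro mult_left_mono small that) simp_all
    finally show ?thesis by (simp add: mult_ac)
  qed
  show ?thesis
    unfolding sum_distrib_right
    by (intro order_trans[OF cp.two_norm_sum] sum_mono bound cp.closed)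
      (use K TM in auto)
qed

text \<open>X stands for the set of all images of the group unitaries. Every constant is fixed from
  \<epsilon>, K and the Fourier coefficients of K before an element of X is considered, whence the
  uniformity.\<close>

lemma uniform_lower_bound:
  assumes outer: "properly_outer_over_center \<sigma> A"
    and E: "trace_preserving_cond_exp \<tau>M M group_vN E"
    and X: "\<And>x. x \<in> X \<Longrightarrow> normalizing_unitary x"
    and \<epsilon>: "\<epsilon> < 1" and K: "finite K" "K \<subseteq> M"
    and close: "\<And>x. x \<in> X \<Longrightarrow>
      two_norm \<tau>M (x - (\<Sum>a\<in>K. \<Sum>b\<in>K. \<Sum>c\<in>K. \<Sum>d\<in>K. a * E (b * x * c) * d)) \<le> \<epsilon>"
  shows "\<exists>D>0. \<exists>F. finite F \<and> F \<noteq> {} \<and> F \<subseteq> \<pi> ` A \<and>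
    (\<forall>x\<in>X. \<exists>l. Max ((\<lambda>(b, c). cmod (\<tau>M (adj b * x * c * u l))) ` (F \<times> F)) \<ge> D)"
proof -
  have cancel: "q * (r / (2 * q)) = r / 2" if "0 < q" for q r :: real
    using that by simp
  have XM: "x \<in> M" if "x \<in> X" for x using X[OF that] by (simp add: normalizing_unitary_def)
  have X1: "opnorm x \<le> 1" if "x \<in> X" for x
    using X[OF that] opnorm_isometry by (auto simp: normalizing_unitary_def)
  have EM: "E T \<in> M" if "T \<in> M" for T using cond_exp_closed[OF E that] .
  define \<kappa> where "\<kappa> = (\<Sum>a\<in>K. \<Sum>b\<in>K. \<Sum>c\<in>K. \<Sum>d\<in>K. opnorm a * opnorm d)"
  have \<kappa>: "0 \<le> \<kappa>" unfolding \<kappa>_def by (intro sum_nonneg mult_nonneg_nonneg) simp_all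
  \<comment> \<open>Makes \<open>\<kappa> * \<delta>\<close> less than 1 - \<epsilon>, while every x
    has 2-norm 1; the added 1 covers the case that \<open>\<kappa>\<close> is 0.\<close>
  define \<delta> where "\<delta> = (1 - \<epsilon>) / (2 * (\<kappa> + 1))"
  have \<delta>: "0 < \<delta>" using \<epsilon> \<kappa> unfolding \<delta>_def by (intro divide_pos_pos) simp_all
  have big: "\<exists>b\<in>K. \<exists>c\<in>K. \<delta> < two_norm \<tau>M (E (b * x * c))" if x: "x \<in> X" for x
  proof (rule ccontr)
    assume "\<not> ?thesis"
    hence small: "two_norm \<tau>M (E (b * x * c)) \<le> \<delta>" if "b \<in> K" "c \<in> K" for b c
      using that by (force simp: not_less)
    have TM: "E (b * x * c) \<in> M" if "b \<in> K" "c \<in> K" for b c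
      by (intro EM cp.closed XM[OF x]) (use that K(2) in auto)
    let ?y = "\<Sum>a\<in>K. \<Sum>b\<in>K. \<Sum>c\<in>K. \<Sum>d\<in>K. a * E (b * x * c) * d"
    have yM: "?y \<in> M" using K(2) TM by (intro cp.closed) auto
    have "two_norm \<tau>M ?y \<le> \<kappa> * \<delta>"
      unfolding \<kappa>_def by (rule sum_quadruple_le[OF TM K(2) small])
    also have "\<kappa> * \<delta> < 1 - \<epsilon>"
    proof -
      have "\<kappa> * \<delta> \<le> (\<kappa> + 1) * \<delta>" using \<delta> by simp
      also have "\<dots> = (1 - \<epsilon>) / 2" unfolding \<delta>_def by (rule cancel) (use \<kappa> in simp)
      finally show ?thesis using \<epsilon> by simp
    qed
    finally have y: "two_norm \<tau>M ?y < 1 - \<epsilon>" .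
    have "two_norm \<tau>M x = 1"
      using X[OF x] by (simp add: two_norm_def normalizing_unitary_def cp.state_one)
    moreover have "two_norm \<tau>M ((x - ?y) + ?y) \<le> two_norm \<tau>M (x - ?y) + two_norm \<tau>M ?y"
      by (intro cp.two_norm_triangle cp.closed XM[OF x] yM)
    ultimately show False using close[OF x] y by simp
  qed
  have approx: "\<exists>G. finite G \<and> two_norm \<tau>M (T - (\<Sum>g\<in>G. \<pi> (fourier T g) * u g)) \<le> e"
    if "T \<in> M" "0 < e" for T e
    using two_norm_approximation[OF that] by metis
  \<comment> \<open>Bounds the operator norms in K, so replacing b costs at most R times its
    approximation error, that is \<delta>/4.\<close>
  define R where "R = 1 + (\<Sum>c\<in>K. opnorm c)"
  have R: "0 < R" unfolding R_def by (intro add_pos_nonneg sum_nonneg) simp_all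
  have R_ge: "opnorm c \<le> R" if "c \<in> K" for c
    unfolding R_def using member_le_sum[OF that _ K(1), of opnorm] by simp
  have e1: "0 < \<delta> / (4 * R)" using \<delta> R by simp
  have "\<forall>b\<in>K. \<exists>G. finite G \<and> two_norm \<tau>M (b - (\<Sum>g\<in>G. \<pi> (fourier b g) * u g)) \<le> \<delta> / (4 * R)"
    using approx[OF subsetD[OF K(2)] e1] by blast
  from bchoice[OF this] obtain G where
    "\<forall>b\<in>K. finite (G b) \<and> two_norm \<tau>M (b - (\<Sum>g\<in>G b. \<pi> (fourier b g) * u g)) \<le> \<delta> / (4 * R)" ..
  hence G: "\<And>b. b \<in> K \<Longrightarrow> finite (G b)"
    "\<And>b. b \<in> K \<Longrightarrow> two_norm \<tau>M (b - (\<Sum>g\<in>G b. \<pi> (fourier b g) * u g)) \<le> \<delta> / (4 * R)" by blast+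
  define b0 where "b0 b = (\<Sum>g\<in>G b. \<pi> (fourier b g) * u g)" for b
  \<comment> \<open>Approximation in the 2-norm does not control the operator norm of
    \<open>b0 b\<close>, which multiplies the error for c; hence c is approximated only after
    \<open>b0\<close> is fixed.\<close>
  define R' where "R' = 1 + (\<Sum>b\<in>K. opnorm (b0 b))"
  have R': "0 < R'" unfolding R'_def by (intro add_pos_nonneg sum_nonneg) simp_all
  have R'_ge: "opnorm (b0 b) \<le> R'" if "b \<in> K" for b
    unfolding R'_def using member_le_sum[OF that _ K(1), of "\<lambda>b. opnorm (b0 b)"] by simp
  have e2: "0 < \<delta> / (4 * R')" using \<delta> R' by simp
  have "\<forall>c\<in>K. \<exists>H. finite H \<and> two_norm \<tau>M (c - (\<Sum>h\<in>H. \<pi> (fourier c h) * u h)) \<le> \<delta> / (4 * R')"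
    using approx[OF subsetD[OF K(2)] e2] by blast
  from bchoice[OF this] obtain H where
    "\<forall>c\<in>K. finite (H c) \<and> two_norm \<tau>M (c - (\<Sum>h\<in>H c. \<pi> (fourier c h) * u h)) \<le> \<delta> / (4 * R')" ..
  hence H: "\<And>c. c \<in> K \<Longrightarrow> finite (H c)"
    "\<And>c. c \<in> K \<Longrightarrow> two_norm \<tau>M (c - (\<Sum>h\<in>H c. \<pi> (fourier c h) * u h)) \<le> \<delta> / (4 * R')" by blast+
  define c0 where "c0 c = (\<Sum>h\<in>H c. \<pi> (fourier c h) * u h)" for c
  have fA: "fourier b g \<in> A" if "b \<in> K" for b g using that K(2) by (intro fourier_in_base) auto
  have b0M: "b0 b \<in> M" if "b \<in> K" for b
    unfolding b0_def by (intro cp.closed emb_in_crossed unitary_in_crossed fA that)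
  have c0M: "c0 c \<in> M" if "c \<in> K" for c
    unfolding c0_def by (intro cp.closed emb_in_crossed unitary_in_crossed fA that)
  \<comment> \<open>Coefficients of \<open>b0 b\<close> with the unitaries on the left; those of
    \<open>c0 c\<close> keep them on the right, so that bimodularity of E extracts both.\<close>
  define bb where "bb b g = \<sigma> (- g) (fourier b g)" for b g
  have bbA: "bb b g \<in> A" if "b \<in> K" for b g unfolding bb_def by (intro act_closed fA that)
  have b0_eq: "b0 b = (\<Sum>g\<in>G b. u g * \<pi> (bb b g))" if "b \<in> K" for b
    unfolding b0_def bb_def using fA[OF that]
    by (intro sum.cong refl) (simp add: unitary_emb act_closed act_inverse)
  have E0: "two_norm \<tau>M (E (b * x * c)) \<le> two_norm \<tau>M (E (b0 b * x * c0 c)) + \<delta> / 2"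
    if x: "x \<in> X" and b: "b \<in> K" and c: "c \<in> K" for x b c
  proof -
    have bM: "b \<in> M" and cM: "c \<in> M" using b c K(2) by auto
    note M = bM cM b0M[OF b] c0M[OF c] XM[OF x]
    have split: "b * x * c = b0 b * x * c0 c + ((b - b0 b) * (x * c) + b0 b * x * (c - c0 c))"
      by (simp add: algebra_simps)
    let ?r = "(b - b0 b) * (x * c) + b0 b * x * (c - c0 c)"
    have "two_norm \<tau>M ((b - b0 b) * (x * c)) \<le> opnorm (x * c) * two_norm \<tau>M (b - b0 b)"
      by (intro two_norm_crossed_mult_right cp.closed M)
    also have "\<dots> \<le> R * (\<delta> / (4 * R))"
    proof (intro mult_mono)
      have "opnorm (x * c) \<le> 1 * opnorm c"
        by (rule order_trans[OF opnorm_mult mult_right_mono[OF X1[OF x]]]) simp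
      thus "opnorm (x * c) \<le> R" using R_ge[OF c] by simp
      show "two_norm \<tau>M (b - b0 b) \<le> \<delta> / (4 * R)" using G(2)[OF b] by (simp add: b0_def)
    qed (use R M in \<open>simp_all add: cp.two_norm_nonneg cp.closed\<close>)
    also have "\<dots> = \<delta> / 4" using R by simp
    finally have 1: "two_norm \<tau>M ((b - b0 b) * (x * c)) \<le> \<delta> / 4" .
    have "two_norm \<tau>M (b0 b * x * (c - c0 c)) \<le> opnorm (b0 b * x) * two_norm \<tau>M (c - c0 c)"
      by (intro cp.two_norm_mult_left cp.closed M)
    also have "\<dots> \<le> R' * (\<delta> / (4 * R'))"
    proof (intro mult_mono)
      have "opnorm (b0 b * x) \<le> opnorm (b0 b) * 1"
        by (rule order_trans[OF opnorm_mult mult_left_mono[OF X1[OF x]]]) simp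
      thus "opnorm (b0 b * x) \<le> R'" using R'_ge[OF b] by simp
      show "two_norm \<tau>M (c - c0 c) \<le> \<delta> / (4 * R')" using H(2)[OF c] by (simp add: c0_def)
    qed (use R' M in \<open>simp_all add: cp.two_norm_nonneg cp.closed\<close>)
    also have "\<dots> = \<delta> / 4" using R' by simp
    finally have 2: "two_norm \<tau>M (b0 b * x * (c - c0 c)) \<le> \<delta> / 4" .
    have rM: "?r \<in> M" by (intro cp.closed M)
    have "two_norm \<tau>M ?r \<le> two_norm \<tau>M ((b - b0 b) * (x * c)) + two_norm \<tau>M (b0 b * x * (c - c0 c))"
      by (intro cp.two_norm_triangle cp.closed M)
    hence r: "two_norm \<tau>M (E ?r) \<le> \<delta> / 2"
      using two_norm_cond_exp_le[OF E rM] 1 2 by linarith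
    have "E (b * x * c) = E (b0 b * x * c0 c) + E ?r"
      unfolding split by (intro cond_exp_add[OF E] cp.closed M)
    moreover have "two_norm \<tau>M (E (b0 b * x * c0 c) + E ?r) \<le> two_norm \<tau>M (E (b0 b * x * c0 c)) + two_norm \<tau>M (E ?r)"
      by (intro cp.two_norm_triangle EM rM cp.closed M)
    ultimately show ?thesis using r by simp
  qed
  \<comment> \<open>Adjoints appear because the conclusion contains adj b; \<open>\<pi> 1\<close>
    keeps F nonempty in all cases.\<close>
  define F where "F = insert (\<pi> 1) ((\<Union>b\<in>K. (\<lambda>g. adj (\<pi> (bb b g))) ` G b) \<union> (\<Union>c\<in>K. (\<lambda>h. \<pi> (fourier c h)) ` H c))"
  have F: "finite F" "F \<noteq> {}" using K(1) G(1) H(1) by (auto simp: F_def)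
  have FA: "F \<subseteq> \<pi> ` A"
    unfolding F_def using bbA fA by (auto simp: emb_adj[symmetric] vN_adj[OF base.vN] vN_one[OF base.vN])
  define L where "L b c = (\<Sum>g\<in>G b. \<Sum>h\<in>H c. sqrt (opnorm (bb b g) * opnorm (fourier c h)))" for b c
  have L: "0 \<le> L b c" for b c unfolding L_def by (intro sum_nonneg) simp
  define L' where "L' = (\<Sum>b\<in>K. \<Sum>c\<in>K. L b c)"
  have L_le: "L b c \<le> L'" if "b \<in> K" "c \<in> K" for b c
  proof -
    have "L b c \<le> (\<Sum>c\<in>K. L b c)" by (rule member_le_sum[OF that(2) _ K(1)]) (rule L)
    also have "\<dots> \<le> L'"
      unfolding L'_def by (rule member_le_sum[OF that(1) _ K(1)]) (intro sum_nonneg L)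
    finally show ?thesis .
  qed
  have L': "0 \<le> L'" unfolding L'_def by (intro sum_nonneg L)
  \<comment> \<open>Solves (L' + 1) sqrt D = \<delta>/2, the share of \<delta> left after the
    Fourier approximation.\<close>
  define D where "D = (\<delta> / (2 * (L' + 1)))\<^sup>2"
  have sqrtD: "sqrt D = \<delta> / (2 * (L' + 1))" using \<delta> L' by (simp add: D_def)
  have D: "0 < D" using \<delta> L' by (simp add: D_def)
  have "\<exists>l. Max ((\<lambda>(b, c). cmod (\<tau>M (adj b * x * c * u l))) ` (F \<times> F)) \<ge> D" if x: "x \<in> X" for x
  proof (rule ccontr)
    assume contr: "\<not> ?thesis"
    have small: "cmod (\<tau>M (adj b * x * c * u l)) \<le> D" if "b \<in> F" "c \<in> F" for b c l
    proof -
      have "cmod (\<tau>M (adj b * x * c * u l)) \<le> Max ((\<lambda>(b, c). cmod (\<tau>M (adj b * x * c * u l))) ` (F \<times> F))"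
        using that F(1) by (intro Max_ge) auto
      also have "\<dots> \<le> D" using contr by (meson linear)
      finally show ?thesis .
    qed
    obtain b c where b: "b \<in> K" and c: "c \<in> K" and bc: "\<delta> < two_norm \<tau>M (E (b * x * c))"
      using big[OF x] by blast
    have mono: "two_norm \<tau>M (u g * E (\<pi> (bb b g) * x * \<pi> (fourier c h)) * u h)
        \<le> sqrt (opnorm (bb b g) * opnorm (fourier c h)) * sqrt D"
      if g: "g \<in> G b" and h: "h \<in> H c" for g h
    proof -
      let ?T = "E (\<pi> (bb b g) * x * \<pi> (fourier c h))"
      have TM: "?T \<in> M" by (intro EM cp.closed emb_in_crossed bbA fA b c XM[OF x])
      have "two_norm \<tau>M (u g * ?T * u h) \<le> opnorm (u h) * two_norm \<tau>M (u g * ?T)"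
        by (intro two_norm_crossed_mult_right cp.closed unitary_in_crossed TM)
      also have "\<dots> \<le> 1 * two_norm \<tau>M (u g * ?T)"
        by (intro mult_right_mono opnorm_crossed_unitary cp.two_norm_nonneg cp.closed unitary_in_crossed TM)
      also have "\<dots> \<le> opnorm (u g) * two_norm \<tau>M ?T"
        unfolding mult_1 by (intro cp.two_norm_mult_left unitary_in_crossed TM)
      also have "\<dots> \<le> 1 * two_norm \<tau>M ?T"
        by (intro mult_right_mono opnorm_crossed_unitary cp.two_norm_nonneg TM)
      also have "\<dots> \<le> sqrt (opnorm (bb b g) * opnorm (fourier c h)) * sqrt D"
        unfolding mult_1
      proof (rule two_norm_cond_exp_normalizing_le[OF outer X[OF x] bbA[OF b] fA[OF c] E])
        fix l
        have "adj (\<pi> (bb b g)) \<in> F" "\<pi> (fourier c h) \<in> F" using b c g h by (auto simp: F_def)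
        from small[OF this, of l]
        show "cmod (\<tau>M (\<pi> (bb b g) * x * \<pi> (fourier c h) * u l)) \<le> D" by simp
      qed (use D in simp)
      finally show ?thesis .
    qed
    have expand: "E (b0 b * x * c0 c) = (\<Sum>g\<in>G b. \<Sum>h\<in>H c. u g * E (\<pi> (bb b g) * x * \<pi> (fourier c h)) * u h)"
    proof -
      have TM: "\<pi> (bb b g) * x * \<pi> (fourier c h) \<in> M" for g h
        by (intro cp.closed emb_in_crossed bbA fA b c XM[OF x])
      have "b0 b * x * c0 c = (\<Sum>g\<in>G b. \<Sum>h\<in>H c. u g * (\<pi> (bb b g) * x * \<pi> (fourier c h)) * u h)"
        unfolding b0_eq[OF b] c0_def
        by (simp add: sum_distrib_left sum_distrib_right mult.assoc) (rule sum.swap)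
      also have "E \<dots> = (\<Sum>g\<in>G b. \<Sum>h\<in>H c. E (u g * (\<pi> (bb b g) * x * \<pi> (fourier c h)) * u h))"
        by (simp add: cond_exp_sum[OF E] cp.closed unitary_in_crossed TM)
      finally show ?thesis by (simp only: cond_exp_unitary[OF E TM])
    qed
    have "two_norm \<tau>M (E (b0 b * x * c0 c)) \<le> (\<Sum>g\<in>G b. \<Sum>h\<in>H c. sqrt (opnorm (bb b g) * opnorm (fourier c h)) * sqrt D)"
      unfolding expand
      by (intro order_trans[OF cp.two_norm_sum] sum_mono mono cp.closed EM emb_in_crossed
          unitary_in_crossed bbA fA b c XM[OF x])
    also have "\<dots> = L b c * sqrt D" by (simp add: L_def sum_distrib_right)
    also have "\<dots> \<le> L' * sqrt D" using D by (intro mult_right_mono L_le b c) simp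
    also have "\<dots> < (L' + 1) * sqrt D" using D by simp
    also have "\<dots> = \<delta> / 2" unfolding sqrtD by (rule cancel) (use L' in simp)
    finally show False using E0[OF x b c] bc by simp
  qed
  thus ?thesis using D F FA by blast
qed

end

text \<open>The isomorphism enters through the images of the group unitaries: covariance on the side
  of A, together with condition (i), makes them normalize B, and \<open>uniform_lower_bound\<close>
  applies to the set of all of them.\<close>

theorem theorem4p4:
  fixes A :: "'h::complex_hilbert bop set" and \<tau>A :: "'h bop \<Rightarrow> complex"
    and \<sigma> :: "'g::{group_add, countable} \<Rightarrow> 'h bop \<Rightarrow> 'h bop"
    and B :: "'k::complex_hilbert bop set" and \<tau>B :: "'k bop \<Rightarrow> complex"
    and \<alpha> :: "'l::{group_add, countable} \<Rightarrow> 'k bop \<Rightarrow> 'k bop"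
    and \<Theta> :: "('g, 'h) ell2 bop \<Rightarrow> ('l, 'k) ell2 bop"
    and E :: "('l, 'k) ell2 bop \<Rightarrow> ('l, 'k) ell2 bop"
    and \<epsilon> :: real and K :: "('l, 'k) ell2 bop set"
  assumes "tracial_von_neumann_algebra A \<tau>A"
    and "tracial_von_neumann_algebra B \<tau>B"
    and "trace_preserving_action \<sigma> A \<tau>A" and "properly_outer_over_center \<sigma> A"
    and "trace_preserving_action \<alpha> B \<tau>B" and "properly_outer_over_center \<alpha> B"
    and "star_isomorphism (crossed_product \<sigma> A) (crossed_product \<alpha> B) \<Theta>"
    and "trace_preserving_cond_exp (crossed_trace \<tau>B) (crossed_product \<alpha> B) group_vN E"
    and "\<Theta> ` crossed_emb \<sigma> ` A = crossed_emb \<alpha> ` B"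
    and "0 < \<epsilon>" and "\<epsilon> < 1"
    and "finite K" and "K \<subseteq> crossed_product \<alpha> B"
    and "\<forall>\<gamma>. two_norm (crossed_trace \<tau>B)
           (\<Theta> (crossed_unitary \<gamma>)
            - (\<Sum>a\<in>K. \<Sum>b\<in>K. \<Sum>c\<in>K. \<Sum>d\<in>K. a * E (b * \<Theta> (crossed_unitary \<gamma>) * c) * d)) \<le> \<epsilon>"
  shows "\<exists>D>0. \<exists>F. finite F \<and> F \<noteq> {} \<and> F \<subseteq> crossed_emb \<alpha> ` B \<and>
           (\<forall>\<gamma>. \<exists>l. Max ((\<lambda>(b, c).
              cmod (crossed_trace \<tau>B (adj b * \<Theta> (crossed_unitary \<gamma>) * c * crossed_unitary l)))
              ` (F \<times> F)) \<ge> D)"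
proof -
  interpret GA: tracial_action A \<tau>A \<sigma> by unfold_locales (rule assms)+
  interpret LB: tracial_action B \<tau>B \<alpha> by unfold_locales (rule assms)+
  have bij: "bij_betw \<Theta> GA.M LB.M"
    and mult: "\<And>x y. x \<in> GA.M \<Longrightarrow> y \<in> GA.M \<Longrightarrow> \<Theta> (x * y) = \<Theta> x * \<Theta> y"
    and adj: "\<And>x. x \<in> GA.M \<Longrightarrow> \<Theta> (adj x) = adj (\<Theta> x)"
    using assms(7) by (auto simp: star_isomorphism_def)
  \<comment> \<open>Unitality is a consequence of surjectivity.\<close>
  have one: "\<Theta> 1 = 1"
  proof -
    have "1 \<in> \<Theta> ` GA.M" using bij LB.cp.closed(3) by (simp add: bij_betw_def)
    then obtain y where y: "y \<in> GA.M" "\<Theta> y = 1" by auto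
    have "\<Theta> 1 = \<Theta> 1 * \<Theta> y" by (simp add: y)
    also have "\<dots> = \<Theta> y" using mult[OF GA.cp.closed(3) y(1)] by simp
    finally show ?thesis by (simp add: y)
  qed
  have normalizing: "LB.normalizing_unitary (\<Theta> (crossed_unitary \<gamma>))" for \<gamma>
    unfolding LB.normalizing_unitary_def
  proof (intro conjI ballI)
    let ?x = "\<Theta> (crossed_unitary \<gamma>)"
    have uM: "crossed_unitary g \<in> GA.M" for g by (rule GA.unitary_in_crossed)
    have adjx: "adj ?x = \<Theta> (crossed_unitary (- \<gamma>))" using adj[OF uM[of \<gamma>]] by simp
    show "?x \<in> LB.M" using bij uM by (auto simp: bij_betw_def)
    show "adj ?x * ?x = 1" "?x * adj ?x = 1"
      unfolding adjx mult[OF uM uM, symmetric] crossed_unitary_add[symmetric] by (simp_all add: one)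
    \<comment> \<open>Image of the covariance relation; \<open>preimage\<close> and
      \<open>image\<close> rewrite both of its ends in terms of B.\<close>
    have twist: "?x * \<Theta> (GA.\<pi> a) = \<Theta> (GA.\<pi> (\<sigma> \<gamma> a)) * ?x" if "a \<in> A" for a
      by (simp only: mult[symmetric] uM GA.emb_in_crossed GA.act_closed GA.unitary_emb that)
    have preimage: "\<exists>a\<in>A. \<Theta> (GA.\<pi> a) = LB.\<pi> b" if "b \<in> B" for b
    proof -
      have "LB.\<pi> b \<in> \<Theta> ` GA.\<pi> ` A" unfolding assms(9) using that by (rule imageI)
      thus ?thesis by auto
    qed
    have image: "\<exists>b\<in>B. \<Theta> (GA.\<pi> a) = LB.\<pi> b" if "a \<in> A" for a
    proof -
      have "\<Theta> (GA.\<pi> a) \<in> LB.\<pi> ` B" unfolding assms(9)[symmetric] using that by (intro imageI)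
      thus ?thesis by auto
    qed
    show "\<exists>b'\<in>B. ?x * LB.\<pi> b = LB.\<pi> b' * ?x" if bB: "b \<in> B" for b
    proof -
      obtain a where a: "a \<in> A" "\<Theta> (GA.\<pi> a) = LB.\<pi> b" using preimage[OF bB] ..
      obtain b' where b': "b' \<in> B" "\<Theta> (GA.\<pi> (\<sigma> \<gamma> a)) = LB.\<pi> b'"
        using image[OF GA.act_closed[OF a(1)]] ..
      show ?thesis using twist[OF a(1)] unfolding a(2) b'(2) by (rule bexI[OF _ b'(1)])
    qed
    show "\<exists>b\<in>B. ?x * LB.\<pi> b = LB.\<pi> b' * ?x" if bB: "b' \<in> B" for b'
    proof -
      obtain a where a: "a \<in> A" "\<Theta> (GA.\<pi> a) = LB.\<pi> b'" using preimage[OF bB] ..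
      obtain b where b: "b \<in> B" "\<Theta> (GA.\<pi> (\<sigma> (- \<gamma>) a)) = LB.\<pi> b"
        using image[OF GA.act_closed[OF a(1)]] ..
      show ?thesis
        using twist[OF GA.act_closed[OF a(1), of "- \<gamma>"]] unfolding GA.act_inverse(2)[OF a(1)] a(2) b(2)
        by (rule bexI[OF _ b(1)])
    qed
  qed
  have "\<exists>D>0. \<exists>F. finite F \<and> F \<noteq> {} \<and> F \<subseteq> crossed_emb \<alpha> ` B \<and>
      (\<forall>x\<in>range (\<lambda>\<gamma>. \<Theta> (crossed_unitary \<gamma>)). \<exists>l. Max ((\<lambda>(b, c).
        cmod (crossed_trace \<tau>B (adj b * x * c * crossed_unitary l))) ` (F \<times> F)) \<ge> D)"
    by (rule LB.uniform_lower_bound[OF assms(6,8) _ assms(11,12,13)]) (use assms(14) normalizing in auto)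
  thus ?thesis by simp
qed

end
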